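(* Let $R$ be a principal ideal domain containing $\frac12$, let $r\ge1$, and let $\varphi:(A,d)\to(B,d)$ be a surjective morphism in $\mathrm{CDGA}_r(R)$ such that $H^*(A,d)$ and $H^*(B,d)$ satisfy condition (F). Then $\mathrm{secat}(\varphi)$ is the smallest $m$ for which $j_m:(A,d)\hookrightarrow(A\otimes\Lambda W_{(m)},\bar d)$ admits a cdga retraction (a cdga morphism $\varrho$ with $\varrho\circ j_m=\mathrm{id}_A$). In particular, if $X$ is a finite type $(r,\rho(R))$-mild CW-complex such that $H_*(\Omega X,R)$ is torsion free, and $(\Lambda V,d)\to C^*(L)$ is a decomposable minimal commutative model of its Cartan–Eilenberg–Chevalley complex $C^*(L)$, then $TC_n(X,R)=\mathrm{secat}(\mu_{\Lambda V,n})$, where $\mu_{\Lambda V,n}:(\Lambda V)^{\otimes n}\to\Lambda V$ is the $n$-fold product.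
   Context: All commutative differential graded algebras (cdga's) are over $R$, cohomologically graded; a quasi-isomorphism is a morphism inducing an isomorphism in (co)homology. $\rho(R)$ denotes the least non-invertible prime number in $R$ (or $\infty$). A cdga over $R$ is $(r,\rho(R))$-H-mild if its homology (apart from degree $0$) is concentrated in degrees $r+1$ through $r\rho(R)$ inclusive; $\mathrm{CDGA}_r(R)$ is the category of such cdga's. Condition (F) on a graded module $H=\{H^i\}_{i\ge0}$: $H$ is of finite type (each $H^i$ is finitely generated), $H^0=R$, $H^i=0$ for $1\le i\le r$, and $H^{r+1}$ is $R$-free. A commutative model of a cdga morphism $f:(C,d)\to(D,d)$ is an inclusion $i:(C,d)\hookrightarrow(C\otimes\Lambda V,d)$, $i(c)=c$, with $V$ a free graded $R$-module and $\Lambda V$ the free graded commutative algebra on $V$, together with a cdga quasi-isomorphism $\psi:(C\otimes\Lambda V,d)\to(D,d)$ with $\psi\circ i=f$. For a surjective $\varphi:(A,d)\to(B,d)$ and an integer $m$, let $i_m:(A^{\otimes m+1},d)\hookrightarrow(A^{\otimes m+1}\otimes\Lambda W_{(m)},d)$ be a commutative model of the projection $p_m:(A^{\otimes m+1},d)\to(A^{\otimes m+1}/(\ker\varphi)^{\otimes m+1},\overline d)$. Standing convention: $\varphi$ is initially a morphism of $(r,\rho(R'))$-H-mild cdga's over a ring $R'$, and the ring is changed to $R$ with $m\rho(R')\le\rho(R)$ so that $p_m$ becomes a morphism of $(r,\rho(R))$-H-mild cdga's to which the existence of commutative models applies. With $\mu_{m+1}:A^{\otimes m+1}\to A$ the multiplication,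 $j_m:(A,d)\hookrightarrow(A\otimes\Lambda W_{(m)},\bar d)$ is the pushout of $i_m$ along $\mu_{m+1}$ (with $\mu_{m+1}\otimes\mathrm{id}:A^{\otimes m+1}\otimes\Lambda W_{(m)}\to A\otimes\Lambda W_{(m)}$ the other structure map). $\mathrm{secat}(\varphi)$ is the smallest $m$ for which there is a cdga morphism $r_m:(A^{\otimes m+1}\otimes\Lambda W_{(m)},d)\to(A,d)$ with $r_m\circ i_m=\mu_{m+1}$. A CW-complex $X$ is $(r,\rho(R))$-mild if it is $r$-connected, of finite type and $\dim X\le r\rho(R)$. To such $X$ Anick and Halperin associate a differential graded Lie algebra $L=\{L_i\}_{i\ge1}$, each $L_i$ being $R$-free on a finite basis, with a dga quasi-isomorphism $UL\to C_*(\Omega X;R)$ preserving the diagonal up to dga homotopy; $C^*(L)$ is its Cartan–Eilenberg–Chevalley cochain complex, an augmented cdga equivalent to $C^*(X;R)$. When $H_*(\Omega X,R)$ is torsion free, $C^*(L)$ has a commutative decomposable model: a cdga quasi-isomorphism $(\Lambda V,d)\to C^*(L)$ with $V=\{V^i\}_{i\ge2}$, each $V^i$ $R$-free on a finite basis, and $d:V\to\Lambda^{\ge2}V$. The higher topological complexity over $R$, $TC_n(X,R)$ ($n\ge2$), is the value obtained by taking $A=(\Lambda V)^{\otimes n}$, $B=\Lambda V$ and $\varphi=\mu_{\Lambda V,n}$ in the definition of $\mathrm{secat}(\varphi)$ (the smallest $m$ for which there is a cdga morphism $r_m:(A^{\otimes m+1}\otimes\Lambda W_{(m)},d)\to(A,d)$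 with $r_m\circ i_m=\mu_{m+1}$, where $i_m$ is a commutative model of the projection $A^{\otimes m+1}\to A^{\otimes m+1}/(\ker\mu_{\Lambda V,n})^{\otimes m+1}$), i.e. it is defined as $\mathrm{secat}(\mu_{\Lambda V,n})$. *)

theory Defs
  imports "HOL-Homology.Homology" "HOL-Algebra.Ring_Divisibility"
    "HOL-Computational_Algebra.Primes" "HOL-Library.Extended_Nat"
begin

section \<open>Graded modules and differential graded algebras over a commutative ring\<close>

text \<open>
  Gradings are upper gradings by \<^typ>\<open>int\<close>, given internally by the subsets \<open>gr M i\<close> of the
  carrier.  Chain algebras and Lie algebras, which carry lower gradings, are encoded by the usual
  convention $M_i = M^{-i}$, so that every differential has degree $+1$.
\<close>

record ('r, 'a) gmodule = "('r, 'a) module" +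
  gr :: "int \<Rightarrow> 'a set"

record ('r, 'a) dg = "('r, 'a) gmodule" +
  dif :: "'a \<Rightarrow> 'a"

definition rho :: "('r, 'q) ring_scheme \<Rightarrow> enat" where
  "rho R = (INF p \<in> {p::nat. Factorial_Ring.prime p \<and> [p] \<cdot>\<^bsub>R\<^esub> \<one>\<^bsub>R\<^esub> \<notin> Units R}. enat p)"

definition sg :: "('r, 'q) ring_scheme \<Rightarrow> int \<Rightarrow> 'r" where
  "sg R k = (if even k then \<one>\<^bsub>R\<^esub> else \<ominus>\<^bsub>R\<^esub> \<one>\<^bsub>R\<^esub>)"

definition mod_span :: "('r, 'q) ring_scheme \<Rightarrow> ('r, 'a, 'm) module_scheme \<Rightarrow> 'a set \<Rightarrow> 'a set" where
  "mod_span R M S = \<Inter>{N. submodule N R M \<and> S \<subseteq> N}"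

definition fin_gen :: "('r, 'q) ring_scheme \<Rightarrow> ('r, 'a, 'm) module_scheme \<Rightarrow> bool" where
  "fin_gen R M \<longleftrightarrow> (\<exists>S. finite S \<and> S \<subseteq> carrier M \<and> mod_span R M S = carrier M)"

definition is_basis :: "('r, 'q) ring_scheme \<Rightarrow> ('r, 'a, 'm) module_scheme \<Rightarrow> 'a set \<Rightarrow> bool" where
  "is_basis R M B \<longleftrightarrow> B \<subseteq> carrier M \<and>
     (\<forall>x\<in>carrier M. \<exists>!c. (\<forall>b. c b \<in> carrier R) \<and> finite {b. c b \<noteq> \<zero>\<^bsub>R\<^esub>} \<and>
        {b. c b \<noteq> \<zero>\<^bsub>R\<^esub>} \<subseteq> B \<and> x = (\<Oplus>\<^bsub>M\<^esub>b\<in>{b. c b \<noteq> \<zero>\<^bsub>R\<^esub>}. c b \<odot>\<^bsub>M\<^esub> b))"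

definition free_module :: "('r, 'q) ring_scheme \<Rightarrow> ('r, 'a, 'm) module_scheme \<Rightarrow> bool" where
  "free_module R M \<longleftrightarrow> (\<exists>B. is_basis R M B)"

definition finite_free :: "('r, 'q) ring_scheme \<Rightarrow> ('r, 'a, 'm) module_scheme \<Rightarrow> bool" where
  "finite_free R M \<longleftrightarrow> (\<exists>B. finite B \<and> is_basis R M B)"

definition degree_part :: "('r, 'a, 'm) gmodule_scheme \<Rightarrow> int \<Rightarrow> ('r, 'a, 'm) gmodule_scheme" where
  "degree_part M i = M\<lparr>carrier := gr M i\<rparr>"

definition decomposition :: "('r, 'a, 'm) gmodule_scheme \<Rightarrow> 'a \<Rightarrow> (int \<Rightarrow> 'a) \<Rightarrow> bool" where
  "decomposition M x f \<longleftrightarrow> (\<forall>i. f i \<in> gr M i) \<and> finite {i. f i \<noteq> \<zero>\<^bsub>M\<^esub>} \<and>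
     x = (\<Oplus>\<^bsub>M\<^esub>i\<in>{i. f i \<noteq> \<zero>\<^bsub>M\<^esub>}. f i)"

definition hcomp :: "('r, 'a, 'm) gmodule_scheme \<Rightarrow> 'a \<Rightarrow> int \<Rightarrow> 'a" where
  "hcomp M x = (THE f. decomposition M x f)"

locale graded_module = module R M
  for R :: "('r, 'q) ring_scheme" (structure) and M :: "('r, 'a, 'm) gmodule_scheme" (structure) +
  assumes gr_submodule: "submodule (gr M i) R M"
    and direct_sum: "x \<in> carrier M \<Longrightarrow> \<exists>!f. decomposition M x f"

locale dg_module = graded_module R M
  for R :: "('r, 'q) ring_scheme" (structure) and M :: "('r, 'a, 'm) dg_scheme" (structure) +
  assumes dif_degree: "x \<in> gr M i \<Longrightarrow> dif M x \<in> gr M (i + 1)"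
    and dif_add: "x \<in> carrier M \<Longrightarrow> y \<in> carrier M \<Longrightarrow> dif M (x \<oplus>\<^bsub>M\<^esub> y) = dif M x \<oplus>\<^bsub>M\<^esub> dif M y"
    and dif_smult: "a \<in> carrier R \<Longrightarrow> x \<in> carrier M \<Longrightarrow> dif M (a \<odot>\<^bsub>M\<^esub> x) = a \<odot>\<^bsub>M\<^esub> dif M x"
    and dif_dif: "x \<in> carrier M \<Longrightarrow> dif M (dif M x) = \<zero>\<^bsub>M\<^esub>"

locale dg_algebra = dg_module R A + ring A
  for R :: "('r, 'q) ring_scheme" (structure) and A :: "('r, 'a, 'm) dg_scheme" (structure) +
  assumes smult_mult_left: "a \<in> carrier R \<Longrightarrow> x \<in> carrier A \<Longrightarrow> y \<in> carrier A \<Longrightarrow>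
      (a \<odot>\<^bsub>A\<^esub> x) \<otimes>\<^bsub>A\<^esub> y = a \<odot>\<^bsub>A\<^esub> (x \<otimes>\<^bsub>A\<^esub> y)"
    and smult_mult_right: "a \<in> carrier R \<Longrightarrow> x \<in> carrier A \<Longrightarrow> y \<in> carrier A \<Longrightarrow>
      x \<otimes>\<^bsub>A\<^esub> (a \<odot>\<^bsub>A\<^esub> y) = a \<odot>\<^bsub>A\<^esub> (x \<otimes>\<^bsub>A\<^esub> y)"
    and one_degree: "\<one>\<^bsub>A\<^esub> \<in> gr A 0"
    and mult_degree: "x \<in> gr A i \<Longrightarrow> y \<in> gr A j \<Longrightarrow> x \<otimes>\<^bsub>A\<^esub> y \<in> gr A (i + j)"
    and leibniz: "x \<in> gr A i \<Longrightarrow> y \<in> carrier A \<Longrightarrow>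
      dif A (x \<otimes>\<^bsub>A\<^esub> y) = (dif A x \<otimes>\<^bsub>A\<^esub> y) \<oplus>\<^bsub>A\<^esub> sg R i \<odot>\<^bsub>A\<^esub> (x \<otimes>\<^bsub>A\<^esub> dif A y)"

locale cdga = dg_algebra R A
  for R :: "('r, 'q) ring_scheme" (structure) and A :: "('r, 'a, 'm) dg_scheme" (structure) +
  assumes graded_comm: "x \<in> gr A i \<Longrightarrow> y \<in> gr A j \<Longrightarrow> x \<otimes>\<^bsub>A\<^esub> y = sg R (i * j) \<odot>\<^bsub>A\<^esub> (y \<otimes>\<^bsub>A\<^esub> x)"
    and nonneg_degrees: "i < 0 \<Longrightarrow> gr A i = {\<zero>\<^bsub>A\<^esub>}"

definition dga_mor ::
  "('r, 'q) ring_scheme \<Rightarrow> ('r, 'a, 'm) dg_scheme \<Rightarrow> ('r, 'b, 'n) dg_scheme \<Rightarrow> ('a \<Rightarrow> 'b) \<Rightarrow> bool" where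
  "dga_mor R A B f \<longleftrightarrow> f \<in> ring_hom A B \<and>
     (\<forall>a\<in>carrier R. \<forall>x\<in>carrier A. f (a \<odot>\<^bsub>A\<^esub> x) = a \<odot>\<^bsub>B\<^esub> f x) \<and>
     (\<forall>i. f ` gr A i \<subseteq> gr B i) \<and>
     (\<forall>x\<in>carrier A. f (dif A x) = dif B (f x))"


section \<open>Quotients and cohomology\<close>

text \<open>The quotient by a submodule \<open>N\<close>; it is used for graded submodules, and for two-sided
  differential ideals when the product matters.\<close>

definition factor_dg :: "('r, 'a, 'm) dg_scheme \<Rightarrow> 'a set \<Rightarrow> ('r, 'a set) dg" where
  "factor_dg M N =
    \<lparr>carrier = (\<lambda>x. N +>\<^bsub>M\<^esub> x) ` carrier M,
     monoid.mult = (\<lambda>X Y. \<Union>x\<in>X. \<Union>y\<in>Y. N +>\<^bsub>M\<^esub> (x \<otimes>\<^bsub>M\<^esub> y)),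
     one = N +>\<^bsub>M\<^esub> \<one>\<^bsub>M\<^esub>,
     zero = N,
     add = (\<lambda>X Y. X <+>\<^bsub>M\<^esub> Y),
     smult = (\<lambda>a X. \<Union>x\<in>X. N +>\<^bsub>M\<^esub> (a \<odot>\<^bsub>M\<^esub> x)),
     gr = (\<lambda>i. (\<lambda>x. N +>\<^bsub>M\<^esub> x) ` gr M i),
     dif = (\<lambda>X. \<Union>x\<in>X. N +>\<^bsub>M\<^esub> dif M x)\<rparr>"

definition cocycles :: "('r, 'a, 'm) dg_scheme \<Rightarrow> int \<Rightarrow> 'a set" where
  "cocycles A i = {x \<in> gr A i. dif A x = \<zero>\<^bsub>A\<^esub>}"

definition coboundaries :: "('r, 'a, 'm) dg_scheme \<Rightarrow> int \<Rightarrow> 'a set" where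
  "coboundaries A i = dif A ` gr A (i - 1)"

text \<open>\<open>cohom A i\<close> is the $R$-module $H^i(A)$; only its module fields are meaningful.\<close>

definition cohom :: "('r, 'a, 'm) dg_scheme \<Rightarrow> int \<Rightarrow> ('r, 'a set) dg" where
  "cohom A i = factor_dg (A\<lparr>carrier := cocycles A i\<rparr>) (coboundaries A i)"

definition quasi_iso ::
  "('r, 'q) ring_scheme \<Rightarrow> ('r, 'a, 'm) dg_scheme \<Rightarrow> ('r, 'b, 'n) dg_scheme \<Rightarrow> ('a \<Rightarrow> 'b) \<Rightarrow> bool" where
  "quasi_iso R A B f \<longleftrightarrow> dga_mor R A B f \<and>
     (\<forall>i. bij_betw (\<lambda>X. \<Union>x\<in>X. coboundaries B i +>\<^bsub>B\<^esub> f x)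
        (carrier (cohom A i)) (carrier (cohom B i)))"

definition mild_cdga :: "('r, 'q) ring_scheme \<Rightarrow> nat \<Rightarrow> ('r, 'a, 'm) dg_scheme \<Rightarrow> bool" where
  "mild_cdga R r A \<longleftrightarrow> cdga R A \<and>
     (\<forall>i. i \<noteq> 0 \<and> carrier (cohom A i) \<noteq> {\<zero>\<^bsub>cohom A i\<^esub>} \<longrightarrow>
        int r + 1 \<le> i \<and> enat (nat i) \<le> enat r * rho R)"

definition cond_F :: "('r, 'q) ring_scheme \<Rightarrow> nat \<Rightarrow> (int \<Rightarrow> ('r, 'a, 'm) module_scheme) \<Rightarrow> bool" where
  "cond_F R r H \<longleftrightarrow>
     (\<forall>i\<ge>0. fin_gen R (H i)) \<and>
     (\<exists>e\<in>carrier (H 0). bij_betw (\<lambda>a. a \<odot>\<^bsub>H 0\<^esub> e) (carrier R) (carrier (H 0))) \<and>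
     (\<forall>i. 1 \<le> i \<and> i \<le> int r \<longrightarrow> carrier (H i) = {\<zero>\<^bsub>H i\<^esub>}) \<and>
     free_module R (H (int r + 1))"


section \<open>Algebras given by generators and relations of the underlying module\<close>

text \<open>
  Tensor products, free graded commutative algebras, enveloping algebras and normalized chains are
  all quotients of a free $R$-module on a set \<open>gens\<close> of homogeneous generators (``words'') by the
  submodule spanned by \<open>rels\<close>.  Product and differential are prescribed on generators and extended
  (bi)linearly.
\<close>

record ('r, 'w) presentation =
  gens :: "'w set"
  wdeg :: "'w \<Rightarrow> int"
  wmult :: "'w \<Rightarrow> 'w \<Rightarrow> 'w \<Rightarrow> 'r"
  wunit :: 'w
  wdif :: "'w \<Rightarrow> 'w \<Rightarrow> 'r"
  rels :: "('w \<Rightarrow> 'r) set"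

type_synonym ('r, 'w) cls = "('w \<Rightarrow> 'r) set"
type_synonym ('r, 'a) words = "('r, (int \<times> 'a) list) cls"
type_synonym ('r, 'a, 'b) tens = "('r, (int \<times> 'a) \<times> (int \<times> 'b)) cls"

definition single :: "('r, 'q) ring_scheme \<Rightarrow> 'w \<Rightarrow> 'w \<Rightarrow> 'r" where
  "single R w = (\<lambda>u. if u = w then \<one>\<^bsub>R\<^esub> else \<zero>\<^bsub>R\<^esub>)"

definition fsupp :: "('r, 'q) ring_scheme \<Rightarrow> ('w \<Rightarrow> 'r) \<Rightarrow> 'w set" where
  "fsupp R f = {w. f w \<noteq> \<zero>\<^bsub>R\<^esub>}"

definition fadd :: "('r, 'q) ring_scheme \<Rightarrow> ('w \<Rightarrow> 'r) \<Rightarrow> ('w \<Rightarrow> 'r) \<Rightarrow> 'w \<Rightarrow> 'r" where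
  "fadd R f g = (\<lambda>u. f u \<oplus>\<^bsub>R\<^esub> g u)"

definition fsub :: "('r, 'q) ring_scheme \<Rightarrow> ('w \<Rightarrow> 'r) \<Rightarrow> ('w \<Rightarrow> 'r) \<Rightarrow> 'w \<Rightarrow> 'r" where
  "fsub R f g = (\<lambda>u. f u \<ominus>\<^bsub>R\<^esub> g u)"

definition fscale :: "('r, 'q) ring_scheme \<Rightarrow> 'r \<Rightarrow> ('w \<Rightarrow> 'r) \<Rightarrow> 'w \<Rightarrow> 'r" where
  "fscale R a f = (\<lambda>u. a \<otimes>\<^bsub>R\<^esub> f u)"

definition free_dg :: "('r, 'q) ring_scheme \<Rightarrow> ('r, 'w) presentation \<Rightarrow> ('r, 'w \<Rightarrow> 'r) dg" where
  "free_dg R P =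
    \<lparr>carrier = {f. (\<forall>w. f w \<in> carrier R) \<and> finite (fsupp R f) \<and> fsupp R f \<subseteq> gens P},
     monoid.mult = (\<lambda>f g u. \<Oplus>\<^bsub>R\<^esub>v\<in>fsupp R f. \<Oplus>\<^bsub>R\<^esub>w\<in>fsupp R g. f v \<otimes>\<^bsub>R\<^esub> g w \<otimes>\<^bsub>R\<^esub> wmult P v w u),
     one = single R (wunit P),
     zero = (\<lambda>u. \<zero>\<^bsub>R\<^esub>),
     add = fadd R,
     smult = fscale R,
     gr = (\<lambda>i. {f. (\<forall>w. f w \<in> carrier R) \<and> finite (fsupp R f) \<and>
                    fsupp R f \<subseteq> {w \<in> gens P. wdeg P w = i}}),
     dif = (\<lambda>f u. \<Oplus>\<^bsub>R\<^esub>w\<in>fsupp R f. f w \<otimes>\<^bsub>R\<^esub> wdif P w u)\<rparr>"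

definition rel_sub :: "('r, 'q) ring_scheme \<Rightarrow> ('r, 'w) presentation \<Rightarrow> ('w \<Rightarrow> 'r) set" where
  "rel_sub R P = mod_span R (free_dg R P) (rels P)"

definition presented :: "('r, 'q) ring_scheme \<Rightarrow> ('r, 'w) presentation \<Rightarrow> ('r, ('r, 'w) cls) dg" where
  "presented R P = factor_dg (free_dg R P) (rel_sub R P)"

definition pclass :: "('r, 'q) ring_scheme \<Rightarrow> ('r, 'w) presentation \<Rightarrow> ('w \<Rightarrow> 'r) \<Rightarrow> ('r, 'w) cls" where
  "pclass R P f = rel_sub R P +>\<^bsub>free_dg R P\<^esub> f"

text \<open>The linear map out of a presented module with prescribed values \<open>D\<close> on generators; meaningful
  whenever the linear extension of \<open>D\<close> vanishes on the relations.\<close>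

definition lin_ext ::
  "('r, 'q) ring_scheme \<Rightarrow> ('r, 't, 'm) module_scheme \<Rightarrow> ('w \<Rightarrow> 't) \<Rightarrow> ('r, 'w) cls \<Rightarrow> 't" where
  "lin_ext R T D X = the_elem ((\<lambda>f. \<Oplus>\<^bsub>T\<^esub>w\<in>fsupp R f. f w \<odot>\<^bsub>T\<^esub> D w) ` X)"


subsection \<open>Words in homogeneous elements\<close>

definition hwords :: "('r, 'a, 'm) gmodule_scheme \<Rightarrow> (int \<times> 'a) list set" where
  "hwords M = {w. \<forall>(i, x)\<in>set w. x \<in> gr M i}"

definition word_deg :: "(int \<times> 'a) list \<Rightarrow> int" where
  "word_deg w = sum_list (map fst w)"

definition multilinear_rels ::
  "('r, 'q) ring_scheme \<Rightarrow> ('r, 'a, 'm) gmodule_scheme \<Rightarrow> (int \<times> 'a) list set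
     \<Rightarrow> ((int \<times> 'a) list \<Rightarrow> 'r) set" where
  "multilinear_rels R M S =
     {fsub R (single R (xs @ (i, x \<oplus>\<^bsub>M\<^esub> y) # ys))
             (fadd R (single R (xs @ (i, x) # ys)) (single R (xs @ (i, y) # ys))) | xs ys i x y.
        x \<in> gr M i \<and> y \<in> gr M i \<and> xs @ (i, x) # ys \<in> S} \<union>
     {fsub R (single R (xs @ (i, a \<odot>\<^bsub>M\<^esub> x) # ys)) (fscale R a (single R (xs @ (i, x) # ys))) | xs ys i a x.
        a \<in> carrier R \<and> x \<in> gr M i \<and> xs @ (i, x) # ys \<in> S}"

text \<open>The derivation $x_1 \cdots x_n \mapsto \sum_k \pm x_1 \cdots d x_k \cdots x_n$.\<close>

definition word_dif ::
  "('r, 'q) ring_scheme \<Rightarrow> ('a \<Rightarrow> 'a) \<Rightarrow> (int \<times> 'a) list \<Rightarrow> (int \<times> 'a) list \<Rightarrow> 'r" where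
  "word_dif R d w = (\<lambda>u. \<Oplus>\<^bsub>R\<^esub>k\<in>{..<length w}.
     sg R (word_deg (take k w)) \<otimes>\<^bsub>R\<^esub> single R (w[k := (fst (w ! k) + 1, d (snd (w ! k)))]) u)"


subsection \<open>Tensor powers\<close>

definition tpow_pres ::
  "('r, 'q) ring_scheme \<Rightarrow> ('r, 'a, 'm) dg_scheme \<Rightarrow> nat \<Rightarrow> ('r, (int \<times> 'a) list) presentation" where
  "tpow_pres R A n =
    \<lparr>gens = {w \<in> hwords A. length w = n},
     wdeg = word_deg,
     wmult = (\<lambda>v w. fscale R (sg R (\<Sum>i<n. \<Sum>j<i. fst (v ! i) * fst (w ! j)))
        (single R (map2 (\<lambda>(i, x) (j, y). (i + j, x \<otimes>\<^bsub>A\<^esub> y)) v w))),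
     wunit = replicate n (0, \<one>\<^bsub>A\<^esub>),
     wdif = word_dif R (dif A),
     rels = multilinear_rels R A {w \<in> hwords A. length w = n}\<rparr>"

definition tpow :: "('r, 'q) ring_scheme \<Rightarrow> ('r, 'a, 'm) dg_scheme \<Rightarrow> nat \<Rightarrow> ('r, ('r, 'a) words) dg" where
  "tpow R A n = presented R (tpow_pres R A n)"

definition mu :: "('r, 'q) ring_scheme \<Rightarrow> ('r, 'a, 'm) dg_scheme \<Rightarrow> ('r, 'a) words \<Rightarrow> 'a" where
  "mu R A = lin_ext R A (\<lambda>w. foldr (\<lambda>p y. snd p \<otimes>\<^bsub>A\<^esub> y) w \<one>\<^bsub>A\<^esub>)"

text \<open>$(\ker\varphi)^{\otimes n}$, as the (differential) ideal of $A^{\otimes n}$ spanned by the pure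
  tensors all of whose factors lie in $\ker\varphi$.\<close>

definition ker_tpow ::
  "('r, 'q) ring_scheme \<Rightarrow> ('r, 'a, 'm) dg_scheme \<Rightarrow> ('r, 'b, 'n) dg_scheme \<Rightarrow> ('a \<Rightarrow> 'b) \<Rightarrow> nat
     \<Rightarrow> ('r, 'a) words set" where
  "ker_tpow R A B \<phi> n = mod_span R (tpow R A n)
     ((\<lambda>w. pclass R (tpow_pres R A n) (single R w)) `
        {w \<in> hwords A. length w = n \<and> (\<forall>(i, x)\<in>set w. \<phi> x = \<zero>\<^bsub>B\<^esub>)})"

definition quot_tpow ::
  "('r, 'q) ring_scheme \<Rightarrow> ('r, 'a, 'm) dg_scheme \<Rightarrow> ('r, 'b, 'n) dg_scheme \<Rightarrow> ('a \<Rightarrow> 'b) \<Rightarrow> nat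
     \<Rightarrow> ('r, ('r, 'a) words set) dg" where
  "quot_tpow R A B \<phi> n = factor_dg (tpow R A n) (ker_tpow R A B \<phi> n)"

definition proj_tpow ::
  "('r, 'q) ring_scheme \<Rightarrow> ('r, 'a, 'm) dg_scheme \<Rightarrow> ('r, 'b, 'n) dg_scheme \<Rightarrow> ('a \<Rightarrow> 'b) \<Rightarrow> nat
     \<Rightarrow> ('r, 'a) words \<Rightarrow> ('r, 'a) words set" where
  "proj_tpow R A B \<phi> n = (\<lambda>x. ker_tpow R A B \<phi> n +>\<^bsub>tpow R A n\<^esub> x)"


subsection \<open>Tensor product of two algebras\<close>

definition tensor_pres ::
  "('r, 'q) ring_scheme \<Rightarrow> ('r, 'a, 'm) dg_scheme \<Rightarrow> ('r, 'b, 'n) dg_scheme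
     \<Rightarrow> ('r, (int \<times> 'a) \<times> (int \<times> 'b)) presentation" where
  "tensor_pres R A B =
    \<lparr>gens = {((i, a), (j, b)) | i a j b. a \<in> gr A i \<and> b \<in> gr B j},
     wdeg = (\<lambda>((i, a), (j, b)). i + j),
     wmult = (\<lambda>((i, a), (j, b)) ((i', a'), (j', b')).
        fscale R (sg R (j * i')) (single R ((i + i', a \<otimes>\<^bsub>A\<^esub> a'), (j + j', b \<otimes>\<^bsub>B\<^esub> b')))),
     wunit = ((0, \<one>\<^bsub>A\<^esub>), (0, \<one>\<^bsub>B\<^esub>)),
     wdif = (\<lambda>((i, a), (j, b)).
        fadd R (single R ((i + 1, dif A a), (j, b))) (fscale R (sg R i) (single R ((i, a), (j + 1, dif B b))))),
     rels =
       {fsub R (single R ((i, a \<oplus>\<^bsub>A\<^esub> a'), (j, b))) (fadd R (single R ((i, a), (j, b))) (single R ((i, a'), (j, b)))) |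
          i a a' j b. a \<in> gr A i \<and> a' \<in> gr A i \<and> b \<in> gr B j} \<union>
       {fsub R (single R ((i, a), (j, b \<oplus>\<^bsub>B\<^esub> b'))) (fadd R (single R ((i, a), (j, b))) (single R ((i, a), (j, b')))) |
          i a j b b'. a \<in> gr A i \<and> b \<in> gr B j \<and> b' \<in> gr B j} \<union>
       {fsub R (single R ((i, c \<odot>\<^bsub>A\<^esub> a), (j, b))) (fscale R c (single R ((i, a), (j, b)))) |
          c i a j b. c \<in> carrier R \<and> a \<in> gr A i \<and> b \<in> gr B j} \<union>
       {fsub R (single R ((i, a), (j, c \<odot>\<^bsub>B\<^esub> b))) (fscale R c (single R ((i, a), (j, b)))) |
          c i a j b. c \<in> carrier R \<and> a \<in> gr A i \<and> b \<in> gr B j}\<rparr>"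

definition tensor ::
  "('r, 'q) ring_scheme \<Rightarrow> ('r, 'a, 'm) dg_scheme \<Rightarrow> ('r, 'b, 'n) dg_scheme \<Rightarrow> ('r, ('r, 'a, 'b) tens) dg" where
  "tensor R A B = presented R (tensor_pres R A B)"

text \<open>The pure tensor $a \otimes b$ of homogeneous elements, each paired with its degree.\<close>

definition pure ::
  "('r, 'q) ring_scheme \<Rightarrow> ('r, 'a, 'm) dg_scheme \<Rightarrow> ('r, 'b, 'n) dg_scheme
     \<Rightarrow> int \<times> 'a \<Rightarrow> int \<times> 'b \<Rightarrow> ('r, 'a, 'b) tens" where
  "pure R A B p q = pclass R (tensor_pres R A B) (single R (p, q))"

text \<open>$a \mapsto a \otimes 1$.\<close>

definition incl ::
  "('r, 'q) ring_scheme \<Rightarrow> ('r, 'a, 'm) dg_scheme \<Rightarrow> ('r, 'b, 'n) dg_scheme \<Rightarrow> 'a \<Rightarrow> ('r, 'a, 'b) tens" where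
  "incl R A B a = (\<Oplus>\<^bsub>tensor R A B\<^esub>i\<in>{i. hcomp A a i \<noteq> \<zero>\<^bsub>A\<^esub>}. pure R A B (i, hcomp A a i) (0, \<one>\<^bsub>B\<^esub>))"

text \<open>$f \otimes g : A \otimes B \to A' \otimes B'$, for $f$ and $g$ of degree $0$.\<close>

definition tensor_map ::
  "('r, 'q) ring_scheme \<Rightarrow> ('r, 'a2, 'm) dg_scheme \<Rightarrow> ('r, 'b2, 'n) dg_scheme \<Rightarrow> ('a \<Rightarrow> 'a2) \<Rightarrow> ('b \<Rightarrow> 'b2)
     \<Rightarrow> ('r, 'a, 'b) tens \<Rightarrow> ('r, 'a2, 'b2) tens" where
  "tensor_map R A' B' f g =
     lin_ext R (tensor R A' B') (\<lambda>((i, a), (j, b)). pure R A' B' (i, f a) (j, g b))"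


section \<open>Free graded commutative algebras and commutative models\<close>

text \<open>The relations $x^2 = 0$ in odd degrees are implied, since \<open>\<Lambda>\<close> is only used over rings
  containing $\frac12$.  The differential of \<open>free_cga\<close> is zero; other differentials on $\Lambda V$ or
  $C \otimes \Lambda V$ are put in by record update.\<close>

definition free_cga_pres ::
  "('r, 'q) ring_scheme \<Rightarrow> ('r, 'v, 'm) gmodule_scheme \<Rightarrow> ('r, (int \<times> 'v) list) presentation" where
  "free_cga_pres R V =
    \<lparr>gens = hwords V,
     wdeg = word_deg,
     wmult = (\<lambda>v w. single R (v @ w)),
     wunit = [],
     wdif = (\<lambda>w u. \<zero>\<^bsub>R\<^esub>),
     rels = multilinear_rels R V (hwords V) \<union>
       {fsub R (single R (xs @ [(i, x), (j, y)] @ ys))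
               (fscale R (sg R (i * j)) (single R (xs @ [(j, y), (i, x)] @ ys))) | xs ys i x j y.
          xs @ [(i, x), (j, y)] @ ys \<in> hwords V}\<rparr>"

definition free_cga :: "('r, 'q) ring_scheme \<Rightarrow> ('r, 'v, 'm) gmodule_scheme \<Rightarrow> ('r, ('r, 'v) words) dg"
    ("\<Lambda>") where
  "\<Lambda> R V = presented R (free_cga_pres R V)"

definition lam :: "('r, 'q) ring_scheme \<Rightarrow> ('r, 'v, 'm) gmodule_scheme \<Rightarrow> int \<Rightarrow> 'v \<Rightarrow> ('r, 'v) words" where
  "lam R V i v = pclass R (free_cga_pres R V) (single R [(i, v)])"

definition free_graded :: "('r, 'q) ring_scheme \<Rightarrow> ('r, 'v, 'm) gmodule_scheme \<Rightarrow> bool" where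
  "free_graded R V \<longleftrightarrow> graded_module R V \<and> (\<forall>i. free_module R (degree_part V i))"

definition rel_free ::
  "('r, 'q) ring_scheme \<Rightarrow> ('r, 'c, 'm) dg_scheme \<Rightarrow> ('r, 'v) gmodule
     \<Rightarrow> (('r, 'c, ('r, 'v) words) tens \<Rightarrow> ('r, 'c, ('r, 'v) words) tens)
     \<Rightarrow> ('r, ('r, 'c, ('r, 'v) words) tens) dg" where
  "rel_free R C V d = (tensor R C (\<Lambda> R V))\<lparr>dif := d\<rparr>"

definition comm_model ::
  "('r, 'q) ring_scheme \<Rightarrow> ('r, 'c, 'm) dg_scheme \<Rightarrow> ('r, 'b, 'n) dg_scheme \<Rightarrow> ('c \<Rightarrow> 'b)
     \<Rightarrow> ('r, 'v) gmodule \<Rightarrow> (('r, 'c, ('r, 'v) words) tens \<Rightarrow> ('r, 'c, ('r, 'v) words) tens) \<Rightarrow> bool" where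
  "comm_model R C D f V d \<longleftrightarrow>
     free_graded R V \<and> cdga R (rel_free R C V d) \<and>
     dga_mor R C (rel_free R C V d) (incl R C (\<Lambda> R V)) \<and>
     (\<exists>\<psi>. quasi_iso R (rel_free R C V d) D \<psi> \<and>
          (\<forall>c\<in>carrier C. \<psi> (incl R C (\<Lambda> R V) c) = f c))"

text \<open>Pushout of $C \hookrightarrow (C \otimes \Lambda W, d)$ along $f : C \to A$: the algebra
  $A \otimes \Lambda W$ with $\bar d(a \otimes w) = da \otimes w + (-1)^{|a|}\, a \cdot (f \otimes 1)(d(1 \otimes w))$,
  which is the only differential for which $a \mapsto a \otimes 1$ and $f \otimes 1$ commute with the
  differentials.\<close>

definition pushout_dif ::
  "('r, 'q) ring_scheme \<Rightarrow> ('r, 'c, 'm) dg_scheme \<Rightarrow> ('r, 'a, 'n) dg_scheme \<Rightarrow> ('c \<Rightarrow> 'a) \<Rightarrow> ('r, 'v) gmodule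
     \<Rightarrow> (('r, 'c, ('r, 'v) words) tens \<Rightarrow> ('r, 'c, ('r, 'v) words) tens)
     \<Rightarrow> ('r, 'a, ('r, 'v) words) tens \<Rightarrow> ('r, 'a, ('r, 'v) words) tens" where
  "pushout_dif R C A f W d =
     lin_ext R (tensor R A (\<Lambda> R W)) (\<lambda>((i, a), (j, w)).
       pure R A (\<Lambda> R W) (i + 1, dif A a) (j, w) \<oplus>\<^bsub>tensor R A (\<Lambda> R W)\<^esub>
       sg R i \<odot>\<^bsub>tensor R A (\<Lambda> R W)\<^esub>
         (pure R A (\<Lambda> R W) (i, a) (0, \<one>\<^bsub>\<Lambda> R W\<^esub>) \<otimes>\<^bsub>tensor R A (\<Lambda> R W)\<^esub>
          tensor_map R A (\<Lambda> R W) f (\<lambda>x. x) (d (pure R C (\<Lambda> R W) (0, \<one>\<^bsub>C\<^esub>) (j, w)))))"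

definition pushout ::
  "('r, 'q) ring_scheme \<Rightarrow> ('r, 'c, 'm) dg_scheme \<Rightarrow> ('r, 'a, 'n) dg_scheme \<Rightarrow> ('c \<Rightarrow> 'a) \<Rightarrow> ('r, 'v) gmodule
     \<Rightarrow> (('r, 'c, ('r, 'v) words) tens \<Rightarrow> ('r, 'c, ('r, 'v) words) tens)
     \<Rightarrow> ('r, ('r, 'a, ('r, 'v) words) tens) dg" where
  "pushout R C A f W d = rel_free R A W (pushout_dif R C A f W d)"


section \<open>Sectional category\<close>

text \<open>
  A choice of commutative models $i_m$ of the projections
  $p_m : A^{\otimes m+1} \to A^{\otimes m+1}/(\ker\varphi)^{\otimes m+1}$ is a partial function \<open>Ms\<close>
  with \<open>Ms m = Some (W, d)\<close> when $i_m : A^{\otimes m+1} \hookrightarrow (A^{\otimes m+1} \otimes \Lambda W, d)$.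
  Its domain is an initial segment of \<open>nat\<close>, possibly all of it: over a ring with finite \<open>rho\<close> only
  those \<open>m\<close> are considered for which $p_m$ is a morphism of $(r,\rho(R))$-H-mild algebras.
\<close>

type_synonym ('r, 'a, 'w) models =
  "nat \<Rightarrow> (('r, 'w) gmodule \<times>
     (('r, ('r, 'a) words, ('r, 'w) words) tens \<Rightarrow> ('r, ('r, 'a) words, ('r, 'w) words) tens)) option"

definition model_family ::
  "('r, 'q) ring_scheme \<Rightarrow> nat \<Rightarrow> ('r, 'a, 'm) dg_scheme \<Rightarrow> ('r, 'b, 'n) dg_scheme \<Rightarrow> ('a \<Rightarrow> 'b)
     \<Rightarrow> ('r, 'a, 'w) models \<Rightarrow> bool" where
  "model_family R r A B \<phi> Ms \<longleftrightarrow>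
     (\<forall>m k. k \<le> m \<and> Ms m \<noteq> None \<longrightarrow> Ms k \<noteq> None) \<and>
     (\<forall>m W d. Ms m = Some (W, d) \<longrightarrow>
        mild_cdga R r (tpow R A (Suc m)) \<and> mild_cdga R r (quot_tpow R A B \<phi> (Suc m)) \<and>
        comm_model R (tpow R A (Suc m)) (quot_tpow R A B \<phi> (Suc m)) (proj_tpow R A B \<phi> (Suc m)) W d)"

definition secat ::
  "('r, 'q) ring_scheme \<Rightarrow> ('r, 'a, 'm) dg_scheme \<Rightarrow> ('r, 'b, 'n) dg_scheme \<Rightarrow> ('a \<Rightarrow> 'b)
     \<Rightarrow> ('r, 'a, 'w) models \<Rightarrow> enat" where
  "secat R A B \<phi> Ms = Inf {enat m | m W d. Ms m = Some (W, d) \<and>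
     comm_model R (tpow R A (Suc m)) (quot_tpow R A B \<phi> (Suc m)) (proj_tpow R A B \<phi> (Suc m)) W d \<and>
     (\<exists>\<rho>. dga_mor R (rel_free R (tpow R A (Suc m)) W d) A \<rho> \<and>
          (\<forall>x\<in>carrier (tpow R A (Suc m)). \<rho> (incl R (tpow R A (Suc m)) (\<Lambda> R W) x) = mu R A x))}"


section \<open>Differential graded Lie algebras\<close>

record ('r, 'l) dgl = "('r, 'l) dg" +
  brk :: "'l \<Rightarrow> 'l \<Rightarrow> 'l"

text \<open>$L_i$ is \<open>gr L (- i)\<close>.  Over a ring containing $\frac12$, $[x,x] = 0$ for even $x$ follows from
  antisymmetry, but $[x,[x,x]] = 0$ for odd $x$ has to be required as 3 need not be invertible.\<close>

locale dg_lie = dg_module R L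
  for R :: "('r, 'q) ring_scheme" (structure) and L :: "('r, 'l, 'm) dgl_scheme" (structure) +
  assumes brk_add_left: "x \<in> carrier L \<Longrightarrow> y \<in> carrier L \<Longrightarrow> z \<in> carrier L \<Longrightarrow>
      brk L (x \<oplus>\<^bsub>L\<^esub> y) z = brk L x z \<oplus>\<^bsub>L\<^esub> brk L y z"
    and brk_add_right: "x \<in> carrier L \<Longrightarrow> y \<in> carrier L \<Longrightarrow> z \<in> carrier L \<Longrightarrow>
      brk L x (y \<oplus>\<^bsub>L\<^esub> z) = brk L x y \<oplus>\<^bsub>L\<^esub> brk L x z"
    and brk_smult_left: "a \<in> carrier R \<Longrightarrow> x \<in> carrier L \<Longrightarrow> y \<in> carrier L \<Longrightarrow>
      brk L (a \<odot>\<^bsub>L\<^esub> x) y = a \<odot>\<^bsub>L\<^esub> brk L x y"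
    and brk_smult_right: "a \<in> carrier R \<Longrightarrow> x \<in> carrier L \<Longrightarrow> y \<in> carrier L \<Longrightarrow>
      brk L x (a \<odot>\<^bsub>L\<^esub> y) = a \<odot>\<^bsub>L\<^esub> brk L x y"
    and brk_degree: "x \<in> gr L i \<Longrightarrow> y \<in> gr L j \<Longrightarrow> brk L x y \<in> gr L (i + j)"
    and antisym: "x \<in> gr L i \<Longrightarrow> y \<in> gr L j \<Longrightarrow> brk L x y = \<ominus>\<^bsub>L\<^esub> (sg R (i * j) \<odot>\<^bsub>L\<^esub> brk L y x)"
    and jacobi: "x \<in> gr L i \<Longrightarrow> y \<in> gr L j \<Longrightarrow> z \<in> gr L k \<Longrightarrow>
      brk L x (brk L y z) = brk L (brk L x y) z \<oplus>\<^bsub>L\<^esub> sg R (i * j) \<odot>\<^bsub>L\<^esub> brk L y (brk L x z)"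
    and odd_cube: "x \<in> gr L i \<Longrightarrow> odd i \<Longrightarrow> brk L x (brk L x x) = \<zero>\<^bsub>L\<^esub>"
    and brk_leibniz: "x \<in> gr L i \<Longrightarrow> y \<in> carrier L \<Longrightarrow>
      dif L (brk L x y) = brk L (dif L x) y \<oplus>\<^bsub>L\<^esub> sg R i \<odot>\<^bsub>L\<^esub> brk L x (dif L y)"

definition env_pres ::
  "('r, 'q) ring_scheme \<Rightarrow> ('r, 'l, 'm) dgl_scheme \<Rightarrow> ('r, (int \<times> 'l) list) presentation" where
  "env_pres R L =
    \<lparr>gens = hwords L,
     wdeg = word_deg,
     wmult = (\<lambda>v w. single R (v @ w)),
     wunit = [],
     wdif = word_dif R (dif L),
     rels = multilinear_rels R L (hwords L) \<union>
       {fsub R (single R (xs @ [(i, x), (j, y)] @ ys))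
               (fadd R (fscale R (sg R (i * j)) (single R (xs @ [(j, y), (i, x)] @ ys)))
                       (single R (xs @ [(i + j, brk L x y)] @ ys))) | xs ys i x j y.
          xs @ [(i, x), (j, y)] @ ys \<in> hwords L}\<rparr>"

definition env :: "('r, 'q) ring_scheme \<Rightarrow> ('r, 'l, 'm) dgl_scheme \<Rightarrow> ('r, ('r, 'l) words) dg" where
  "env R L = presented R (env_pres R L)"

definition env_gen ::
  "('r, 'q) ring_scheme \<Rightarrow> ('r, 'l, 'm) dgl_scheme \<Rightarrow> int \<Rightarrow> 'l \<Rightarrow> ('r, 'l) words" where
  "env_gen R L i x = pclass R (env_pres R L) (single R [(i, x)])"

text \<open>The diagonal of $UL$: the morphism for which the elements of $L$ are primitive.\<close>

definition env_diagonal ::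
  "('r, 'q) ring_scheme \<Rightarrow> ('r, 'l, 'm) dgl_scheme
     \<Rightarrow> (('r, 'l) words \<Rightarrow> ('r, ('r, 'l) words, ('r, 'l) words) tens) \<Rightarrow> bool" where
  "env_diagonal R L \<Delta> \<longleftrightarrow> dga_mor R (env R L) (tensor R (env R L) (env R L)) \<Delta> \<and>
     (\<forall>i. \<forall>x\<in>gr L i. \<Delta> (env_gen R L i x) =
        pure R (env R L) (env R L) (i, env_gen R L i x) (0, \<one>\<^bsub>env R L\<^esub>)
        \<oplus>\<^bsub>tensor R (env R L) (env R L)\<^esub>
        pure R (env R L) (env R L) (0, \<one>\<^bsub>env R L\<^esub>) (i, env_gen R L i x))"

text \<open>Homotopy of algebra morphisms: a chain homotopy which is an $(f,g)$-derivation.\<close>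

definition dga_homotopic ::
  "('r, 'q) ring_scheme \<Rightarrow> ('r, 'a, 'm) dg_scheme \<Rightarrow> ('r, 'b, 'n) dg_scheme
     \<Rightarrow> ('a \<Rightarrow> 'b) \<Rightarrow> ('a \<Rightarrow> 'b) \<Rightarrow> bool" where
  "dga_homotopic R A B f g \<longleftrightarrow> dga_mor R A B f \<and> dga_mor R A B g \<and>
     (\<exists>h. (\<forall>i. h ` gr A i \<subseteq> gr B (i - 1)) \<and>
        (\<forall>x\<in>carrier A. \<forall>y\<in>carrier A. h (x \<oplus>\<^bsub>A\<^esub> y) = h x \<oplus>\<^bsub>B\<^esub> h y) \<and>
        (\<forall>a\<in>carrier R. \<forall>x\<in>carrier A. h (a \<odot>\<^bsub>A\<^esub> x) = a \<odot>\<^bsub>B\<^esub> h x) \<and>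
        (\<forall>i. \<forall>x\<in>gr A i. \<forall>y\<in>carrier A.
           h (x \<otimes>\<^bsub>A\<^esub> y) = (h x \<otimes>\<^bsub>B\<^esub> g y) \<oplus>\<^bsub>B\<^esub> sg R i \<odot>\<^bsub>B\<^esub> (f x \<otimes>\<^bsub>B\<^esub> h y)) \<and>
        (\<forall>x\<in>carrier A. f x \<ominus>\<^bsub>B\<^esub> g x = dif B (h x) \<oplus>\<^bsub>B\<^esub> h (dif A x)))"


subsection \<open>The Cartan--Eilenberg--Chevalley cochain algebra\<close>

text \<open>
  $C^*(L) = \Lambda W$ with $W = \mathrm{Hom}(sL, R)$, which for $L$ of finite type is the dual of the
  chain coalgebra $\Gamma(sL)$.  An element of $W^k = \mathrm{Hom}(L_{k-1}, R)$ is represented by a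
  linear form on \<open>L\<close> that vanishes on \<open>gr L j\<close> for \<open>j \<noteq> 1 - k\<close>, with \<open>v x\<close> standing for
  $\langle v, sx\rangle$.
\<close>

definition ce_gens :: "('r, 'q) ring_scheme \<Rightarrow> ('r, 'l, 'm) dgl_scheme \<Rightarrow> ('r, 'l \<Rightarrow> 'r) gmodule" where
  "ce_gens R L = (let forms = {v. v \<in> carrier L \<rightarrow> carrier R \<and> (\<forall>x. x \<notin> carrier L \<longrightarrow> v x = \<zero>\<^bsub>R\<^esub>) \<and>
        (\<forall>x\<in>carrier L. \<forall>y\<in>carrier L. v (x \<oplus>\<^bsub>L\<^esub> y) = v x \<oplus>\<^bsub>R\<^esub> v y) \<and>
        (\<forall>a\<in>carrier R. \<forall>x\<in>carrier L. v (a \<odot>\<^bsub>L\<^esub> x) = a \<otimes>\<^bsub>R\<^esub> v x)} in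
    \<lparr>carrier = {v \<in> forms. finite {j. \<exists>x\<in>gr L j. v x \<noteq> \<zero>\<^bsub>R\<^esub>}},
     monoid.mult = undefined, one = undefined,
     zero = (\<lambda>x. \<zero>\<^bsub>R\<^esub>),
     add = fadd R,
     smult = fscale R,
     gr = (\<lambda>k. {v \<in> forms. \<forall>j. j \<noteq> 1 - k \<longrightarrow> (\<forall>x\<in>gr L j. v x = \<zero>\<^bsub>R\<^esub>)})\<rparr>)"

text \<open>$\langle vu, sx \wedge sy\rangle = (-1)^{|v||u|} v(sx)u(sy) + v(sy)u(sx)$, the Koszul-signed pairing
  between $\Lambda^2W$ and $sL \otimes sL$.\<close>

definition ce_pairing ::
  "('r, 'q) ring_scheme \<Rightarrow> (int \<times> ('l \<Rightarrow> 'r)) list \<Rightarrow> 'l \<Rightarrow> 'l \<Rightarrow> 'r" where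
  "ce_pairing R w x y = (let (k, v) = w ! 0; (l, u) = w ! 1 in
     sg R (k * l) \<otimes>\<^bsub>R\<^esub> (v x \<otimes>\<^bsub>R\<^esub> u y) \<oplus>\<^bsub>R\<^esub> (v y \<otimes>\<^bsub>R\<^esub> u x))"

text \<open>The differential is the derivation with $d v = d_0 v + d_1 v$ on $v \in W^k$, where $d_0 v \in W$,
  $d_1 v \in \Lambda^2 W$, $\langle d_0 v, sx\rangle = (-1)^k \langle v, s\,dx\rangle$ and
  $\langle d_1 v, sx \wedge sy\rangle = (-1)^{|y|+1}\langle v, s[x,y]\rangle$.  The element $d_1 v$ is
  represented by a combination \<open>q\<close> of words of length two.\<close>

definition ce_dif ::
  "('r, 'q) ring_scheme \<Rightarrow> ('r, 'l, 'm) dgl_scheme \<Rightarrow> (('r, 'l \<Rightarrow> 'r) words \<Rightarrow> ('r, 'l \<Rightarrow> 'r) words) \<Rightarrow> bool" where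
  "ce_dif R L d \<longleftrightarrow>
     cdga R ((\<Lambda> R (ce_gens R L))\<lparr>dif := d\<rparr>) \<and>
     (\<forall>k. \<forall>v\<in>gr (ce_gens R L) k. \<exists>q\<in>carrier (free_dg R (free_cga_pres R (ce_gens R L))).
        fsupp R q \<subseteq> {w. length w = 2} \<and>
        d (lam R (ce_gens R L) k v) =
          lam R (ce_gens R L) (k + 1) (\<lambda>x. if x \<in> carrier L then sg R k \<otimes>\<^bsub>R\<^esub> v (dif L x) else \<zero>\<^bsub>R\<^esub>)
          \<oplus>\<^bsub>\<Lambda> R (ce_gens R L)\<^esub> pclass R (free_cga_pres R (ce_gens R L)) q \<and>
        (\<forall>i j. \<forall>x\<in>gr L i. \<forall>y\<in>gr L j.
           (\<Oplus>\<^bsub>R\<^esub>w\<in>fsupp R q. q w \<otimes>\<^bsub>R\<^esub> ce_pairing R w x y) = sg R (j + 1) \<otimes>\<^bsub>R\<^esub> v (brk L x y)))"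

text \<open>The conditions in \<open>ce_dif\<close> determine the differential on the carrier.\<close>

definition ce_complex ::
  "('r, 'q) ring_scheme \<Rightarrow> ('r, 'l, 'm) dgl_scheme \<Rightarrow> ('r, ('r, 'l \<Rightarrow> 'r) words) dg" where
  "ce_complex R L = (\<Lambda> R (ce_gens R L))\<lparr>dif := (SOME d. ce_dif R L d)\<rparr>"

definition decomposable_model ::
  "('r, 'q) ring_scheme \<Rightarrow> ('r, 'l, 'm) dgl_scheme \<Rightarrow> ('r, 'v) gmodule \<Rightarrow> (('r, 'v) words \<Rightarrow> ('r, 'v) words)
     \<Rightarrow> (('r, 'v) words \<Rightarrow> ('r, 'l \<Rightarrow> 'r) words) \<Rightarrow> bool" where
  "decomposable_model R L V d \<kappa> \<longleftrightarrow>
     graded_module R V \<and> (\<forall>i. finite_free R (degree_part V i)) \<and> (\<forall>i<2. gr V i = {\<zero>\<^bsub>V\<^esub>}) \<and>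
     cdga R ((\<Lambda> R V)\<lparr>dif := d\<rparr>) \<and>
     (\<forall>i. \<forall>v\<in>gr V i. d (lam R V i v) \<in>
        mod_span R (\<Lambda> R V) ((\<lambda>w. pclass R (free_cga_pres R V) (single R w)) ` {w \<in> hwords V. 2 \<le> length w})) \<and>
     quasi_iso R ((\<Lambda> R V)\<lparr>dif := d\<rparr>) (ce_complex R L) \<kappa>"


section \<open>Mild CW-complexes and chains on the loop space\<close>

definition disc :: "nat \<Rightarrow> (nat \<Rightarrow> real) topology" where
  "disc n = subtopology (Euclidean_space n) {x. (\<Sum>i<n. (x i)\<^sup>2) \<le> 1}"

definition open_disc :: "nat \<Rightarrow> (nat \<Rightarrow> real) set" where
  "open_disc n = {x \<in> topspace (Euclidean_space n). (\<Sum>i<n. (x i)\<^sup>2) < 1}"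

text \<open>\<open>cw_decomposition X E\<close>: the open \<open>n\<close>-cells of the CW-complex \<open>X\<close> are the members of \<open>E n\<close>.\<close>

definition cw_decomposition :: "'x topology \<Rightarrow> (nat \<Rightarrow> 'x set set) \<Rightarrow> bool" where
  "cw_decomposition X E \<longleftrightarrow>
     Hausdorff_space X \<and>
     (\<Union>n. \<Union>(E n)) = topspace X \<and>
     (\<forall>m n e e'. e \<in> E m \<and> e' \<in> E n \<and> (m, e) \<noteq> (n, e') \<longrightarrow> e \<inter> e' = {}) \<and>
     (\<forall>n. \<forall>e\<in>E n. \<exists>\<Phi>. continuous_map (disc n) X \<Phi> \<and>
        homeomorphic_map (subtopology (disc n) (open_disc n)) (subtopology X e) \<Phi> \<and>
        (\<exists>F. finite F \<and> F \<subseteq> (\<Union>k<n. E k) \<and> \<Phi> ` (topspace (disc n) - open_disc n) \<subseteq> \<Union>F)) \<and>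
     (\<forall>S. S \<subseteq> topspace X \<and> (\<forall>n. \<forall>e\<in>E n. closedin X (S \<inter> X closure_of e)) \<longrightarrow> closedin X S)"

definition r_connected :: "nat \<Rightarrow> 'x topology \<Rightarrow> bool" where
  "r_connected r X \<longleftrightarrow> topspace X \<noteq> {} \<and>
     (\<forall>i\<le>r. \<forall>f. continuous_map (nsphere i) X f \<longrightarrow>
        (\<exists>c\<in>topspace X. homotopic_with (\<lambda>h. True) (nsphere i) X f (\<lambda>x. c)))"

definition mild_cw :: "('r, 'q) ring_scheme \<Rightarrow> nat \<Rightarrow> 'x topology \<Rightarrow> bool" where
  "mild_cw R r X \<longleftrightarrow> r_connected r X \<and>
     (\<exists>E. cw_decomposition X E \<and> (\<forall>n. finite (E n)) \<and> (\<forall>n. E n \<noteq> {} \<longrightarrow> enat n \<le> enat r * rho R))"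

text \<open>Moore loops $(\gamma, l)$ of length $l$.  The path \<open>\<gamma>\<close> is extended to all of \<open>real\<close> by the base
  point, and the set of loops has the topology induced by the compact-open topology and \<open>real\<close>.\<close>

definition compact_open :: "'x topology \<Rightarrow> (real \<Rightarrow> 'x) topology" where
  "compact_open X = topology_generated_by
     {{f. continuous_map euclideanreal X f \<and> f ` K \<subseteq> U} | K U. compact K \<and> openin X U}"

definition moore_loops :: "'x topology \<Rightarrow> 'x \<Rightarrow> ((real \<Rightarrow> 'x) \<times> real) topology" where
  "moore_loops X x0 = subtopology (prod_topology (compact_open X) euclideanreal)
     {(\<gamma>, l). 0 \<le> l \<and> continuous_map euclideanreal X \<gamma> \<and> (\<forall>t. t \<le> 0 \<or> l \<le> t \<longrightarrow> \<gamma> t = x0)}"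

definition loop_mult :: "(real \<Rightarrow> 'x) \<times> real \<Rightarrow> (real \<Rightarrow> 'x) \<times> real \<Rightarrow> (real \<Rightarrow> 'x) \<times> real" where
  "loop_mult = (\<lambda>(\<gamma>, l) (\<delta>, k). (\<lambda>t. if t \<le> l then \<gamma> t else \<delta> (t - l), l + k))"

text \<open>Pull-back of a singular simplex along the affine map \<open>\<Delta>\<^sup>m \<rightarrow> \<Delta>\<^sup>n\<close> with vertex map \<open>\<theta>\<close>.\<close>

definition simplex_op ::
  "nat \<Rightarrow> (nat \<Rightarrow> nat) \<Rightarrow> ((nat \<Rightarrow> real) \<Rightarrow> 'g) \<Rightarrow> (nat \<Rightarrow> real) \<Rightarrow> 'g" where
  "simplex_op m \<theta> \<sigma> = restrict (\<lambda>t. \<sigma> (\<lambda>i. \<Sum>k | k \<le> m \<and> \<theta> k = i. t k)) (standard_simplex m)"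

text \<open>A $(p,q)$-shuffle is given by the set $S \subseteq \{0,\dots,p+q-1\}$ of its $p$ steps in the
  first direction: the corresponding simplex of $\Delta^p \times \Delta^q$ has \<open>k\<close>-th vertex
  \<open>(lower S k, lower (- S) k)\<close>.\<close>

definition lower :: "nat set \<Rightarrow> nat \<Rightarrow> nat" where
  "lower S k = card (S \<inter> {..<k})"

definition shuffle_sign :: "nat \<Rightarrow> nat set \<Rightarrow> int" where
  "shuffle_sign n S = int (card {(a, b). a \<in> S \<and> b \<in> {..<n} - S \<and> b < a})"

definition loop_chains_pres ::
  "('r, 'q) ring_scheme \<Rightarrow> 'x topology \<Rightarrow> 'x
     \<Rightarrow> ('r, nat \<times> ((nat \<Rightarrow> real) \<Rightarrow> (real \<Rightarrow> 'x) \<times> real)) presentation" where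
  "loop_chains_pres R X x0 =
    \<lparr>gens = {(n, \<sigma>). singular_simplex n (moore_loops X x0) \<sigma>},
     wdeg = (\<lambda>(n, \<sigma>). - int n),
     wmult = (\<lambda>(p, \<sigma>) (q, \<tau>) u. \<Oplus>\<^bsub>R\<^esub>S\<in>{S. S \<subseteq> {..<p + q} \<and> card S = p}.
        sg R (shuffle_sign (p + q) S) \<otimes>\<^bsub>R\<^esub>
        single R (p + q, restrict (\<lambda>t. loop_mult (simplex_op (p + q) (lower S) \<sigma> t)
                                               (simplex_op (p + q) (lower (- S)) \<tau> t))
                                (standard_simplex (p + q))) u),
     wunit = (0, restrict (\<lambda>t. (\<lambda>s. x0, 0)) (standard_simplex 0)),
     wdif = (\<lambda>(n, \<sigma>) u. if n = 0 then \<zero>\<^bsub>R\<^esub> else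
        \<Oplus>\<^bsub>R\<^esub>k\<in>{..n}. sg R (int k) \<otimes>\<^bsub>R\<^esub> single R (n - 1, singular_face n k \<sigma>) u),
     rels = {single R (Suc n, simplex_op (Suc n) (\<lambda>k. if k \<le> j then k else k - 1) \<tau>) | n j \<tau>.
        j \<le> n \<and> singular_simplex n (moore_loops X x0) \<tau>}\<rparr>"

text \<open>$C_*(\Omega X; R)$: normalized singular chains on the Moore loop space, with the product induced
  by the Eilenberg--Zilber map and the multiplication of loops.\<close>

definition loop_chains ::
  "('r, 'q) ring_scheme \<Rightarrow> 'x topology \<Rightarrow> 'x
     \<Rightarrow> ('r, ('r, nat \<times> ((nat \<Rightarrow> real) \<Rightarrow> (real \<Rightarrow> 'x) \<times> real)) cls) dg" where
  "loop_chains R X x0 = presented R (loop_chains_pres R X x0)"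

definition aw_diagonal where
  "aw_diagonal R X x0 = (let C = loop_chains R X x0; T = tensor R C C;
       c = (\<lambda>n \<sigma>. (- int n, pclass R (loop_chains_pres R X x0) (single R (n, \<sigma>)))) in
     lin_ext R T (\<lambda>(n, \<sigma>). \<Oplus>\<^bsub>T\<^esub>p\<in>{..n}.
       pure R C C (c p (simplex_op p (\<lambda>k. k) \<sigma>)) (c (n - p) (simplex_op (n - p) (\<lambda>k. k + p) \<sigma>))))"

definition ah_lie :: "('r, 'q) ring_scheme \<Rightarrow> 'x topology \<Rightarrow> 'x \<Rightarrow> ('r, 'l) dgl \<Rightarrow> bool" where
  "ah_lie R X x0 L \<longleftrightarrow> dg_lie R L \<and>
     (\<forall>i. finite_free R (degree_part L i)) \<and> (\<forall>i\<ge>0. gr L i = {\<zero>\<^bsub>L\<^esub>}) \<and>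
     (\<exists>\<theta> \<Delta>. quasi_iso R (env R L) (loop_chains R X x0) \<theta> \<and> env_diagonal R L \<Delta> \<and>
        dga_homotopic R (env R L) (tensor R (loop_chains R X x0) (loop_chains R X x0))
          (\<lambda>x. tensor_map R (loop_chains R X x0) (loop_chains R X x0) \<theta> \<theta> (\<Delta> x))
          (\<lambda>x. aw_diagonal R X x0 (\<theta> x)))"

definition torsion_free_loop_homology :: "('r, 'q) ring_scheme \<Rightarrow> 'x topology \<Rightarrow> 'x \<Rightarrow> bool" where
  "torsion_free_loop_homology R X x0 \<longleftrightarrow> (let H = cohom (loop_chains R X x0) in
     \<forall>i. \<forall>a\<in>carrier R - {\<zero>\<^bsub>R\<^esub>}. \<forall>z\<in>carrier (H i). a \<odot>\<^bsub>H i\<^esub> z = \<zero>\<^bsub>H i\<^esub> \<longrightarrow> z = \<zero>\<^bsub>H i\<^esub>)"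

text \<open>The hypotheses under which $TC_n(X,R)$ is defined, together with the choices it is computed from:
  a base point, \<open>L\<close> and the decomposable model $\kappa : (\Lambda V, d) \to C^*(L)$.\<close>

definition tc_setting ::
  "('r, 'q) ring_scheme \<Rightarrow> nat \<Rightarrow> 'x topology \<Rightarrow> 'x \<Rightarrow> ('r, 'l) dgl \<Rightarrow> ('r, 'v) gmodule
     \<Rightarrow> (('r, 'v) words \<Rightarrow> ('r, 'v) words) \<Rightarrow> (('r, 'v) words \<Rightarrow> ('r, 'l \<Rightarrow> 'r) words) \<Rightarrow> bool" where
  "tc_setting R r X x0 L V d \<kappa> \<longleftrightarrow>
     mild_cw R r X \<and> x0 \<in> topspace X \<and> torsion_free_loop_homology R X x0 \<and>
     ah_lie R X x0 L \<and> decomposable_model R L V d \<kappa>"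

definition TC ::
  "('r, 'q) ring_scheme \<Rightarrow> nat \<Rightarrow> nat \<Rightarrow> 'x topology \<Rightarrow> 'x \<Rightarrow> ('r, 'l) dgl \<Rightarrow> ('r, 'v) gmodule
     \<Rightarrow> (('r, 'v) words \<Rightarrow> ('r, 'v) words) \<Rightarrow> (('r, 'v) words \<Rightarrow> ('r, 'l \<Rightarrow> 'r) words)
     \<Rightarrow> ('r, ('r, ('r, 'v) words) words, 'w) models \<Rightarrow> enat" where
  "TC R r n X x0 L V d \<kappa> Ms =
     (if tc_setting R r X x0 L V d \<kappa> then
        (let B = (\<Lambda> R V)\<lparr>dif := d\<rparr>; A = tpow R B n in
         Inf {enat m | m W dW. Ms m = Some (W, dW) \<and>
           comm_model R (tpow R A (Suc m)) (quot_tpow R A B (mu R B) (Suc m))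
             (proj_tpow R A B (mu R B) (Suc m)) W dW \<and>
           (\<exists>\<rho>. dga_mor R (rel_free R (tpow R A (Suc m)) W dW) A \<rho> \<and>
              (\<forall>x\<in>carrier (tpow R A (Suc m)).
                 \<rho> (incl R (tpow R A (Suc m)) (\<Lambda> R W) x) = mu R A x))})
      else undefined)"

end

theory Submission
  imports Defs
begin

text \<open>
  The algebra \<open>A \<otimes> \<Lambda>W\<close> is the pushout of \<open>i\<^sub>m : C \<rightarrow> C \<otimes> \<Lambda>W\<close> with \<open>C = A\<^sup>\<otimes>\<^sup>m\<^sup>+\<^sup>1\<close> along the multiplication
  \<open>\<mu> : C \<rightarrow> A\<close>, so extensions of \<open>\<mu>\<close> along \<open>i\<^sub>m\<close> correspond to retractions of \<open>A \<rightarrow> A \<otimes> \<Lambda>W\<close>: a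
  retraction \<open>\<sigma>\<close> gives the extension \<open>\<sigma> \<circ> (\<mu> \<otimes> 1)\<close>, and an extension \<open>\<rho>\<close> gives the retraction
  \<open>a \<otimes> w \<mapsto> a \<cdot> \<rho> (1 \<otimes> w)\<close>, which is multiplicative because \<open>A\<close> is graded commutative.
\<close>

section \<open>Linear maps and submodules\<close>

text \<open>Tensor products, tensor powers and \<open>\<Lambda> R W\<close> are quotients of free
  modules on words, with operations defined as unions of cosets over all representatives. Hence even
  the formula for the product of two pure tensors needs an argument, and there are two sources for
  it. For \<open>\<Lambda> R W\<close> and its tensor products with \<open>C\<close> and
  \<open>A\<close>, the span of the relations is shown to be a two-sided ideal. A tensor power of
  \<open>A\<close> is a cdga by the choice of models, so a product or differential of classes is
  known to be a class and can be identified by a single representative. Besides multiplicativity,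
  the retraction built from \<open>\<rho>\<close> must respect the differential of the pushout,
  which is defined through \<open>d (1 \<otimes> w)\<close>. The identity \<sigma> \<circ> (\<mu>
  \<otimes> 1) = \<rho> does this: it evaluates the retraction on the image of
  \<open>d (1 \<otimes> w)\<close> as the differential of \<open>\<rho> (1 \<otimes> w)\<close>.
  This identity is where the equation \<rho> \<circ> i = \<mu> enters.\<close>

definition lin_map :: "('r, 'q) ring_scheme \<Rightarrow> ('r, 'a, 'm) module_scheme \<Rightarrow> ('r, 'b, 'n) module_scheme
    \<Rightarrow> ('a \<Rightarrow> 'b) \<Rightarrow> bool" where
  "lin_map R M T h \<longleftrightarrow> h \<in> carrier M \<rightarrow> carrier T \<and>
     (\<forall>x\<in>carrier M. \<forall>y\<in>carrier M. h (x \<oplus>\<^bsub>M\<^esub> y) = h x \<oplus>\<^bsub>T\<^esub> h y) \<and>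
     (\<forall>a\<in>carrier R. \<forall>x\<in>carrier M. h (a \<odot>\<^bsub>M\<^esub> x) = a \<odot>\<^bsub>T\<^esub> h x)"

lemma lin_mapI:
  assumes "\<And>x. x \<in> carrier M \<Longrightarrow> h x \<in> carrier T"
    and "\<And>x y. x \<in> carrier M \<Longrightarrow> y \<in> carrier M \<Longrightarrow> h (x \<oplus>\<^bsub>M\<^esub> y) = h x \<oplus>\<^bsub>T\<^esub> h y"
    and "\<And>a x. a \<in> carrier R \<Longrightarrow> x \<in> carrier M \<Longrightarrow> h (a \<odot>\<^bsub>M\<^esub> x) = a \<odot>\<^bsub>T\<^esub> h x"
  shows "lin_map R M T h"
  using assms by (auto simp: lin_map_def)

lemma lin_map_closed: "lin_map R M T h \<Longrightarrow> x \<in> carrier M \<Longrightarrow> h x \<in> carrier T"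
  and lin_map_add: "lin_map R M T h \<Longrightarrow> x \<in> carrier M \<Longrightarrow> y \<in> carrier M \<Longrightarrow> h (x \<oplus>\<^bsub>M\<^esub> y) = h x \<oplus>\<^bsub>T\<^esub> h y"
  and lin_map_smult: "lin_map R M T h \<Longrightarrow> a \<in> carrier R \<Longrightarrow> x \<in> carrier M \<Longrightarrow> h (a \<odot>\<^bsub>M\<^esub> x) = a \<odot>\<^bsub>T\<^esub> h x"
  by (auto simp: lin_map_def)

lemma lin_map_comp: "lin_map R M T h \<Longrightarrow> lin_map R T U k \<Longrightarrow> lin_map R M U (\<lambda>x. k (h x))"
  by (auto simp: lin_map_def Pi_iff)

lemma lin_map_id: "lin_map R M M (\<lambda>x. x)"
  by (auto simp: lin_map_def)

lemma lin_map_zero: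
  assumes "lin_map R M T h" "module R M" "module R T"
  shows "h \<zero>\<^bsub>M\<^esub> = \<zero>\<^bsub>T\<^esub>"
proof -
  interpret M: module R M by fact
  interpret T: module R T by fact
  have "h (\<zero>\<^bsub>R\<^esub> \<odot>\<^bsub>M\<^esub> \<zero>\<^bsub>M\<^esub>) = \<zero>\<^bsub>R\<^esub> \<odot>\<^bsub>T\<^esub> h \<zero>\<^bsub>M\<^esub>"
    by (rule lin_map_smult[OF assms(1)]) auto
  then show ?thesis
    using lin_map_closed[OF assms(1), of "\<zero>\<^bsub>M\<^esub>"] by simp
qed

lemma lin_map_finsum:
  assumes "lin_map R M T h" "module R M" "module R T" "f \<in> I \<rightarrow> carrier M"
  shows "h (\<Oplus>\<^bsub>M\<^esub>i\<in>I. f i) = (\<Oplus>\<^bsub>T\<^esub>i\<in>I. h (f i))"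
proof -
  interpret M: module R M by fact
  interpret T: module R T by fact
  show ?thesis
    using assms(4)
  proof (induction I rule: infinite_finite_induct)
    case (infinite I)
    then show ?case
      by (simp add: M.finsum_infinite T.finsum_infinite lin_map_zero[OF assms(1-3)])
  next
    case empty
    then show ?case by (simp add: lin_map_zero[OF assms(1-3)])
  next
    case (insert i I)
    then have "(\<lambda>i. h (f i)) \<in> I \<rightarrow> carrier T" "h (f i) \<in> carrier T"
      using lin_map_closed[OF assms(1)] by (auto simp: Pi_iff)
    with insert show ?case
      by (simp add: Pi_iff lin_map_add[OF assms(1)])
  qed
qed

lemma (in module) minus_eq_smult: "x \<in> carrier M \<Longrightarrow> \<ominus>\<^bsub>M\<^esub> x = (\<ominus>\<^bsub>R\<^esub> \<one>\<^bsub>R\<^esub>) \<odot>\<^bsub>M\<^esub> x"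
  by (simp add: smult_l_minus)

text \<open>Closure under negation, which \<open>submoduleI\<close> also asks for, comes from
  scaling by minus one.\<close>

lemma (in module) submoduleI':
  assumes "H \<subseteq> carrier M" "\<zero>\<^bsub>M\<^esub> \<in> H" "\<And>a b. a \<in> H \<Longrightarrow> b \<in> H \<Longrightarrow> a \<oplus>\<^bsub>M\<^esub> b \<in> H"
    "\<And>a x. a \<in> carrier R \<Longrightarrow> x \<in> H \<Longrightarrow> a \<odot>\<^bsub>M\<^esub> x \<in> H"
  shows "submodule H R M"
proof (rule submoduleI)
  fix x assume "x \<in> H"
  then show "\<ominus>\<^bsub>M\<^esub> x \<in> H"
    using assms(1) assms(4)[of "\<ominus>\<^bsub>R\<^esub> \<one>\<^bsub>R\<^esub>" x] minus_eq_smult[of x] by auto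
qed (use assms in auto)

lemma (in module) submodule_zero: "submodule N R M \<Longrightarrow> \<zero>\<^bsub>M\<^esub> \<in> N"
  using submodule.axioms(1) subgroup.one_closed by fastforce

lemma (in module) submodule_finsum:
  assumes "submodule N R M" "f \<in> I \<rightarrow> N"
  shows "(\<Oplus>\<^bsub>M\<^esub>i\<in>I. f i) \<in> N"
  using assms(2)
proof (induction I rule: infinite_finite_induct)
  case (insert i I)
  then have "f \<in> I \<rightarrow> carrier M" "f i \<in> carrier M" using submoduleE(1)[OF assms(1)] by auto
  with insert show ?case using submoduleE(5)[OF assms(1)] by (simp add: Pi_iff)
qed (auto simp: finsum_infinite submodule_zero[OF assms(1)])

text \<open>Used with \<open>K\<close> zero, to see that a map killing the relations kills their
  span, and with \<open>K\<close> a graded piece, to control degrees by looking at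
  generators.\<close>

lemma submodule_vimage:
  assumes "lin_map R M T h" "module R M" "module R T" "submodule K R T"
  shows "submodule {x \<in> carrier M. h x \<in> K} R M"
proof -
  interpret M: module R M by fact
  interpret T: module R T by fact
  show ?thesis
    using T.submoduleE[OF assms(4)] T.submodule_zero[OF assms(4)]
    by (intro M.submoduleI')
      (auto simp: lin_map_zero[OF assms(1-3)] lin_map_add[OF assms(1)] lin_map_smult[OF assms(1)])
qed

text \<open>This is how an identity between linear maps is reduced to generators below: a submodule
  that contains the generators contains everything they span.\<close>

lemma submodule_equalizer:
  assumes "lin_map R M T h" "lin_map R M T k" "module R M" "module R T"
  shows "submodule {x \<in> carrier M. h x = k x} R M"
proof -
  interpret M: module R M by fact
  show ?thesis
    by (intro M.submoduleI')
      (auto simp: lin_map_zero[OF assms(1,3,4)] lin_map_add[OF assms(1)] lin_map_smult[OF assms(1)]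
         lin_map_zero[OF assms(2,3,4)] lin_map_add[OF assms(2)] lin_map_smult[OF assms(2)])
qed

text \<open>\<open>mod_span\<close> is an intersection, and the assumption puts the carrier itself
  into the family. Over an empty family the intersection would be the whole type.\<close>

lemma (in module) submodule_mod_span:
  assumes "S \<subseteq> carrier M"
  shows "submodule (mod_span R M S) R M"
proof -
  have *: "N \<subseteq> carrier M" "\<zero>\<^bsub>M\<^esub> \<in> N" "\<And>a b. a \<in> N \<Longrightarrow> b \<in> N \<Longrightarrow> a \<oplus>\<^bsub>M\<^esub> b \<in> N"
    "\<And>a x. a \<in> carrier R \<Longrightarrow> x \<in> N \<Longrightarrow> a \<odot>\<^bsub>M\<^esub> x \<in> N" if "submodule N R M" for N
    using submoduleE[OF that] submodule_zero[OF that] by auto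
  show ?thesis
    by (rule submoduleI') (use * assms carrier_is_submodule in \<open>auto simp: mod_span_def\<close>)
qed

lemma mod_span_superset: "S \<subseteq> mod_span R M S"
  by (auto simp: mod_span_def)

lemma mod_span_least: "submodule N R M \<Longrightarrow> S \<subseteq> N \<Longrightarrow> mod_span R M S \<subseteq> N"
  by (auto simp: mod_span_def)

lemma submodule_singleton_zero:
  assumes "module R M" shows "submodule {\<zero>\<^bsub>M\<^esub>} R M"
proof -
  interpret module R M by fact
  show ?thesis by (rule submoduleI') auto
qed


section \<open>Quotient modules\<close>

context module
begin

lemma submodule_abelian_subgroup: "submodule N R M \<Longrightarrow> abelian_subgroup N M"
  by (intro abelian_subgroupI3 additive_subgroup.intro M.abelian_group_axioms)
    (auto dest: submodule.axioms(1))

context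
  fixes N assumes N: "submodule N R M"
begin

interpretation N: abelian_subgroup N M
  by (rule submodule_abelian_subgroup[OF N])

lemma mem_coset_iff:
  assumes "x \<in> carrier M"
  shows "y \<in> N +>\<^bsub>M\<^esub> x \<longleftrightarrow> y \<in> carrier M \<and> y \<ominus>\<^bsub>M\<^esub> x \<in> N"
proof (cases "y \<in> carrier M")
  case True
  then show ?thesis
    using N.a_rcos_module[OF assms True] by (simp add: a_minus_def)
next
  case False
  then show ?thesis
    using N.a_elemrcos_carrier[OF assms] by blast
qed

lemma coset_self: "x \<in> carrier M \<Longrightarrow> x \<in> N +>\<^bsub>M\<^esub> x"
  by (rule N.a_rcos_self)

lemma coset_eqI: "x \<in> carrier M \<Longrightarrow> y \<in> N +>\<^bsub>M\<^esub> x \<Longrightarrow> N +>\<^bsub>M\<^esub> x = N +>\<^bsub>M\<^esub> y"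
  using a_repr_independence submoduleE(1)[OF N] N.a_subgroup by blast

lemma coset_eq_iff:
  assumes "x \<in> carrier M" "y \<in> carrier M"
  shows "N +>\<^bsub>M\<^esub> x = N +>\<^bsub>M\<^esub> y \<longleftrightarrow> x \<ominus>\<^bsub>M\<^esub> y \<in> N"
  using coset_eqI[OF assms(2), of x] coset_self[OF assms(1)] mem_coset_iff[OF assms(2), of x] assms(1)
  by metis

lemma coset_zero: "N +>\<^bsub>M\<^esub> \<zero>\<^bsub>M\<^esub> = N"
  using submoduleE(1)[OF N] by simp

end

end

lemma carrier_factor_dg: "carrier (factor_dg M N) = (\<lambda>x. N +>\<^bsub>M\<^esub> x) ` carrier M"
  and zero_factor_dg: "\<zero>\<^bsub>factor_dg M N\<^esub> = N"
  by (simp_all add: factor_dg_def)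

text \<open>Scaling in \<open>factor_dg\<close> is a union of cosets over all representatives. These
  cosets coincide because \<open>N\<close> is closed under scaling, so the union is the coset of any
  one representative.\<close>

lemma
  fixes M :: "('r, 'a, 'm) dg_scheme"
  assumes "module R M" and N: "submodule N R M"
  shows add_factor_dg: "x \<in> carrier M \<Longrightarrow> y \<in> carrier M \<Longrightarrow>
      (N +>\<^bsub>M\<^esub> x) \<oplus>\<^bsub>factor_dg M N\<^esub> (N +>\<^bsub>M\<^esub> y) = N +>\<^bsub>M\<^esub> (x \<oplus>\<^bsub>M\<^esub> y)"
    and smult_factor_dg: "a \<in> carrier R \<Longrightarrow> x \<in> carrier M \<Longrightarrow>
      a \<odot>\<^bsub>factor_dg M N\<^esub> (N +>\<^bsub>M\<^esub> x) = N +>\<^bsub>M\<^esub> (a \<odot>\<^bsub>M\<^esub> x)"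
    and module_factor_dg: "module R (factor_dg M N)"
proof -
  interpret module R M by fact
  interpret N: abelian_subgroup N M by (rule submodule_abelian_subgroup[OF N])
  show add: "(N +>\<^bsub>M\<^esub> x) \<oplus>\<^bsub>factor_dg M N\<^esub> (N +>\<^bsub>M\<^esub> y) = N +>\<^bsub>M\<^esub> (x \<oplus>\<^bsub>M\<^esub> y)"
    if "x \<in> carrier M" "y \<in> carrier M" for x y
    using that by (simp add: factor_dg_def N.a_rcos_sum)
  show smult: "a \<odot>\<^bsub>factor_dg M N\<^esub> (N +>\<^bsub>M\<^esub> x) = N +>\<^bsub>M\<^esub> (a \<odot>\<^bsub>M\<^esub> x)"
    if a: "a \<in> carrier R" and x: "x \<in> carrier M" for a x
  proof -
    have "N +>\<^bsub>M\<^esub> (a \<odot>\<^bsub>M\<^esub> y) = N +>\<^bsub>M\<^esub> (a \<odot>\<^bsub>M\<^esub> x)" if "y \<in> N +>\<^bsub>M\<^esub> x" for y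
    proof -
      have y: "y \<in> carrier M" "y \<ominus>\<^bsub>M\<^esub> x \<in> N" using that mem_coset_iff[OF N x] by auto
      have "a \<odot>\<^bsub>M\<^esub> y \<ominus>\<^bsub>M\<^esub> a \<odot>\<^bsub>M\<^esub> x = a \<odot>\<^bsub>M\<^esub> (y \<ominus>\<^bsub>M\<^esub> x)"
        using a x y by (simp add: a_minus_def smult_r_distr smult_r_minus)
      then show ?thesis
        using a x y submoduleE(4)[OF N] by (simp add: coset_eq_iff[OF N])
    qed
    then have "(\<Union>y\<in>N +>\<^bsub>M\<^esub> x. N +>\<^bsub>M\<^esub> (a \<odot>\<^bsub>M\<^esub> y)) = N +>\<^bsub>M\<^esub> (a \<odot>\<^bsub>M\<^esub> x)"
      using coset_self[OF N x] by blast
    then show ?thesis by (simp add: factor_dg_def)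
  qed
  have N0: "N +>\<^bsub>M\<^esub> \<zero>\<^bsub>M\<^esub> = N"
    by (simp add: coset_zero[OF N])
  have car: "\<exists>x\<in>carrier M. X = N +>\<^bsub>M\<^esub> x" if "X \<in> carrier (factor_dg M N)" for X
    using that by (auto simp: carrier_factor_dg)
  have coset: "N +>\<^bsub>M\<^esub> x \<in> carrier (factor_dg M N)" if "x \<in> carrier M" for x
    using that by (auto simp: carrier_factor_dg)
  have "abelian_group (factor_dg M N)"
  proof (rule abelian_groupI, goal_cases)
    case (1 X Y)
    then show ?case by (auto dest!: car simp: add intro!: coset)
  next
    case 2
    show ?case using coset[of "\<zero>\<^bsub>M\<^esub>"] N0 by (simp add: zero_factor_dg)
  next
    case (3 X Y Z)
    then obtain x y z where "x \<in> carrier M" "y \<in> carrier M" "z \<in> carrier M"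
      "X = N +>\<^bsub>M\<^esub> x" "Y = N +>\<^bsub>M\<^esub> y" "Z = N +>\<^bsub>M\<^esub> z" by (meson car)
    then show ?case by (simp add: add M.a_assoc)
  next
    case (4 X Y)
    then obtain x y where "x \<in> carrier M" "y \<in> carrier M" "X = N +>\<^bsub>M\<^esub> x" "Y = N +>\<^bsub>M\<^esub> y"
      by (meson car)
    then show ?case using M.a_comm[of x y] by (simp add: add)
  next
    case (5 X)
    then obtain x where x: "x \<in> carrier M" "X = N +>\<^bsub>M\<^esub> x" by (meson car)
    then have "(N +>\<^bsub>M\<^esub> \<zero>\<^bsub>M\<^esub>) \<oplus>\<^bsub>factor_dg M N\<^esub> X = X" by (simp only: add M.zero_closed M.l_zero)
    then show ?case using N0 by (simp add: zero_factor_dg)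
  next
    case (6 X)
    then obtain x where x: "x \<in> carrier M" "X = N +>\<^bsub>M\<^esub> x" by (meson car)
    have "(N +>\<^bsub>M\<^esub> \<ominus>\<^bsub>M\<^esub> x) \<oplus>\<^bsub>factor_dg M N\<^esub> X = \<zero>\<^bsub>factor_dg M N\<^esub>"
      using x N0 by (simp add: add M.l_neg zero_factor_dg)
    then show ?case using coset[of "\<ominus>\<^bsub>M\<^esub> x"] x by blast
  qed
  then show "module R (factor_dg M N)"
  proof (rule moduleI[OF R.is_cring], goal_cases)
    case (1 a X)
    then show ?case by (auto dest!: car simp: smult intro!: coset)
  next
    case (2 a b X)
    then obtain x where "x \<in> carrier M" "X = N +>\<^bsub>M\<^esub> x" by (meson car)
    with 2 show ?case by (simp add: add smult smult_l_distr)
  next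
    case (3 a X Y)
    then obtain x y where "x \<in> carrier M" "y \<in> carrier M" "X = N +>\<^bsub>M\<^esub> x" "Y = N +>\<^bsub>M\<^esub> y"
      by (meson car)
    with 3 show ?case by (simp add: add smult smult_r_distr)
  next
    case (4 a b X)
    then obtain x where "x \<in> carrier M" "X = N +>\<^bsub>M\<^esub> x" by (meson car)
    with 4 show ?case by (simp add: smult smult_assoc1)
  next
    case (5 X)
    then obtain x where "x \<in> carrier M" "X = N +>\<^bsub>M\<^esub> x" by (meson car)
    then show ?case by (simp add: smult)
  qed
qed


section \<open>Presented modules\<close>

text \<open>This is the map that \<open>lin_ext\<close> applies to every representative of a class.
  It makes sense on the free module before anything is known about the relations.\<close>

definition lin_comb ::
  "('r, 'q) ring_scheme \<Rightarrow> ('r, 't, 'm) module_scheme \<Rightarrow> ('w \<Rightarrow> 't) \<Rightarrow> ('w \<Rightarrow> 'r) \<Rightarrow> 't" where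
  "lin_comb R T D f = (\<Oplus>\<^bsub>T\<^esub>w\<in>fsupp R f. f w \<odot>\<^bsub>T\<^esub> D w)"

abbreviation pgen :: "('r, 'q) ring_scheme \<Rightarrow> ('r, 'w) presentation \<Rightarrow> 'w \<Rightarrow> ('r, 'w) cls" where
  "pgen R P w \<equiv> pclass R P (single R w)"

lemma free_dg_simps [simp]:
  "\<zero>\<^bsub>free_dg R P\<^esub> = (\<lambda>u. \<zero>\<^bsub>R\<^esub>)"
  "f \<oplus>\<^bsub>free_dg R P\<^esub> g = fadd R f g"
  "a \<odot>\<^bsub>free_dg R P\<^esub> f = fscale R a f"
  "\<one>\<^bsub>free_dg R P\<^esub> = single R (wunit P)"
  by (simp_all add: free_dg_def)

lemma free_dg_carrier_iff:
  "f \<in> carrier (free_dg R P) \<longleftrightarrow> (\<forall>w. f w \<in> carrier R) \<and> finite (fsupp R f) \<and> fsupp R f \<subseteq> gens P"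
  by (simp add: free_dg_def)

lemma free_dg_gr_iff:
  "f \<in> gr (free_dg R P) i \<longleftrightarrow> f \<in> carrier (free_dg R P) \<and> (\<forall>w\<in>fsupp R f. wdeg P w = i)"
  by (auto simp: free_dg_def)

lemma fadd_apply [simp]: "fadd R f g u = f u \<oplus>\<^bsub>R\<^esub> g u"
  and fsub_apply [simp]: "fsub R f g u = f u \<ominus>\<^bsub>R\<^esub> g u"
  and fscale_apply [simp]: "fscale R a f u = a \<otimes>\<^bsub>R\<^esub> f u"
  by (simp_all add: fadd_def fsub_def fscale_def)

section \<open>Free modules on words\<close>

lemma (in cring) module_free_dg: "module R (free_dg R P)"
proof (rule moduleI[OF is_cring])
  have add: "fadd R f g \<in> carrier (free_dg R P)"
    if "f \<in> carrier (free_dg R P)" "g \<in> carrier (free_dg R P)" for f g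
  proof -
    have "fsupp R (fadd R f g) \<subseteq> fsupp R f \<union> fsupp R g" by (auto simp: fsupp_def)
    then show ?thesis using that
      by (auto simp: free_dg_carrier_iff intro: finite_subset)
  qed
  have smult: "fscale R a f \<in> carrier (free_dg R P)"
    if "a \<in> carrier R" "f \<in> carrier (free_dg R P)" for a f
  proof -
    have "fsupp R (fscale R a f) \<subseteq> fsupp R f" using that by (auto simp: fsupp_def)
    then show ?thesis using that
      by (auto simp: free_dg_carrier_iff intro: finite_subset)
  qed
  have val: "f u \<in> carrier R" if "f \<in> carrier (free_dg R P)" for f u
    using that by (simp add: free_dg_carrier_iff)
  show "abelian_group (free_dg R P)"
  proof (rule abelian_groupI, goal_cases)
    case 2
    show ?case by (simp add: free_dg_carrier_iff fsupp_def)
  next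
    case (6 f)
    have "fscale R (\<ominus> \<one>) f \<in> carrier (free_dg R P)" using 6 by (simp add: smult)
    moreover have "fadd R (fscale R (\<ominus> \<one>) f) f = (\<lambda>u. \<zero>)"
      using val[OF 6] by (simp add: fun_eq_iff l_minus l_neg)
    ultimately show ?case by auto
  qed (auto simp: add val a_assoc fun_eq_iff intro: a_comm)
  show "a \<odot>\<^bsub>free_dg R P\<^esub> f \<in> carrier (free_dg R P)"
    if "a \<in> carrier R" "f \<in> carrier (free_dg R P)" for a f
    using smult[OF that] by simp
qed (auto simp: free_dg_carrier_iff fun_eq_iff l_distr r_distr m_assoc)

lemma (in cring) submodule_gr_free_dg: "submodule (gr (free_dg R P) i) R (free_dg R P)"
proof -
  interpret F: module R "free_dg R P" by (rule module_free_dg)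
  have *: "f \<in> gr (free_dg R P) i \<longleftrightarrow> f \<in> carrier (free_dg R P) \<and> (\<forall>w. wdeg P w \<noteq> i \<longrightarrow> f w = \<zero>)" for f
    by (auto simp: free_dg_gr_iff fsupp_def)
  show ?thesis
    using F.a_closed F.smult_closed F.zero_closed
    by (intro F.submoduleI') (auto simp: *)
qed

lemma (in cring) single_closed: "w \<in> gens P \<Longrightarrow> single R w \<in> carrier (free_dg R P)"
  and single_gr: "w \<in> gens P \<Longrightarrow> single R w \<in> gr (free_dg R P) (wdeg P w)"
proof -
  \<comment> \<open>Only an inclusion, since in the zero ring the support is empty.\<close>
  have "fsupp R (single R w) \<subseteq> {w}" by (auto simp: fsupp_def single_def)
  moreover then have "finite (fsupp R (single R w))" using finite_subset by blast
  ultimately show "w \<in> gens P \<Longrightarrow> single R w \<in> carrier (free_dg R P)"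
    "w \<in> gens P \<Longrightarrow> single R w \<in> gr (free_dg R P) (wdeg P w)"
    by (auto simp: free_dg_carrier_iff free_dg_gr_iff) (auto simp: single_def)
qed

lemma (in cring) finsum_free_dg_apply:
  assumes "g \<in> I \<rightarrow> carrier (free_dg R P)"
  shows "(\<Oplus>\<^bsub>free_dg R P\<^esub>i\<in>I. g i) u = (\<Oplus>i\<in>I. g i u)"
proof -
  interpret F: module R "free_dg R P" by (rule module_free_dg)
  show ?thesis
    using assms
  proof (induction I rule: infinite_finite_induct)
    case (insert i I)
    then have "(\<lambda>i. g i u) \<in> I \<rightarrow> carrier R" "g i u \<in> carrier R"
      by (auto simp: free_dg_carrier_iff Pi_iff)
    with insert show ?case by (simp add: Pi_iff)
  qed (simp_all add: F.finsum_infinite finsum_infinite)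
qed

context module
begin

text \<open>Cancellation can make the support of a sum or a multiple smaller. Summing over one
  larger set of words makes the combinations comparable.\<close>

lemma lin_comb_superset:
  assumes "finite S" "fsupp R f \<subseteq> S" "D \<in> S \<rightarrow> carrier M" "\<And>w. f w \<in> carrier R"
  shows "lin_comb R M D f = (\<Oplus>\<^bsub>M\<^esub>w\<in>S. f w \<odot>\<^bsub>M\<^esub> D w)"
  unfolding lin_comb_def
proof (rule M.add.finprod_mono_neutral_cong_left)
  show "\<And>w. w \<in> S - fsupp R f \<Longrightarrow> f w \<odot>\<^bsub>M\<^esub> D w = \<zero>\<^bsub>M\<^esub>"
    using assms by (auto simp: fsupp_def Pi_iff)
qed (use assms in auto)

lemma lin_comb_linear:
  assumes "D \<in> gens P \<rightarrow> carrier M"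
  shows "lin_map R (free_dg R P) M (lin_comb R M D)"
proof (rule lin_mapI)
  interpret F: module R "free_dg R P" by (rule R.module_free_dg)
  fix f g assume f: "f \<in> carrier (free_dg R P)" and g: "g \<in> carrier (free_dg R P)"
  define S where "S = fsupp R f \<union> fsupp R g"
  have S: "finite S" "fsupp R f \<subseteq> S" "fsupp R g \<subseteq> S" "fsupp R (fadd R f g) \<subseteq> S" "S \<subseteq> gens P"
    using f g by (auto simp: S_def free_dg_carrier_iff) (auto simp: fsupp_def)
  have D: "D \<in> S \<rightarrow> carrier M" using assms S by auto
  have c: "\<And>w. f w \<in> carrier R" "\<And>w. g w \<in> carrier R" using f g by (auto simp: free_dg_carrier_iff)
  have "lin_comb R M D (fadd R f g) = (\<Oplus>\<^bsub>M\<^esub>w\<in>S. fadd R f g w \<odot>\<^bsub>M\<^esub> D w)"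
    using c D S by (intro lin_comb_superset) auto
  also have "\<dots> = (\<Oplus>\<^bsub>M\<^esub>w\<in>S. f w \<odot>\<^bsub>M\<^esub> D w \<oplus>\<^bsub>M\<^esub> g w \<odot>\<^bsub>M\<^esub> D w)"
    by (rule M.finsum_cong') (use c D in \<open>auto simp: smult_l_distr Pi_iff\<close>)
  also have "\<dots> = lin_comb R M D f \<oplus>\<^bsub>M\<^esub> lin_comb R M D g"
    using c D S by (subst (1 2) lin_comb_superset[of S]) (auto intro!: M.finsum_addf)
  finally show "lin_comb R M D (f \<oplus>\<^bsub>free_dg R P\<^esub> g) = lin_comb R M D f \<oplus>\<^bsub>M\<^esub> lin_comb R M D g"
    by simp
next
  fix a f assume a: "a \<in> carrier R" and f: "f \<in> carrier (free_dg R P)"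
  then have c: "\<And>w. f w \<in> carrier R" and S: "finite (fsupp R f)" "fsupp R (fscale R a f) \<subseteq> fsupp R f"
    and D: "D \<in> fsupp R f \<rightarrow> carrier M"
    using assms by (auto simp: free_dg_carrier_iff fsupp_def)
  have "lin_comb R M D (fscale R a f) = (\<Oplus>\<^bsub>M\<^esub>w\<in>fsupp R f. fscale R a f w \<odot>\<^bsub>M\<^esub> D w)"
    using a c D S by (intro lin_comb_superset) auto
  also have "\<dots> = (\<Oplus>\<^bsub>M\<^esub>w\<in>fsupp R f. a \<odot>\<^bsub>M\<^esub> (f w \<odot>\<^bsub>M\<^esub> D w))"
    by (rule M.finsum_cong') (use a c D in \<open>auto simp: smult_assoc1 Pi_iff\<close>)
  also have "\<dots> = a \<odot>\<^bsub>M\<^esub> lin_comb R M D f"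
    unfolding lin_comb_def by (rule finsum_smult_ldistr[symmetric]) (use a c D S in auto)
  finally show "lin_comb R M D (a \<odot>\<^bsub>free_dg R P\<^esub> f) = a \<odot>\<^bsub>M\<^esub> lin_comb R M D f"
    by simp
next
  fix f assume f: "f \<in> carrier (free_dg R P)"
  then show "lin_comb R M D f \<in> carrier M"
    using assms by (auto simp: lin_comb_def free_dg_carrier_iff intro!: M.finsum_closed)
qed

lemma lin_comb_single:
  assumes "D w \<in> carrier M"
  shows "lin_comb R M D (single R w) = D w"
proof -
  have "lin_comb R M D (single R w) = (\<Oplus>\<^bsub>M\<^esub>v\<in>{w}. single R w v \<odot>\<^bsub>M\<^esub> D v)"
    using assms by (intro lin_comb_superset) (auto simp: fsupp_def single_def)
  then show ?thesis using assms by (simp add: single_def)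
qed

end

text \<open>Source of all reductions to single words: a submodule that contains the words in the
  support of \<open>f\<close> then contains \<open>f\<close>, and linear maps that agree on words
  agree.\<close>

lemma (in cring) free_dg_expand:
  assumes "f \<in> carrier (free_dg R P)"
  shows "f = (\<Oplus>\<^bsub>free_dg R P\<^esub>w\<in>fsupp R f. fscale R (f w) (single R w))"
proof
  fix u
  interpret F: module R "free_dg R P" by (rule module_free_dg)
  have f: "\<And>w. f w \<in> carrier R" "finite (fsupp R f)" "fsupp R f \<subseteq> gens P"
    using assms by (auto simp: free_dg_carrier_iff)
  have "(\<lambda>w. fscale R (f w) (single R w)) \<in> fsupp R f \<rightarrow> carrier (free_dg R P)"
    using F.smult_closed[OF f(1) single_closed] f(3) by auto
  then have "(\<Oplus>\<^bsub>free_dg R P\<^esub>w\<in>fsupp R f. fscale R (f w) (single R w)) u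
      = (\<Oplus>w\<in>fsupp R f. f w \<otimes> single R w u)"
    by (simp add: finsum_free_dg_apply)
  also have "\<dots> = (\<Oplus>w\<in>fsupp R f. if u = w then f w else \<zero>)"
    using f by (intro finsum_cong') (auto simp: single_def)
  also have "\<dots> = f u"
  proof (cases "u \<in> fsupp R f")
    case True
    then show ?thesis using f add.finprod_singleton[of u "fsupp R f" f] by simp
  next
    case False
    then have "(\<Oplus>w\<in>fsupp R f. if u = w then f w else \<zero>) = (\<Oplus>w\<in>fsupp R f. \<zero>)"
      by (intro finsum_cong') auto
    then show ?thesis using False by (simp add: fsupp_def)
  qed
  finally show "f u = (\<Oplus>\<^bsub>free_dg R P\<^esub>w\<in>fsupp R f. fscale R (f w) (single R w)) u" by simp
qed

lemma (in cring) free_dg_in_submodule: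
  assumes "submodule K R (free_dg R P)" "f \<in> carrier (free_dg R P)"
    and "\<And>w. w \<in> fsupp R f \<Longrightarrow> single R w \<in> K"
  shows "f \<in> K"
proof -
  interpret F: module R "free_dg R P" by (rule module_free_dg)
  have "(\<lambda>w. fscale R (f w) (single R w)) \<in> fsupp R f \<rightarrow> K"
    using assms F.submoduleE(4)[OF assms(1)] by (auto simp: free_dg_carrier_iff)
  from F.submodule_finsum[OF assms(1) this] show ?thesis
    by (simp only: free_dg_expand[OF assms(2), symmetric])
qed

lemma (in cring) free_dg_lin_map_eqI:
  assumes "lin_map R (free_dg R P) T h" "lin_map R (free_dg R P) T k" "module R T"
    and "\<And>w. w \<in> gens P \<Longrightarrow> h (single R w) = k (single R w)" and f: "f \<in> carrier (free_dg R P)"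
  shows "h f = k f"
proof -
  have "f \<in> {f \<in> carrier (free_dg R P). h f = k f}"
  proof (rule free_dg_in_submodule[OF submodule_equalizer[OF assms(1,2) module_free_dg assms(3)] f])
    fix w assume "w \<in> fsupp R f"
    then have "w \<in> gens P" using f by (auto simp: free_dg_carrier_iff)
    then show "single R w \<in> {f \<in> carrier (free_dg R P). h f = k f}"
      by (simp add: assms(4) single_closed)
  qed
  then show ?thesis by simp
qed

text \<open>\<open>rels_closed\<close> makes \<open>rel_sub\<close> a submodule of the free module,
  and thereby the quotient a module.\<close>

locale presented_module = cring R for R :: "('r, 'q) ring_scheme" (structure) +
  fixes P :: "('r, 'w) presentation"
  assumes rels_closed: "rels P \<subseteq> carrier (free_dg R P)"
begin

abbreviation "F \<equiv> free_dg R P"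
abbreviation "Q \<equiv> presented R P"
abbreviation "N \<equiv> rel_sub R P"
abbreviation "cls \<equiv> pclass R P"
abbreviation "gen \<equiv> pgen R P"

sublocale F: module R F by (rule module_free_dg)

lemma N: "submodule N R F"
  unfolding rel_sub_def by (rule F.submodule_mod_span[OF rels_closed])

lemma rels_N: "rels P \<subseteq> N"
  unfolding rel_sub_def by (rule mod_span_superset)

lemma N_closed: "N \<subseteq> carrier F"
  by (rule F.submoduleE(1)[OF N])

sublocale Q: module R Q
  unfolding presented_def by (rule module_factor_dg[OF F.module_axioms N])

lemma carrier_Q: "carrier Q = cls ` carrier F"
  and zero_Q: "\<zero>\<^bsub>Q\<^esub> = N"
  and gr_Q: "gr Q i = cls ` gr F i"
  and one_Q: "\<one>\<^bsub>Q\<^esub> = gen (wunit P)"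
  by (auto simp: presented_def pclass_def[abs_def] factor_dg_def)

lemma lin_map_cls: "lin_map R F Q cls"
  unfolding presented_def pclass_def[abs_def]
  by (rule lin_mapI)
    (simp_all only: carrier_factor_dg add_factor_dg[OF F.module_axioms N]
      smult_factor_dg[OF F.module_axioms N] imageI)

lemmas cls_closed = lin_map_closed[OF lin_map_cls]
  and cls_add = lin_map_add[OF lin_map_cls]
  and cls_smult = lin_map_smult[OF lin_map_cls]

lemma gen_closed: "w \<in> gens P \<Longrightarrow> gen w \<in> carrier Q"
  by (simp add: cls_closed single_closed)

lemma gen_gr: "w \<in> gens P \<Longrightarrow> gen w \<in> gr Q (wdeg P w)"
  by (simp add: gr_Q single_gr)

lemma mem_cls_iff: "f \<in> carrier F \<Longrightarrow> g \<in> cls f \<longleftrightarrow> g \<in> carrier F \<and> g \<ominus>\<^bsub>F\<^esub> f \<in> N"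
  unfolding pclass_def by (rule F.mem_coset_iff[OF N])

lemma cls_self: "f \<in> carrier F \<Longrightarrow> f \<in> cls f"
  unfolding pclass_def by (rule F.coset_self[OF N])

lemma cls_eqI: "f \<in> carrier F \<Longrightarrow> g \<in> cls f \<Longrightarrow> cls f = cls g"
  unfolding pclass_def by (rule F.coset_eqI[OF N])

lemma cls_N: "f \<in> N \<Longrightarrow> cls f = \<zero>\<^bsub>Q\<^esub>"
  using cls_eqI[of "\<lambda>u. \<zero>" f] F.zero_closed F.coset_zero[OF N] by (simp add: zero_Q pclass_def)

text \<open>The kernel of \<open>h\<close> is a submodule, so it contains the span of the relations
  as soon as it contains the relations.\<close>

lemma vanish_on_N:
  assumes "lin_map R F T h" "module R T" "\<forall>f\<in>rels P. h f = \<zero>\<^bsub>T\<^esub>" "f \<in> N"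
  shows "h f = \<zero>\<^bsub>T\<^esub>"
proof -
  have "N \<subseteq> {f \<in> carrier F. h f \<in> {\<zero>\<^bsub>T\<^esub>}}"
    unfolding rel_sub_def
    using assms rels_closed
    by (intro mod_span_least submodule_vimage[OF assms(1) F.module_axioms] submodule_singleton_zero) auto
  then show ?thesis using assms(4) by blast
qed

lemma const_on_cls:
  assumes "lin_map R F T h" "module R T" "\<forall>f\<in>N. h f = \<zero>\<^bsub>T\<^esub>" "f \<in> carrier F" "g \<in> cls f"
  shows "h g = h f"
proof -
  interpret T: module R T by fact
  have g: "g \<in> carrier F" "g \<ominus>\<^bsub>F\<^esub> f \<in> N" using assms(4,5) mem_cls_iff by auto
  have "g = (g \<ominus>\<^bsub>F\<^esub> f) \<oplus>\<^bsub>F\<^esub> f"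
    using g(1) assms(4) F.r_neg1 F.a_comm F.a_assoc F.l_neg F.r_zero F.a_inv_closed
    unfolding a_minus_def by metis
  then have "h g = h (g \<ominus>\<^bsub>F\<^esub> f) \<oplus>\<^bsub>T\<^esub> h f"
    using lin_map_add[OF assms(1), of "g \<ominus>\<^bsub>F\<^esub> f" f] g assms(4) by simp
  then show ?thesis
    using assms(3) g(2) lin_map_closed[OF assms(1,4)] by simp
qed

lemma lin_map_eqI:
  assumes "lin_map R Q T h" "lin_map R Q T k" "module R T"
    and "\<And>w. w \<in> gens P \<Longrightarrow> h (gen w) = k (gen w)" and "X \<in> carrier Q"
  shows "h X = k X"
proof -
  obtain f where f: "f \<in> carrier F" "X = cls f" using assms(5) by (auto simp: carrier_Q)
  have "h (cls f) = k (cls f)"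
    by (rule free_dg_lin_map_eqI[OF lin_map_comp[OF lin_map_cls assms(1)]
        lin_map_comp[OF lin_map_cls assms(2)] assms(3) _ f(1)]) (rule assms(4))
  then show ?thesis using f by simp
qed

text \<open>A class of degree \<open>i\<close> has a representative supported on words of degree
  \<open>i\<close>, so testing these words suffices.\<close>

lemma lin_map_gr:
  assumes "lin_map R Q T h" "module R T" "submodule K R T"
    and "\<And>w. w \<in> gens P \<Longrightarrow> wdeg P w = i \<Longrightarrow> h (gen w) \<in> K" and "X \<in> gr Q i"
  shows "h X \<in> K"
proof -
  obtain f where f: "f \<in> gr F i" "X = cls f" using assms(5) by (auto simp: gr_Q)
  have "f \<in> {f \<in> carrier F. h (cls f) \<in> K}"
  proof (rule free_dg_in_submodule)
    show "submodule {f \<in> carrier F. h (cls f) \<in> K} R F"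
      by (rule submodule_vimage[OF lin_map_comp[OF lin_map_cls assms(1)] F.module_axioms assms(2,3)])
    show "f \<in> carrier F" using f(1) by (simp add: free_dg_gr_iff)
    fix w assume "w \<in> fsupp R f"
    then have "w \<in> gens P" "wdeg P w = i" using f(1) by (auto simp: free_dg_gr_iff free_dg_carrier_iff)
    then show "single R w \<in> {f \<in> carrier F. h (cls f) \<in> K}"
      by (simp add: assms(4) single_closed)
  qed
  then show ?thesis using f(2) by simp
qed

lemma submodule_gr_Q: "submodule (gr Q i) R Q"
proof -
  note * = F.submoduleE[OF submodule_gr_free_dg[of P i]] F.submodule_zero[OF submodule_gr_free_dg[of P i]]
  show ?thesis
  proof (rule Q.submoduleI')
    show "gr Q i \<subseteq> carrier Q" using *(1) by (auto simp: gr_Q carrier_Q)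
    show "\<zero>\<^bsub>Q\<^esub> \<in> gr Q i" using *(7) lin_map_zero[OF lin_map_cls F.module_axioms Q.module_axioms]
      by (metis gr_Q imageI)
    have mem: "\<exists>f. f \<in> gr F i \<and> f \<in> carrier F \<and> X = cls f" if "X \<in> gr Q i" for X
      using that *(1) by (auto simp: gr_Q)
    show "X \<oplus>\<^bsub>Q\<^esub> Y \<in> gr Q i" if XY: "X \<in> gr Q i" "Y \<in> gr Q i" for X Y
    proof -
      from XY obtain f g where "f \<in> gr F i" "f \<in> carrier F" "X = cls f"
        "g \<in> gr F i" "g \<in> carrier F" "Y = cls g" by (meson mem)
      then show ?thesis using *(5)[of f g] by (simp add: gr_Q cls_add[symmetric] del: free_dg_simps)
    qed
    show "a \<odot>\<^bsub>Q\<^esub> X \<in> gr Q i" if aX: "a \<in> carrier R" "X \<in> gr Q i" for X a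
    proof -
      from aX obtain f where "f \<in> gr F i" "f \<in> carrier F" "X = cls f" by (meson mem)
      then show ?thesis using *(4)[OF aX(1), of f] aX(1)
        by (simp add: gr_Q cls_smult[symmetric] del: free_dg_simps)
    qed
  qed
qed

text \<open>A map that kills the relations takes one value on a whole class. The image of the class
  is then a singleton, and \<open>the_elem\<close> in \<open>lin_ext\<close> returns that
  value.\<close>

lemma lin_ext_cls:
  assumes "module R T" "D \<in> gens P \<rightarrow> carrier T" "\<forall>f\<in>rels P. lin_comb R T D f = \<zero>\<^bsub>T\<^esub>"
    and f: "f \<in> carrier F"
  shows "lin_ext R T D (cls f) = lin_comb R T D f"
proof -
  interpret T: module R T by fact
  have "lin_comb R T D ` cls f = {lin_comb R T D f}"
    using const_on_cls[OF T.lin_comb_linear[OF assms(2)] assms(1) _ f]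
      vanish_on_N[OF T.lin_comb_linear[OF assms(2)] assms(1,3)] cls_self[OF f]
    by blast
  then show ?thesis by (simp add: lin_ext_def lin_comb_def[abs_def])
qed

lemma lin_ext_gen:
  assumes "module R T" "D \<in> gens P \<rightarrow> carrier T" "\<forall>f\<in>rels P. lin_comb R T D f = \<zero>\<^bsub>T\<^esub>"
    and w: "w \<in> gens P"
  shows "lin_ext R T D (gen w) = D w"
proof -
  interpret T: module R T by fact
  show ?thesis
    using lin_ext_cls[OF assms(1-3) single_closed[OF w]] T.lin_comb_single[of D w] assms(2) w by auto
qed

lemma lin_ext_linear:
  assumes "module R T" "D \<in> gens P \<rightarrow> carrier T" "\<forall>f\<in>rels P. lin_comb R T D f = \<zero>\<^bsub>T\<^esub>"
  shows "lin_map R Q T (lin_ext R T D)"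
proof -
  interpret T: module R T by fact
  note * = lin_ext_cls[OF assms] and ** = T.lin_comb_linear[OF assms(2)]
  show ?thesis
  proof (rule lin_mapI)
    show "lin_ext R T D X \<in> carrier T" if "X \<in> carrier Q" for X
      using that * lin_map_closed[OF **] by (auto simp: carrier_Q)
    show "lin_ext R T D (X \<oplus>\<^bsub>Q\<^esub> Y) = lin_ext R T D X \<oplus>\<^bsub>T\<^esub> lin_ext R T D Y"
      if XY: "X \<in> carrier Q" "Y \<in> carrier Q" for X Y
    proof -
      obtain f g where fg: "f \<in> carrier F" "g \<in> carrier F" "X = cls f" "Y = cls g"
        using XY by (auto simp: carrier_Q)
      then show ?thesis
        using *[OF F.a_closed[OF fg(1,2)]] lin_map_add[OF **, of f g] cls_add[of f g] *[of f] *[of g] by simp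
    qed
    show "lin_ext R T D (a \<odot>\<^bsub>Q\<^esub> X) = a \<odot>\<^bsub>T\<^esub> lin_ext R T D X"
      if aX: "a \<in> carrier R" "X \<in> carrier Q" for a X
    proof -
      obtain f where fg: "f \<in> carrier F" "X = cls f"
        using aX by (auto simp: carrier_Q)
      then show ?thesis
        using *[OF F.smult_closed[OF aX(1) fg(1)]] lin_map_smult[OF ** aX(1), of f]
          cls_smult[OF aX(1), of f] *[of f] by simp
    qed
  qed
qed

end


section \<open>Presented algebras\<close>

lemma lin_map_cong:
  assumes "\<And>x. x \<in> carrier M \<Longrightarrow> h x = k x" "module R M"
  shows "lin_map R M T h \<longleftrightarrow> lin_map R M T k"
proof -
  interpret module R M by fact
  show ?thesis using assms(1) by (auto simp: lin_map_def Pi_iff)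
qed

text \<open>Needed for the second factor of a product: by \<open>mult_F\<close> below, a product is
  a combination, indexed by the first factor, of maps that are linear in the second.\<close>

lemma lin_map_lin_comb:
  assumes "module R M" "module R T" "\<And>v. v \<in> fsupp R f \<Longrightarrow> lin_map R M T (H v)" "\<And>v. f v \<in> carrier R"
  shows "lin_map R M T (\<lambda>x. lin_comb R T (\<lambda>v. H v x) f)"
proof -
  interpret M: module R M by fact
  interpret T: module R T by fact
  have cl: "f v \<odot>\<^bsub>T\<^esub> H v x \<in> carrier T" if "v \<in> fsupp R f" "x \<in> carrier M" for v x
    using assms(3,4) that by (auto intro: lin_map_closed)
  show ?thesis
  proof (rule lin_mapI)
    show "lin_comb R T (\<lambda>v. H v x) f \<in> carrier T" if "x \<in> carrier M" for x
      using cl that by (auto simp: lin_comb_def intro!: T.finsum_closed)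
    show "lin_comb R T (\<lambda>v. H v (x \<oplus>\<^bsub>M\<^esub> y)) f = lin_comb R T (\<lambda>v. H v x) f \<oplus>\<^bsub>T\<^esub> lin_comb R T (\<lambda>v. H v y) f"
      if xy: "x \<in> carrier M" "y \<in> carrier M" for x y
    proof -
      have "lin_comb R T (\<lambda>v. H v (x \<oplus>\<^bsub>M\<^esub> y)) f = (\<Oplus>\<^bsub>T\<^esub>v\<in>fsupp R f. f v \<odot>\<^bsub>T\<^esub> H v x \<oplus>\<^bsub>T\<^esub> f v \<odot>\<^bsub>T\<^esub> H v y)"
        unfolding lin_comb_def using xy cl assms(4) lin_map_closed[OF assms(3)] lin_map_add[OF assms(3)]
        by (intro T.finsum_cong') (auto simp: T.smult_r_distr)
      also have "\<dots> = lin_comb R T (\<lambda>v. H v x) f \<oplus>\<^bsub>T\<^esub> lin_comb R T (\<lambda>v. H v y) f"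
        unfolding lin_comb_def using xy cl by (intro T.finsum_addf) auto
      finally show ?thesis .
    qed
    show "lin_comb R T (\<lambda>v. H v (a \<odot>\<^bsub>M\<^esub> x)) f = a \<odot>\<^bsub>T\<^esub> lin_comb R T (\<lambda>v. H v x) f"
      if ax: "a \<in> carrier R" "x \<in> carrier M" for a x
    proof (cases "finite (fsupp R f)")
      case True
      have "f v \<odot>\<^bsub>T\<^esub> (a \<odot>\<^bsub>T\<^esub> H v x) = a \<odot>\<^bsub>T\<^esub> (f v \<odot>\<^bsub>T\<^esub> H v x)" if "v \<in> fsupp R f" for v
        using ax assms(4) lin_map_closed[OF assms(3)[OF that] ax(2)]
        by (metis M.R.m_comm T.smult_assoc1)
      then have "lin_comb R T (\<lambda>v. H v (a \<odot>\<^bsub>M\<^esub> x)) f = (\<Oplus>\<^bsub>T\<^esub>v\<in>fsupp R f. a \<odot>\<^bsub>T\<^esub> (f v \<odot>\<^bsub>T\<^esub> H v x))"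
        unfolding lin_comb_def using ax cl lin_map_smult[OF assms(3)]
        by (intro T.finsum_cong') auto
      also have "\<dots> = a \<odot>\<^bsub>T\<^esub> lin_comb R T (\<lambda>v. H v x) f"
        unfolding lin_comb_def using True ax cl by (intro T.finsum_smult_ldistr[symmetric]) auto
      finally show ?thesis .
    \<comment> \<open>For infinite support both sums take the default value zero.\<close>
    qed (use ax in \<open>simp add: lin_comb_def T.finsum_infinite\<close>)
  qed
qed

text \<open>Bilinearity of the product and its behaviour on degrees, without associativity, unit
  laws or a differential. Cdga's satisfy this, and for \<open>\<Lambda> R W\<close> and the tensor
  products it can be read off the presentation.\<close>

locale graded_alg = module R A
  for R :: "('r, 'q) ring_scheme" and A :: "('r, 'a, 'm) dg_scheme" +
  assumes gr_sub: "submodule (gr A i) R A"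
    and mult_closed: "x \<in> carrier A \<Longrightarrow> y \<in> carrier A \<Longrightarrow> x \<otimes>\<^bsub>A\<^esub> y \<in> carrier A"
    and mult_add_left: "x \<in> carrier A \<Longrightarrow> y \<in> carrier A \<Longrightarrow> z \<in> carrier A \<Longrightarrow>
      (x \<oplus>\<^bsub>A\<^esub> y) \<otimes>\<^bsub>A\<^esub> z = x \<otimes>\<^bsub>A\<^esub> z \<oplus>\<^bsub>A\<^esub> y \<otimes>\<^bsub>A\<^esub> z"
    and mult_add_right: "x \<in> carrier A \<Longrightarrow> y \<in> carrier A \<Longrightarrow> z \<in> carrier A \<Longrightarrow>
      x \<otimes>\<^bsub>A\<^esub> (y \<oplus>\<^bsub>A\<^esub> z) = x \<otimes>\<^bsub>A\<^esub> y \<oplus>\<^bsub>A\<^esub> x \<otimes>\<^bsub>A\<^esub> z"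
    and mult_smult_left: "a \<in> carrier R \<Longrightarrow> x \<in> carrier A \<Longrightarrow> y \<in> carrier A \<Longrightarrow>
      (a \<odot>\<^bsub>A\<^esub> x) \<otimes>\<^bsub>A\<^esub> y = a \<odot>\<^bsub>A\<^esub> (x \<otimes>\<^bsub>A\<^esub> y)"
    and mult_smult_right: "a \<in> carrier R \<Longrightarrow> x \<in> carrier A \<Longrightarrow> y \<in> carrier A \<Longrightarrow>
      x \<otimes>\<^bsub>A\<^esub> (a \<odot>\<^bsub>A\<^esub> y) = a \<odot>\<^bsub>A\<^esub> (x \<otimes>\<^bsub>A\<^esub> y)"
    and one_gr: "\<one>\<^bsub>A\<^esub> \<in> gr A 0"
    and mult_gr: "x \<in> gr A i \<Longrightarrow> y \<in> gr A j \<Longrightarrow> x \<otimes>\<^bsub>A\<^esub> y \<in> gr A (i + j)"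
begin

lemma gr_closed: "x \<in> gr A i \<Longrightarrow> x \<in> carrier A"
  using submoduleE(1)[OF gr_sub] by auto

lemma gr_add: "x \<in> gr A i \<Longrightarrow> y \<in> gr A i \<Longrightarrow> x \<oplus>\<^bsub>A\<^esub> y \<in> gr A i"
  and gr_smult: "a \<in> carrier R \<Longrightarrow> x \<in> gr A i \<Longrightarrow> a \<odot>\<^bsub>A\<^esub> x \<in> gr A i"
  using submoduleE[OF gr_sub] by auto

lemma one_mem: "\<one>\<^bsub>A\<^esub> \<in> carrier A"
  using one_gr by (rule gr_closed)

lemma lin_map_mult_left: "y \<in> carrier A \<Longrightarrow> lin_map R A A (\<lambda>x. x \<otimes>\<^bsub>A\<^esub> y)"
  by (rule lin_mapI) (simp_all add: mult_closed mult_add_left mult_smult_left)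

lemma lin_map_mult_right: "x \<in> carrier A \<Longrightarrow> lin_map R A A (\<lambda>y. x \<otimes>\<^bsub>A\<^esub> y)"
  by (rule lin_mapI) (simp_all add: mult_closed mult_add_right mult_smult_right)

end

text \<open>The differentials on relative free extensions are put in by record update. Module
  structure, grading and product do not mention the field \<open>dif\<close>, so they carry
  over.\<close>

lemma module_dif_update:
  fixes A :: "('r, 'a, 'm) dg_scheme"
  shows "module R (A\<lparr>dif := d\<rparr>) \<longleftrightarrow> module R A"
  by (simp add: module_def module_axioms_def abelian_group_def abelian_monoid_def abelian_group_axioms_def)

lemma submodule_dif_update:
  fixes A :: "('r, 'a, 'm) dg_scheme"
  shows "submodule K R (A\<lparr>dif := d\<rparr>) \<longleftrightarrow> submodule K R A"
  by (simp add: submodule_def submodule_axioms_def)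

lemma lin_map_dif_update [simp]:
  "lin_map R (A\<lparr>dif := d\<rparr>) T h \<longleftrightarrow> lin_map R A T h"
  "lin_map R T (A\<lparr>dif := d\<rparr>) k \<longleftrightarrow> lin_map R T A k"
  by (simp_all add: lin_map_def)

lemma graded_alg_dif_update: "graded_alg R (A\<lparr>dif := d\<rparr>) \<longleftrightarrow> graded_alg R A"
  by (simp add: graded_alg_def graded_alg_axioms_def module_dif_update submodule_dif_update)

lemma ring_imp_semiring: "ring A \<Longrightarrow> semiring A"
proof -
  assume "ring A"
  then interpret ring A .
  show ?thesis by (rule semiring_axioms)
qed

text \<open>The locale carries ring laws for \<open>R\<close> as well as for \<open>A\<close>; these
  names stand for the laws of \<open>A\<close>.\<close>

lemmas (in cdga) mult_assoc = monoid.m_assoc[OF semiring.axioms(2)[OF ring_imp_semiring[OF ring_axioms]]]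
  and one_mult = monoid.l_one[OF semiring.axioms(2)[OF ring_imp_semiring[OF ring_axioms]]]
  and mult_one = monoid.r_one[OF semiring.axioms(2)[OF ring_imp_semiring[OF ring_axioms]]]

lemma (in cdga) graded_alg: "graded_alg R A"
proof (intro graded_alg.intro module_axioms graded_alg_axioms.intro)
  show "x \<otimes>\<^bsub>A\<^esub> y \<in> carrier A" if "x \<in> carrier A" "y \<in> carrier A" for x y
    using that by (rule monoid.m_closed[OF semiring.axioms(2)[OF ring_imp_semiring[OF ring_axioms]]])
  show "(x \<oplus>\<^bsub>A\<^esub> y) \<otimes>\<^bsub>A\<^esub> z = x \<otimes>\<^bsub>A\<^esub> z \<oplus>\<^bsub>A\<^esub> y \<otimes>\<^bsub>A\<^esub> z"
    if "x \<in> carrier A" "y \<in> carrier A" "z \<in> carrier A" for x y z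
    using that by (rule semiring.l_distr[OF ring_imp_semiring[OF ring_axioms]])
  show "x \<otimes>\<^bsub>A\<^esub> (y \<oplus>\<^bsub>A\<^esub> z) = x \<otimes>\<^bsub>A\<^esub> y \<oplus>\<^bsub>A\<^esub> x \<otimes>\<^bsub>A\<^esub> z"
    if "x \<in> carrier A" "y \<in> carrier A" "z \<in> carrier A" for x y z
    by (rule semiring.r_distr[OF ring_imp_semiring[OF ring_axioms] that(2,3,1)])
qed (fact gr_submodule smult_mult_left smult_mult_right one_degree mult_degree)+

text \<open>The point is closure: the axioms place \<open>dif M x\<close> in the module for
  homogeneous \<open>x\<close>, so a general \<open>x\<close> is split into its components and
  \<open>dif\<close> is applied to the sum.\<close>

lemma (in dg_module) lin_map_dif: "lin_map R M M (dif M)"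
proof (rule lin_mapI)
  fix x assume "x \<in> carrier M"
  then obtain f where f: "decomposition M x f" using direct_sum by blast
  then have fi: "f i \<in> gr M i" "f i \<in> carrier M" for i
    using submoduleE(1)[OF gr_submodule] by (auto simp: decomposition_def)
  have d: "dif M (f i) \<in> carrier M" for i
    using dif_degree[OF fi(1)] submoduleE(1)[OF gr_submodule] by blast
  \<comment> \<open>Base of the induction over the sum of components: zero is homogeneous, so its
    differential lies in the carrier, and scaling by zero determines it.\<close>
  have dz: "dif M \<zero>\<^bsub>M\<^esub> = \<zero>\<^bsub>M\<^esub>"
  proof -
    have "dif M \<zero>\<^bsub>M\<^esub> \<in> carrier M"
      using dif_degree[OF submodule_zero[OF gr_submodule]] submoduleE(1)[OF gr_submodule] by blast
    then show ?thesis using dif_smult[of "\<zero>\<^bsub>R\<^esub>" "\<zero>\<^bsub>M\<^esub>"] by simp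
  qed
  have "dif M (\<Oplus>\<^bsub>M\<^esub>i\<in>I. f i) \<in> carrier M" for I
  proof (induction I rule: infinite_finite_induct)
    case (insert i I)
    then show ?case using fi d by (simp add: dif_add)
  qed (simp_all add: dz M.finsum_infinite)
  then show "dif M x \<in> carrier M" using f by (simp add: decomposition_def)
qed (simp_all add: dif_add dif_smult)

section \<open>Products on presented modules\<close>

locale graded_presentation = presented_module R P
  for R :: "('r, 'q) ring_scheme" (structure) and P :: "('r, 'w) presentation" +
  assumes wmult_gr: "v \<in> gens P \<Longrightarrow> w \<in> gens P \<Longrightarrow> wmult P v w \<in> gr (free_dg R P) (wdeg P v + wdeg P w)"
    and wunit_gens: "wunit P \<in> gens P"
    and wdeg_wunit: "wdeg P (wunit P) = 0"
begin

lemma wmult_closed: "v \<in> gens P \<Longrightarrow> w \<in> gens P \<Longrightarrow> wmult P v w \<in> carrier F"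
  using wmult_gr free_dg_gr_iff by blast

lemma wmult_linear: "v \<in> gens P \<Longrightarrow> lin_map R F F (lin_comb R F (wmult P v))"
  using wmult_closed by (intro F.lin_comb_linear) auto

text \<open>The double sum in \<open>free_dg\<close> becomes an iterated \<open>lin_comb\<close>,
  whose linearity in each factor is already available.\<close>

lemma mult_F:
  assumes f: "f \<in> carrier F" and g: "g \<in> carrier F"
  shows "f \<otimes>\<^bsub>F\<^esub> g = lin_comb R F (\<lambda>v. lin_comb R F (wmult P v) g) f"
proof
  fix u
  have fc: "f v \<in> carrier R" "v \<in> fsupp R f \<Longrightarrow> v \<in> gens P" "finite (fsupp R f)"
    and gc: "g v \<in> carrier R" "v \<in> fsupp R g \<Longrightarrow> v \<in> gens P" "finite (fsupp R g)" for v
    using f g by (auto simp: free_dg_carrier_iff)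
  have c: "wmult P v w u \<in> carrier R" if "v \<in> gens P" "w \<in> gens P" for v w
    using wmult_closed[OF that] by (simp add: free_dg_carrier_iff)
  have in1: "lin_comb R F (wmult P v) g u = (\<Oplus>w\<in>fsupp R g. g w \<otimes> wmult P v w u)"
    if "v \<in> fsupp R f" for v
    unfolding lin_comb_def using wmult_closed[OF fc(2)[OF that] gc(2)] gc F.smult_closed
    by (subst finsum_free_dg_apply) auto
  have in2: "f v \<otimes> lin_comb R F (wmult P v) g u = (\<Oplus>w\<in>fsupp R g. f v \<otimes> g w \<otimes> wmult P v w u)"
    if "v \<in> fsupp R f" for v
    unfolding in1[OF that] using fc gc c[OF fc(2)[OF that] gc(2)] that
    by (subst finsum_rdistr) (auto intro!: finsum_cong' simp: m_assoc)
  have "lin_comb R F (\<lambda>v. lin_comb R F (wmult P v) g) f u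
      = (\<Oplus>v\<in>fsupp R f. f v \<otimes> lin_comb R F (wmult P v) g u)"
    unfolding lin_comb_def[of _ _ _ f]
    using lin_map_closed[OF wmult_linear[OF fc(2)] g] fc(1) F.smult_closed
    by (subst finsum_free_dg_apply) auto
  also have "\<dots> = (\<Oplus>v\<in>fsupp R f. \<Oplus>w\<in>fsupp R g. f v \<otimes> g w \<otimes> wmult P v w u)"
    using fc gc c[OF fc(2) gc(2)] by (intro finsum_cong') (auto simp: in2 intro!: finsum_closed)
  also have "\<dots> = (f \<otimes>\<^bsub>F\<^esub> g) u"
    by (simp add: free_dg_def)
  finally show "(f \<otimes>\<^bsub>F\<^esub> g) u = lin_comb R F (\<lambda>v. lin_comb R F (wmult P v) g) f u" ..
qed

lemma lin_map_mult_left_F: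
  assumes "g \<in> carrier F" shows "lin_map R F F (\<lambda>f. f \<otimes>\<^bsub>F\<^esub> g)"
proof -
  have "lin_map R F F (lin_comb R F (\<lambda>v. lin_comb R F (wmult P v) g))"
    using lin_map_closed[OF wmult_linear assms] by (intro F.lin_comb_linear) auto
  then show ?thesis
    by (subst lin_map_cong[OF mult_F[OF _ assms] F.module_axioms])
qed

lemma lin_map_mult_right_F:
  assumes "f \<in> carrier F" shows "lin_map R F F (\<lambda>g. f \<otimes>\<^bsub>F\<^esub> g)"
proof -
  have "lin_map R F F (\<lambda>g. lin_comb R F (\<lambda>v. lin_comb R F (wmult P v) g) f)"
    using wmult_linear assms
    by (intro lin_map_lin_comb F.module_axioms) (auto simp: free_dg_carrier_iff)
  then show ?thesis
    by (subst lin_map_cong[OF mult_F[OF assms] F.module_axioms])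
qed

lemma mult_F_closed: "f \<in> carrier F \<Longrightarrow> g \<in> carrier F \<Longrightarrow> f \<otimes>\<^bsub>F\<^esub> g \<in> carrier F"
  using lin_map_closed[OF lin_map_mult_left_F] by blast

lemma mult_F_single:
  assumes v: "v \<in> gens P" and w: "w \<in> gens P"
  shows "single R v \<otimes>\<^bsub>F\<^esub> single R w = wmult P v w"
proof -
  have "lin_comb R F (wmult P v) (single R w) = wmult P v w"
    by (rule F.lin_comb_single) (rule wmult_closed[OF v w])
  then show ?thesis
    using mult_F[OF single_closed[OF v] single_closed[OF w]]
      F.lin_comb_single[of "\<lambda>v. lin_comb R F (wmult P v) (single R w)" v] wmult_closed[OF v w] by simp
qed

lemma mult_Q_Union: "X \<otimes>\<^bsub>Q\<^esub> Y = (\<Union>x\<in>X. \<Union>y\<in>Y. cls (x \<otimes>\<^bsub>F\<^esub> y))"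
  by (simp add: presented_def pclass_def factor_dg_def)

text \<open>If the product of two cosets is a coset at all, it has to be the expected one.\<close>

lemma mult_Q_if_closed:
  assumes f: "f \<in> carrier F" and g: "g \<in> carrier F" and "cls f \<otimes>\<^bsub>Q\<^esub> cls g \<in> carrier Q"
  shows "cls f \<otimes>\<^bsub>Q\<^esub> cls g = cls (f \<otimes>\<^bsub>F\<^esub> g)"
proof -
  obtain h where h: "h \<in> carrier F" "cls f \<otimes>\<^bsub>Q\<^esub> cls g = cls h"
    using assms(3) by (auto simp: carrier_Q)
  have "f \<otimes>\<^bsub>F\<^esub> g \<in> cls f \<otimes>\<^bsub>Q\<^esub> cls g"
    unfolding mult_Q_Union using cls_self[OF f] cls_self[OF g] cls_self[OF mult_F_closed[OF f g]] by blast
  then show ?thesis using h cls_eqI[OF h(1)] by auto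
qed

text \<open>Both sides are linear in each factor: the left factor is first held at a word while the
  right one varies, and then the left one varies.\<close>

lemma lin_map_mult:
  assumes Q: "graded_alg R Q" and T: "graded_alg R T" and h: "lin_map R Q T h"
    and gen: "\<And>v w. v \<in> gens P \<Longrightarrow> w \<in> gens P \<Longrightarrow> h (gen v \<otimes>\<^bsub>Q\<^esub> gen w) = h (gen v) \<otimes>\<^bsub>T\<^esub> h (gen w)"
    and X: "X \<in> carrier Q" and Y: "Y \<in> carrier Q"
  shows "h (X \<otimes>\<^bsub>Q\<^esub> Y) = h X \<otimes>\<^bsub>T\<^esub> h Y"
proof -
  interpret GQ: graded_alg R Q by fact
  interpret T: graded_alg R T by fact
  have 1: "h (gen v \<otimes>\<^bsub>Q\<^esub> Y) = h (gen v) \<otimes>\<^bsub>T\<^esub> h Y" if "v \<in> gens P" for v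
    by (rule lin_map_eqI[OF lin_map_comp[OF GQ.lin_map_mult_right h]
          lin_map_comp[OF h T.lin_map_mult_right] T.module_axioms _ Y])
      (use that gen gen_closed lin_map_closed[OF h] in auto)
  show ?thesis
    by (rule lin_map_eqI[OF lin_map_comp[OF GQ.lin_map_mult_left h]
          lin_map_comp[OF h T.lin_map_mult_left] T.module_axioms _ X])
      (use Y 1 lin_map_closed[OF h] in auto)
qed

text \<open>The differential \<open>d\<close> is a parameter instead of the one prescribed by the
  presentation, because relative free extensions carry a differential put in afterwards. All
  conditions on \<open>h\<close> are tested on words.\<close>

lemma dga_mor_presented:
  assumes Q: "graded_alg R Q" and T: "graded_alg R T" and h: "lin_map R Q T h"
    and mult: "\<And>v w. v \<in> gens P \<Longrightarrow> w \<in> gens P \<Longrightarrow> h (gen v \<otimes>\<^bsub>Q\<^esub> gen w) = h (gen v) \<otimes>\<^bsub>T\<^esub> h (gen w)"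
    and one: "h (gen (wunit P)) = \<one>\<^bsub>T\<^esub>"
    and deg: "\<And>w. w \<in> gens P \<Longrightarrow> h (gen w) \<in> gr T (wdeg P w)"
    and d: "lin_map R Q Q d" "lin_map R T T (dif T)"
    and dif: "\<And>w. w \<in> gens P \<Longrightarrow> h (d (gen w)) = dif T (h (gen w))"
  shows "dga_mor R (Q\<lparr>dif := d\<rparr>) T h"
proof -
  interpret T: graded_alg R T by fact
  have "h X \<in> gr T i" if "X \<in> gr Q i" for X i
    by (rule lin_map_gr[OF h T.module_axioms T.gr_sub _ that]) (use deg in auto)
  moreover have "h (d X) = dif T (h X)" if "X \<in> carrier Q" for X
    by (rule lin_map_eqI[OF lin_map_comp[OF d(1) h] lin_map_comp[OF h d(2)] T.module_axioms dif that])
  ultimately show ?thesis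
    using lin_map_mult[OF Q T h mult] one h
    by (auto simp: dga_mor_def ring_hom_def lin_map_def one_Q)
qed

end

text \<open>The two assumptions say that the span of the relations is a two-sided ideal, in a form
  that has to be verified for one word times one relation.\<close>

locale presented_algebra = graded_presentation R P
  for R :: "('r, 'q) ring_scheme" (structure) and P :: "('r, 'w) presentation" +
  assumes rels_left: "v \<in> gens P \<Longrightarrow> f \<in> rels P \<Longrightarrow>
      lin_comb R (presented R P) (\<lambda>u. pclass R P (wmult P v u)) f = \<zero>\<^bsub>presented R P\<^esub>"
    and rels_right: "v \<in> gens P \<Longrightarrow> f \<in> rels P \<Longrightarrow>
      lin_comb R (presented R P) (\<lambda>u. pclass R P (wmult P u v)) f = \<zero>\<^bsub>presented R P\<^esub>"
begin

text \<open>Linearity in \<open>f\<close> reduces to a single word, then linearity in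
  \<open>n\<close> reduces to a single relation, where \<open>rels_left\<close> applies.\<close>

lemma mult_F_N:
  assumes f: "f \<in> carrier F" and n: "n \<in> N"
  shows "cls (f \<otimes>\<^bsub>F\<^esub> n) = \<zero>\<^bsub>Q\<^esub>"
proof -
  have nF: "n \<in> carrier F" using n N_closed by auto
  have "cls (single R v \<otimes>\<^bsub>F\<^esub> n) = \<zero>\<^bsub>Q\<^esub>" if v: "v \<in> gens P" for v
  proof -
    have cl: "(\<lambda>u. cls (wmult P v u)) \<in> gens P \<rightarrow> carrier Q" using v wmult_closed cls_closed by auto
    have "cls (single R v \<otimes>\<^bsub>F\<^esub> n) = lin_comb R Q (\<lambda>u. cls (wmult P v u)) n"
      by (rule free_dg_lin_map_eqI[OF lin_map_comp[OF lin_map_mult_right_F lin_map_cls]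
            Q.lin_comb_linear[OF cl] Q.module_axioms _ nF])
        (use v cl in \<open>auto simp: mult_F_single single_closed Q.lin_comb_single Pi_iff\<close>)
    also have "\<dots> = \<zero>\<^bsub>Q\<^esub>"
      by (rule vanish_on_N[OF Q.lin_comb_linear[OF cl] Q.module_axioms _ n]) (use rels_left v in auto)
    finally show ?thesis .
  qed
  then show ?thesis
    by (intro free_dg_lin_map_eqI[OF lin_map_comp[OF lin_map_mult_left_F[OF nF] lin_map_cls]
         _ Q.module_axioms _ f, of "\<lambda>f. \<zero>\<^bsub>Q\<^esub>"]) (auto intro!: lin_mapI)
qed

lemma mult_N_F:
  assumes f: "f \<in> carrier F" and n: "n \<in> N"
  shows "cls (n \<otimes>\<^bsub>F\<^esub> f) = \<zero>\<^bsub>Q\<^esub>"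
proof -
  have nF: "n \<in> carrier F" using n N_closed by auto
  have "cls (n \<otimes>\<^bsub>F\<^esub> single R v) = \<zero>\<^bsub>Q\<^esub>" if v: "v \<in> gens P" for v
  proof -
    have cl: "(\<lambda>u. cls (wmult P u v)) \<in> gens P \<rightarrow> carrier Q" using v wmult_closed cls_closed by auto
    have "cls (n \<otimes>\<^bsub>F\<^esub> single R v) = lin_comb R Q (\<lambda>u. cls (wmult P u v)) n"
      by (rule free_dg_lin_map_eqI[OF lin_map_comp[OF lin_map_mult_left_F lin_map_cls]
            Q.lin_comb_linear[OF cl] Q.module_axioms _ nF])
        (use v cl in \<open>auto simp: mult_F_single single_closed Q.lin_comb_single Pi_iff\<close>)
    also have "\<dots> = \<zero>\<^bsub>Q\<^esub>"
      by (rule vanish_on_N[OF Q.lin_comb_linear[OF cl] Q.module_axioms _ n]) (use rels_right v in auto)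
    finally show ?thesis .
  qed
  then show ?thesis
    by (intro free_dg_lin_map_eqI[OF lin_map_comp[OF lin_map_mult_right_F[OF nF] lin_map_cls]
         _ Q.module_axioms _ f, of "\<lambda>f. \<zero>\<^bsub>Q\<^esub>"]) (auto intro!: lin_mapI)
qed

text \<open>The product of two classes is a union over pairs of representatives. Representatives are
  exchanged one factor at a time, and the ideal property keeps the class of the product
  fixed.\<close>

lemma mult_cls:
  assumes f: "f \<in> carrier F" and g: "g \<in> carrier F"
  shows "cls f \<otimes>\<^bsub>Q\<^esub> cls g = cls (f \<otimes>\<^bsub>F\<^esub> g)"
proof -
  have "cls (x \<otimes>\<^bsub>F\<^esub> y) = cls (f \<otimes>\<^bsub>F\<^esub> g)" if x: "x \<in> cls f" and y: "y \<in> cls g" for x y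
  proof -
    have xF: "x \<in> carrier F" using x f mem_cls_iff by auto
    have "cls (x \<otimes>\<^bsub>F\<^esub> y) = cls (x \<otimes>\<^bsub>F\<^esub> g)"
      using mult_F_N[OF xF]
      by (intro const_on_cls[OF lin_map_comp[OF lin_map_mult_right_F[OF xF] lin_map_cls] Q.module_axioms _ g y]) auto
    also have "\<dots> = cls (f \<otimes>\<^bsub>F\<^esub> g)"
      using mult_N_F[OF g]
      by (intro const_on_cls[OF lin_map_comp[OF lin_map_mult_left_F[OF g] lin_map_cls] Q.module_axioms _ f x]) auto
    finally show ?thesis .
  qed
  then show ?thesis
    unfolding mult_Q_Union using cls_self[OF f] cls_self[OF g] by blast
qed

lemma gen_mult: "v \<in> gens P \<Longrightarrow> w \<in> gens P \<Longrightarrow> gen v \<otimes>\<^bsub>Q\<^esub> gen w = cls (wmult P v w)"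
  by (simp add: mult_cls single_closed mult_F_single)

lemma lin_map_mult_left_Q:
  assumes "Y \<in> carrier Q" shows "lin_map R Q Q (\<lambda>X. X \<otimes>\<^bsub>Q\<^esub> Y)"
proof (rule lin_mapI)
  obtain g where g: "g \<in> carrier F" "Y = cls g" using assms by (auto simp: carrier_Q)
  note L = lin_map_mult_left_F[OF g(1)]
  have car: "\<exists>f\<in>carrier F. X = cls f" if "X \<in> carrier Q" for X using that by (auto simp: carrier_Q)
  show "X \<otimes>\<^bsub>Q\<^esub> Y \<in> carrier Q" if "X \<in> carrier Q" for X
    using car[OF that] g by (auto simp: mult_cls cls_closed mult_F_closed)
  show "(X \<oplus>\<^bsub>Q\<^esub> X') \<otimes>\<^bsub>Q\<^esub> Y = X \<otimes>\<^bsub>Q\<^esub> Y \<oplus>\<^bsub>Q\<^esub> X' \<otimes>\<^bsub>Q\<^esub> Y" if X: "X \<in> carrier Q" "X' \<in> carrier Q" for X X'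
  proof -
    obtain f f' where f: "f \<in> carrier F" "X = cls f" "f' \<in> carrier F" "X' = cls f'" using X by (meson car)
    show ?thesis
      using lin_map_add[OF L f(1,3)] f g
      by (simp add: cls_add[symmetric] mult_cls mult_F_closed F.a_closed del: free_dg_simps)
  qed
  show "(a \<odot>\<^bsub>Q\<^esub> X) \<otimes>\<^bsub>Q\<^esub> Y = a \<odot>\<^bsub>Q\<^esub> (X \<otimes>\<^bsub>Q\<^esub> Y)" if X: "a \<in> carrier R" "X \<in> carrier Q" for a X
  proof -
    obtain f where f: "f \<in> carrier F" "X = cls f" using X by (meson car)
    show ?thesis
      using lin_map_smult[OF L X(1) f(1)] f g X(1)
      by (simp add: cls_smult[symmetric] mult_cls mult_F_closed F.smult_closed del: free_dg_simps)
  qed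
qed

lemma lin_map_mult_right_Q:
  assumes "X \<in> carrier Q" shows "lin_map R Q Q (\<lambda>Y. X \<otimes>\<^bsub>Q\<^esub> Y)"
proof (rule lin_mapI)
  obtain g where g: "g \<in> carrier F" "X = cls g" using assms by (auto simp: carrier_Q)
  note L = lin_map_mult_right_F[OF g(1)]
  have car: "\<exists>f\<in>carrier F. Y = cls f" if "Y \<in> carrier Q" for Y using that by (auto simp: carrier_Q)
  show "X \<otimes>\<^bsub>Q\<^esub> Y \<in> carrier Q" if "Y \<in> carrier Q" for Y
    using car[OF that] g by (auto simp: mult_cls cls_closed mult_F_closed)
  show "X \<otimes>\<^bsub>Q\<^esub> (Y \<oplus>\<^bsub>Q\<^esub> Y') = X \<otimes>\<^bsub>Q\<^esub> Y \<oplus>\<^bsub>Q\<^esub> X \<otimes>\<^bsub>Q\<^esub> Y'" if Y: "Y \<in> carrier Q" "Y' \<in> carrier Q" for Y Y'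
  proof -
    obtain f f' where f: "f \<in> carrier F" "Y = cls f" "f' \<in> carrier F" "Y' = cls f'" using Y by (meson car)
    show ?thesis
      using lin_map_add[OF L f(1,3)] f g
      by (simp add: cls_add[symmetric] mult_cls mult_F_closed F.a_closed del: free_dg_simps)
  qed
  show "X \<otimes>\<^bsub>Q\<^esub> (a \<odot>\<^bsub>Q\<^esub> Y) = a \<odot>\<^bsub>Q\<^esub> (X \<otimes>\<^bsub>Q\<^esub> Y)" if Y: "a \<in> carrier R" "Y \<in> carrier Q" for a Y
  proof -
    obtain f where f: "f \<in> carrier F" "Y = cls f" using Y by (meson car)
    show ?thesis
      using lin_map_smult[OF L Y(1) f(1)] f g Y(1)
      by (simp add: cls_smult[symmetric] mult_cls mult_F_closed F.smult_closed del: free_dg_simps)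
  qed
qed

lemma mult_gr_Q:
  assumes X: "X \<in> gr Q i" and Y: "Y \<in> gr Q j"
  shows "X \<otimes>\<^bsub>Q\<^esub> Y \<in> gr Q (i + j)"
proof -
  have gr: "gr Q k \<subseteq> carrier Q" for k by (rule Q.submoduleE(1)[OF submodule_gr_Q])
  have "gen v \<otimes>\<^bsub>Q\<^esub> Y \<in> gr Q (i + j)" if v: "v \<in> gens P" "wdeg P v = i" for v
    by (rule lin_map_gr[OF lin_map_mult_right_Q[OF gen_closed[OF v(1)]] Q.module_axioms submodule_gr_Q _ Y])
      (use v wmult_gr[OF v(1)] in \<open>auto simp: gen_mult gr_Q\<close>)
  then show ?thesis
    by (intro lin_map_gr[OF lin_map_mult_left_Q Q.module_axioms submodule_gr_Q _ X]) (use Y gr in auto)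
qed

lemma graded_alg_Q: "graded_alg R Q"
proof (intro graded_alg.intro Q.module_axioms graded_alg_axioms.intro)
  fix x y z a assume *: "x \<in> carrier Q" "y \<in> carrier Q"
  show "x \<otimes>\<^bsub>Q\<^esub> y \<in> carrier Q" using lin_map_closed[OF lin_map_mult_left_Q] * by blast
  show "(x \<oplus>\<^bsub>Q\<^esub> y) \<otimes>\<^bsub>Q\<^esub> z = x \<otimes>\<^bsub>Q\<^esub> z \<oplus>\<^bsub>Q\<^esub> y \<otimes>\<^bsub>Q\<^esub> z" if "z \<in> carrier Q"
    using lin_map_add[OF lin_map_mult_left_Q[OF that]] * by blast
  show "x \<otimes>\<^bsub>Q\<^esub> (y \<oplus>\<^bsub>Q\<^esub> z) = x \<otimes>\<^bsub>Q\<^esub> y \<oplus>\<^bsub>Q\<^esub> x \<otimes>\<^bsub>Q\<^esub> z" if "z \<in> carrier Q"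
    using lin_map_add[OF lin_map_mult_right_Q] that * by blast
next
  fix x y a assume *: "a \<in> carrier R" "x \<in> carrier Q" "y \<in> carrier Q"
  show "(a \<odot>\<^bsub>Q\<^esub> x) \<otimes>\<^bsub>Q\<^esub> y = a \<odot>\<^bsub>Q\<^esub> (x \<otimes>\<^bsub>Q\<^esub> y)"
    using lin_map_smult[OF lin_map_mult_left_Q] * by blast
  show "x \<otimes>\<^bsub>Q\<^esub> (a \<odot>\<^bsub>Q\<^esub> y) = a \<odot>\<^bsub>Q\<^esub> (x \<otimes>\<^bsub>Q\<^esub> y)"
    using lin_map_smult[OF lin_map_mult_right_Q] * by blast
qed (use submodule_gr_Q gen_gr[OF wunit_gens] mult_gr_Q in \<open>auto simp: one_Q wdeg_wunit\<close>)

end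


section \<open>Relations written as differences\<close>

context cring
begin

lemma fadd_closed: "f \<in> carrier (free_dg R P) \<Longrightarrow> g \<in> carrier (free_dg R P) \<Longrightarrow> fadd R f g \<in> carrier (free_dg R P)"
  and fscale_closed: "a \<in> carrier R \<Longrightarrow> f \<in> carrier (free_dg R P) \<Longrightarrow> fscale R a f \<in> carrier (free_dg R P)"
proof -
  interpret F: module R "free_dg R P" by (rule module_free_dg)
  show "f \<in> carrier (free_dg R P) \<Longrightarrow> g \<in> carrier (free_dg R P) \<Longrightarrow> fadd R f g \<in> carrier (free_dg R P)"
    using F.a_closed[of f g] by simp
  show "a \<in> carrier R \<Longrightarrow> f \<in> carrier (free_dg R P) \<Longrightarrow> fscale R a f \<in> carrier (free_dg R P)"
    using F.smult_closed[of a f] by simp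
qed

text \<open>\<open>fsub\<close> is defined pointwise; in this form the rules for sums and multiples
  apply to it.\<close>

lemma fsub_eq:
  assumes "f \<in> carrier (free_dg R P)" "g \<in> carrier (free_dg R P)"
  shows "fsub R f g = fadd R f (fscale R (\<ominus> \<one>) g)"
  using assms by (auto simp: fun_eq_iff free_dg_carrier_iff a_minus_def l_minus)

lemma fsub_closed: "f \<in> carrier (free_dg R P) \<Longrightarrow> g \<in> carrier (free_dg R P) \<Longrightarrow> fsub R f g \<in> carrier (free_dg R P)"
  by (simp add: fsub_eq fadd_closed fscale_closed)

lemma sg_closed: "sg R k \<in> carrier R"
  by (simp add: sg_def)

lemma sg_zero: "sg R 0 = \<one>"
  by (simp add: sg_def)

lemma sg_add: "sg R (k + l) = sg R k \<otimes> sg R l"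
  by (simp add: sg_def l_minus)

end

context module
begin

text \<open>The relations of tensor products, tensor powers and free algebras are differences, so
  killing one of them means taking equal values on its two terms.\<close>

lemma lin_comb_fsub_zero:
  assumes "D \<in> gens (P :: ('a, _) presentation) \<rightarrow> carrier M" "f \<in> carrier (free_dg R P)" "g \<in> carrier (free_dg R P)"
    and "lin_comb R M D f = lin_comb R M D g"
  shows "lin_comb R M D (fsub R f g) = \<zero>\<^bsub>M\<^esub>"
proof -
  note L = lin_comb_linear[OF assms(1)]
  have "lin_comb R M D (fsub R f g) = lin_comb R M D f \<oplus>\<^bsub>M\<^esub> (\<ominus>\<^bsub>R\<^esub> \<one>\<^bsub>R\<^esub>) \<odot>\<^bsub>M\<^esub> lin_comb R M D g"
    using lin_map_add[OF L assms(2) R.fscale_closed[OF _ assms(3)]] lin_map_smult[OF L _ assms(3)]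
    by (simp add: R.fsub_eq[OF assms(2,3)])
  then show ?thesis
    using lin_map_closed[OF L assms(3)] assms(4) by (simp add: smult_l_minus M.r_neg)
qed

lemma lin_comb_fadd_single:
  assumes "D \<in> gens (P :: ('a, _) presentation) \<rightarrow> carrier M" "v \<in> gens P" "w \<in> gens P"
  shows "lin_comb R M D (fadd R (single R v) (single R w)) = D v \<oplus>\<^bsub>M\<^esub> D w"
  using lin_map_add[OF lin_comb_linear[OF assms(1)] R.single_closed[OF assms(2)] R.single_closed[OF assms(3)]]
    assms by (auto simp: lin_comb_single Pi_iff)

lemma lin_comb_fscale_single:
  assumes "D \<in> gens (P :: ('a, _) presentation) \<rightarrow> carrier M" "a \<in> carrier R" "w \<in> gens P"
  shows "lin_comb R M D (fscale R a (single R w)) = a \<odot>\<^bsub>M\<^esub> D w"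
  using lin_map_smult[OF lin_comb_linear[OF assms(1)] assms(2) R.single_closed[OF assms(3)]]
    assms by (auto simp: lin_comb_single Pi_iff)

lemma lin_comb_rel_add:
  assumes "D \<in> gens (P :: ('a, _) presentation) \<rightarrow> carrier M" "u \<in> gens P" "v \<in> gens P" "w \<in> gens P" "D u = D v \<oplus>\<^bsub>M\<^esub> D w"
  shows "lin_comb R M D (fsub R (single R u) (fadd R (single R v) (single R w))) = \<zero>\<^bsub>M\<^esub>"
  using assms
  by (intro lin_comb_fsub_zero[OF assms(1)])
    (auto simp: R.single_closed R.fadd_closed lin_comb_fadd_single lin_comb_single Pi_iff)

lemma lin_comb_rel_smult:
  assumes "D \<in> gens (P :: ('a, _) presentation) \<rightarrow> carrier M" "u \<in> gens P" "w \<in> gens P" "a \<in> carrier R" "D u = a \<odot>\<^bsub>M\<^esub> D w"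
  shows "lin_comb R M D (fsub R (single R u) (fscale R a (single R w))) = \<zero>\<^bsub>M\<^esub>"
  using assms
  by (intro lin_comb_fsub_zero[OF assms(1)])
    (auto simp: R.single_closed R.fscale_closed lin_comb_fscale_single lin_comb_single Pi_iff)

lemma smult_left_commute:
  "a \<in> carrier R \<Longrightarrow> b \<in> carrier R \<Longrightarrow> x \<in> carrier M \<Longrightarrow> a \<odot>\<^bsub>M\<^esub> (b \<odot>\<^bsub>M\<^esub> x) = b \<odot>\<^bsub>M\<^esub> (a \<odot>\<^bsub>M\<^esub> x)"
  by (simp add: smult_assoc1[symmetric] R.m_comm)

end

lemma (in presented_module) cls_eq_of_rel:
  assumes "f \<in> carrier F" "g \<in> carrier F" "fsub R f g \<in> rels P"
  shows "cls f = cls g"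
proof -
  have "f \<ominus>\<^bsub>F\<^esub> g \<in> N"
    using assms rels_N F.minus_eq_smult[OF assms(2)] by (auto simp: a_minus_def fsub_eq)
  then show ?thesis
    unfolding pclass_def using F.coset_eq_iff[OF N assms(1,2)] by simp
qed


section \<open>Tensor products\<close>

text \<open>Used twice, for \<open>C\<close> tensored with \<open>\<Lambda> R W\<close> and for
  \<open>A\<close> tensored with \<open>\<Lambda> R W\<close>.\<close>

locale tensor_algs = A: graded_alg R A + B: graded_alg R B
  for R :: "('r, 'q) ring_scheme" and A :: "('r, 'a, 'm) dg_scheme" and B :: "('r, 'b, 'n) dg_scheme"
begin

abbreviation "PT \<equiv> tensor_pres R A B"
abbreviation "T \<equiv> tensor R A B"
abbreviation "pu \<equiv> pure R A B"

lemma gens_iff: "((i, a), (j, b)) \<in> gens PT \<longleftrightarrow> a \<in> gr A i \<and> b \<in> gr B j"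
  by (auto simp: tensor_pres_def)

lemma wmult_PT: "wmult PT ((i, a), (j, b)) ((i', a'), (j', b')) =
    fscale R (sg R (j * i')) (single R ((i + i', a \<otimes>\<^bsub>A\<^esub> a'), (j + j', b \<otimes>\<^bsub>B\<^esub> b')))"
  and wdeg_PT: "wdeg PT ((i, a), (j, b)) = i + j"
  and wunit_PT: "wunit PT = ((0, \<one>\<^bsub>A\<^esub>), (0, \<one>\<^bsub>B\<^esub>))"
  by (simp_all add: tensor_pres_def)

lemma rels_cases:
  assumes "f \<in> rels PT"
  obtains (add_left) i a a' j b where "a \<in> gr A i" "a' \<in> gr A i" "b \<in> gr B j"
      "f = fsub R (single R ((i, a \<oplus>\<^bsub>A\<^esub> a'), (j, b))) (fadd R (single R ((i, a), (j, b))) (single R ((i, a'), (j, b))))"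
    | (add_right) i a j b b' where "a \<in> gr A i" "b \<in> gr B j" "b' \<in> gr B j"
      "f = fsub R (single R ((i, a), (j, b \<oplus>\<^bsub>B\<^esub> b'))) (fadd R (single R ((i, a), (j, b))) (single R ((i, a), (j, b'))))"
    | (smult_left) c i a j b where "c \<in> carrier R" "a \<in> gr A i" "b \<in> gr B j"
      "f = fsub R (single R ((i, c \<odot>\<^bsub>A\<^esub> a), (j, b))) (fscale R c (single R ((i, a), (j, b))))"
    | (smult_right) c i a j b where "c \<in> carrier R" "a \<in> gr A i" "b \<in> gr B j"
      "f = fsub R (single R ((i, a), (j, c \<odot>\<^bsub>B\<^esub> b))) (fscale R c (single R ((i, a), (j, b))))"
  using assms unfolding tensor_pres_def presentation.simps Un_iff mem_Collect_eq
  by (elim disjE exE conjE) (rule that(1) that(2) that(3) that(4); assumption)+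

lemma rels_in_F: "rels PT \<subseteq> carrier (free_dg R PT)"
proof
  fix f assume "f \<in> rels PT"
  then show "f \<in> carrier (free_dg R PT)"
    by (cases rule: rels_cases)
      (auto intro!: A.R.fsub_closed A.R.fadd_closed A.R.fscale_closed A.R.single_closed
        simp: gens_iff A.gr_add B.gr_add A.gr_smult B.gr_smult)
qed

sublocale P: graded_presentation R PT
proof (intro graded_presentation.intro presented_module.intro graded_presentation_axioms.intro
    presented_module_axioms.intro A.R.is_cring rels_in_F)
  fix v w assume vw: "v \<in> gens PT" "w \<in> gens PT"
  obtain i a j b i' a' j' b' where eq: "v = ((i, a), (j, b))" "w = ((i', a'), (j', b'))"
    by (metis surj_pair)
  let ?u = "((i + i', a \<otimes>\<^bsub>A\<^esub> a'), (j + j', b \<otimes>\<^bsub>B\<^esub> b'))"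
  have "?u \<in> gens PT" using vw by (simp add: eq gens_iff A.mult_gr B.mult_gr)
  then have "single R ?u \<in> gr (free_dg R PT) (wdeg PT v + wdeg PT w)"
    using A.R.single_gr[of ?u PT] by (simp add: eq wdeg_PT algebra_simps)
  then show "wmult PT v w \<in> gr (free_dg R PT) (wdeg PT v + wdeg PT w)"
    using module.submoduleE(4)[OF A.R.module_free_dg A.R.submodule_gr_free_dg A.R.sg_closed]
    by (simp add: eq wmult_PT)
qed (simp_all add: wunit_PT gens_iff wdeg_PT A.one_gr B.one_gr)

lemma T_eq: "P.Q = T"
  by (simp add: tensor_def)

lemma gen_eq: "P.gen ((i, a), (j, b)) = pu (i, a) (j, b)"
  by (simp add: pure_def)

lemma module_T: "module R T"
  using P.Q.module_axioms by (simp add: T_eq)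

lemma pure_closed: "a \<in> gr A i \<Longrightarrow> b \<in> gr B j \<Longrightarrow> pu (i, a) (j, b) \<in> carrier T"
  using P.gen_closed[of "((i, a), (j, b))"] by (simp add: gens_iff gen_eq T_eq)

lemma pure_gr: "a \<in> gr A i \<Longrightarrow> b \<in> gr B j \<Longrightarrow> pu (i, a) (j, b) \<in> gr T (i + j)"
  using P.gen_gr[of "((i, a), (j, b))"] by (simp add: gens_iff gen_eq T_eq wdeg_PT)

lemma one_T: "\<one>\<^bsub>T\<^esub> = pu (0, \<one>\<^bsub>A\<^esub>) (0, \<one>\<^bsub>B\<^esub>)"
  using P.one_Q by (simp add: T_eq wunit_PT gen_eq)

lemma cls_fscale: "c \<in> carrier R \<Longrightarrow> a \<in> gr A i \<Longrightarrow> b \<in> gr B j \<Longrightarrow>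
    P.cls (fscale R c (single R ((i, a), (j, b)))) = c \<odot>\<^bsub>T\<^esub> pu (i, a) (j, b)"
  using P.cls_smult[of c "single R ((i, a), (j, b))"] by (simp add: A.R.single_closed gens_iff gen_eq T_eq)

lemma cls_fadd: "a \<in> gr A i \<Longrightarrow> b \<in> gr B j \<Longrightarrow> a' \<in> gr A i' \<Longrightarrow> b' \<in> gr B j' \<Longrightarrow>
    P.cls (fadd R (single R ((i, a), (j, b))) (single R ((i', a'), (j', b'))))
      = pu (i, a) (j, b) \<oplus>\<^bsub>T\<^esub> pu (i', a') (j', b')"
  using P.cls_add[of "single R ((i, a), (j, b))" "single R ((i', a'), (j', b'))"]
  by (simp add: A.R.single_closed gens_iff gen_eq T_eq)

lemma pure_add_left:
  assumes "a \<in> gr A i" "a' \<in> gr A i" "b \<in> gr B j"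
  shows "pu (i, a \<oplus>\<^bsub>A\<^esub> a') (j, b) = pu (i, a) (j, b) \<oplus>\<^bsub>T\<^esub> pu (i, a') (j, b)"
  unfolding cls_fadd[OF assms(1,3,2,3), symmetric]
  unfolding gen_eq[symmetric]
  by (rule P.cls_eq_of_rel)
    (use assms in \<open>auto simp: A.R.single_closed A.R.fadd_closed gens_iff A.gr_add\<close>,
      use assms in \<open>unfold tensor_pres_def presentation.simps, blast\<close>)

lemma pure_add_right:
  assumes "a \<in> gr A i" "b \<in> gr B j" "b' \<in> gr B j"
  shows "pu (i, a) (j, b \<oplus>\<^bsub>B\<^esub> b') = pu (i, a) (j, b) \<oplus>\<^bsub>T\<^esub> pu (i, a) (j, b')"
  unfolding cls_fadd[OF assms(1,2,1,3), symmetric]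
  unfolding gen_eq[symmetric]
  by (rule P.cls_eq_of_rel)
    (use assms in \<open>auto simp: A.R.single_closed A.R.fadd_closed gens_iff B.gr_add\<close>,
      use assms in \<open>unfold tensor_pres_def presentation.simps, blast\<close>)

lemma pure_smult_left:
  assumes "c \<in> carrier R" "a \<in> gr A i" "b \<in> gr B j"
  shows "pu (i, c \<odot>\<^bsub>A\<^esub> a) (j, b) = c \<odot>\<^bsub>T\<^esub> pu (i, a) (j, b)"
  unfolding cls_fscale[OF assms, symmetric]
  unfolding gen_eq[symmetric]
  by (rule P.cls_eq_of_rel)
    (use assms in \<open>auto simp: A.R.single_closed A.R.fscale_closed gens_iff A.gr_smult\<close>,
      use assms in \<open>unfold tensor_pres_def presentation.simps, blast\<close>)

lemma pure_smult_right:
  assumes "c \<in> carrier R" "a \<in> gr A i" "b \<in> gr B j"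
  shows "pu (i, a) (j, c \<odot>\<^bsub>B\<^esub> b) = c \<odot>\<^bsub>T\<^esub> pu (i, a) (j, b)"
  unfolding cls_fscale[OF assms, symmetric]
  unfolding gen_eq[symmetric]
  by (rule P.cls_eq_of_rel)
    (use assms in \<open>auto simp: A.R.single_closed A.R.fscale_closed gens_iff B.gr_smult\<close>,
      use assms in \<open>unfold tensor_pres_def presentation.simps, blast\<close>)

text \<open>\<open>D\<close> sees elements together with their degrees, so it may contain Koszul
  signs, and additivity is asked within one bidegree. The four equations match the four families of
  relations in \<open>tensor_pres\<close>.\<close>

definition bilinear_on_pure :: "('r, 't, 'k) module_scheme \<Rightarrow> ((int \<times> 'a) \<times> (int \<times> 'b) \<Rightarrow> 't) \<Rightarrow> bool" where
  "bilinear_on_pure U D \<longleftrightarrow>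
    (\<forall>i j. \<forall>a\<in>gr A i. \<forall>b\<in>gr B j. D ((i, a), (j, b)) \<in> carrier U \<and>
      (\<forall>a'\<in>gr A i. D ((i, a \<oplus>\<^bsub>A\<^esub> a'), (j, b)) = D ((i, a), (j, b)) \<oplus>\<^bsub>U\<^esub> D ((i, a'), (j, b))) \<and>
      (\<forall>b'\<in>gr B j. D ((i, a), (j, b \<oplus>\<^bsub>B\<^esub> b')) = D ((i, a), (j, b)) \<oplus>\<^bsub>U\<^esub> D ((i, a), (j, b'))) \<and>
      (\<forall>c\<in>carrier R. D ((i, c \<odot>\<^bsub>A\<^esub> a), (j, b)) = c \<odot>\<^bsub>U\<^esub> D ((i, a), (j, b))) \<and>
      (\<forall>c\<in>carrier R. D ((i, a), (j, c \<odot>\<^bsub>B\<^esub> b)) = c \<odot>\<^bsub>U\<^esub> D ((i, a), (j, b))))"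

lemma bilinear_closed:
  assumes "bilinear_on_pure U D" shows "D \<in> gens PT \<rightarrow> carrier U"
  using assms by (fastforce simp: bilinear_on_pure_def gens_iff)

lemma bilinear_rels:
  assumes U: "module R U" and D: "bilinear_on_pure U D" and f: "f \<in> rels PT"
  shows "lin_comb R U D f = \<zero>\<^bsub>U\<^esub>"
proof -
  interpret U: module R U by fact
  note cl = bilinear_closed[OF D]
  from f show ?thesis
  proof (cases rule: rels_cases)
    case (add_left i a a' j b)
    then show ?thesis using D
      by (auto simp: gens_iff A.gr_add bilinear_on_pure_def intro!: U.lin_comb_rel_add[OF cl])
  next
    case (add_right i a j b b')
    then show ?thesis using D
      by (auto simp: gens_iff B.gr_add bilinear_on_pure_def intro!: U.lin_comb_rel_add[OF cl])
  next
    case (smult_left c i a j b)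
    then show ?thesis using D
      by (auto simp: gens_iff A.gr_smult bilinear_on_pure_def intro!: U.lin_comb_rel_smult[OF cl])
  next
    case (smult_right c i a j b)
    then show ?thesis using D
      by (auto simp: gens_iff B.gr_smult bilinear_on_pure_def intro!: U.lin_comb_rel_smult[OF cl])
  qed
qed

text \<open>The universal property of the tensor product. It is what makes each later
  \<open>lin_ext\<close> on a tensor product have its prescribed values.\<close>

lemma
  assumes U: "module R U" and D: "bilinear_on_pure U D"
  shows tensor_lift_linear: "lin_map R T U (lin_ext R U D)"
    and tensor_lift_pure: "a \<in> gr A i \<Longrightarrow> b \<in> gr B j \<Longrightarrow> lin_ext R U D (pu (i, a) (j, b)) = D ((i, a), (j, b))"
  using P.lin_ext_linear[OF U bilinear_closed[OF D]] P.lin_ext_gen[OF U bilinear_closed[OF D], of "((i, a), (j, b))"]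
    bilinear_rels[OF U D] by (simp_all add: T_eq gens_iff gen_eq)

lemma tensor_eqI:
  assumes "lin_map R T U h" "lin_map R T U k" "module R U"
    and "\<And>i a j b. a \<in> gr A i \<Longrightarrow> b \<in> gr B j \<Longrightarrow> h (pu (i, a) (j, b)) = k (pu (i, a) (j, b))"
    and "x \<in> carrier T"
  shows "h x = k x"
proof (rule P.lin_map_eqI[unfolded T_eq, OF assms(1-3) _ assms(5)])
  fix w assume w: "w \<in> gens PT"
  obtain i a j b where "w = ((i, a), (j, b))" by (metis surj_pair)
  with w show "h (P.gen w) = k (P.gen w)" using assms(4) by (simp only: gens_iff gen_eq)
qed

text \<open>For fixed \<open>x\<close> and \<open>y\<close> this is left multiplication by their
  pure tensor, Koszul sign included. Bilinearity in the other factor shows that it kills the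
  relations, which is the left ideal condition.\<close>

lemma bilinear_left_mult:
  assumes "x \<in> gr A k" "y \<in> gr B l"
  shows "bilinear_on_pure T (\<lambda>((i, a), (j, b)). sg R (l * i) \<odot>\<^bsub>T\<^esub> pu (k + i, x \<otimes>\<^bsub>A\<^esub> a) (l + j, y \<otimes>\<^bsub>B\<^esub> b))"
proof -
  interpret T: module R T by (rule module_T)
  note [simp] = A.mult_gr[OF assms(1)] B.mult_gr[OF assms(2)] A.gr_closed[OF assms(1)] B.gr_closed[OF assms(2)]
    pure_closed A.R.sg_closed
  show ?thesis
    unfolding bilinear_on_pure_def
    by (auto simp: A.gr_closed B.gr_closed A.mult_add_right B.mult_add_right A.mult_smult_right B.mult_smult_right
        pure_add_left pure_add_right pure_smult_left pure_smult_right T.smult_r_distr T.smult_left_commute)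
qed

lemma bilinear_right_mult:
  assumes "x \<in> gr A k" "y \<in> gr B l"
  shows "bilinear_on_pure T (\<lambda>((i, a), (j, b)). sg R (j * k) \<odot>\<^bsub>T\<^esub> pu (i + k, a \<otimes>\<^bsub>A\<^esub> x) (j + l, b \<otimes>\<^bsub>B\<^esub> y))"
proof -
  interpret T: module R T by (rule module_T)
  note [simp] = A.mult_gr[OF _ assms(1)] B.mult_gr[OF _ assms(2)] A.gr_closed[OF assms(1)] B.gr_closed[OF assms(2)]
    pure_closed A.R.sg_closed
  show ?thesis
    unfolding bilinear_on_pure_def
    by (auto simp: A.gr_closed B.gr_closed A.mult_add_left B.mult_add_left A.mult_smult_left B.mult_smult_left
        pure_add_left pure_add_right pure_smult_left pure_smult_right T.smult_r_distr T.smult_left_commute)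
qed

text \<open>Relations are supported on words. There the class of a product of words can be replaced
  by the explicit signed pure tensor, for which bilinearity is known.\<close>

lemma lin_comb_cong_rel:
  assumes "\<And>w. w \<in> gens PT \<Longrightarrow> D w = E w" "f \<in> rels PT" "module R U" "E \<in> gens PT \<rightarrow> carrier U"
  shows "lin_comb R U D f = lin_comb R U E f"
proof -
  interpret U: module R U by fact
  have D: "D \<in> gens PT \<rightarrow> carrier U" using assms(1,4) by (simp add: Pi_iff)
  show ?thesis
  proof (rule A.R.free_dg_lin_map_eqI[OF U.lin_comb_linear[OF D] U.lin_comb_linear[OF assms(4)] assms(3)])
    show "f \<in> carrier (free_dg R PT)" using assms(2) rels_in_F by blast
    fix w assume "w \<in> gens PT"
    then show "lin_comb R U D (single R w) = lin_comb R U E (single R w)"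
      using D assms(1,4) by (simp add: U.lin_comb_single Pi_iff)
  qed
qed

sublocale P: presented_algebra R PT
proof (intro presented_algebra.intro presented_algebra_axioms.intro P.graded_presentation_axioms)
  fix v f assume v: "v \<in> gens PT" and f: "f \<in> rels PT"
  obtain k x l y where v': "v = ((k, x), (l, y))" by (metis surj_pair)
  with v have x: "x \<in> gr A k" and y: "y \<in> gr B l" by (simp_all add: gens_iff)
  have "lin_comb R T (\<lambda>u. P.cls (wmult PT v u)) f = lin_comb R T
      (\<lambda>((i, a), (j, b)). sg R (l * i) \<odot>\<^bsub>T\<^esub> pu (k + i, x \<otimes>\<^bsub>A\<^esub> a) (l + j, y \<otimes>\<^bsub>B\<^esub> b)) f"
    by (rule lin_comb_cong_rel[OF _ f module_T bilinear_closed[OF bilinear_left_mult[OF x y]]])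
      (use x y in \<open>auto simp: v' gens_iff wmult_PT cls_fscale A.R.sg_closed A.mult_gr B.mult_gr\<close>)
  then show "lin_comb R P.Q (\<lambda>u. P.cls (wmult PT v u)) f = \<zero>\<^bsub>P.Q\<^esub>"
    using bilinear_rels[OF module_T bilinear_left_mult[OF x y] f] by (simp add: T_eq)
  have "lin_comb R T (\<lambda>u. P.cls (wmult PT u v)) f = lin_comb R T
      (\<lambda>((i, a), (j, b)). sg R (j * k) \<odot>\<^bsub>T\<^esub> pu (i + k, a \<otimes>\<^bsub>A\<^esub> x) (j + l, b \<otimes>\<^bsub>B\<^esub> y)) f"
    by (rule lin_comb_cong_rel[OF _ f module_T bilinear_closed[OF bilinear_right_mult[OF x y]]])
      (use x y in \<open>auto simp: v' gens_iff wmult_PT cls_fscale A.R.sg_closed A.mult_gr B.mult_gr\<close>)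
  then show "lin_comb R P.Q (\<lambda>u. P.cls (wmult PT u v)) f = \<zero>\<^bsub>P.Q\<^esub>"
    using bilinear_rels[OF module_T bilinear_right_mult[OF x y] f] by (simp add: T_eq)
qed

sublocale T: graded_alg R T
  using P.graded_alg_Q by (simp add: T_eq)

lemma pure_mult:
  assumes "a \<in> gr A i" "b \<in> gr B j" "a' \<in> gr A i'" "b' \<in> gr B j'"
  shows "pu (i, a) (j, b) \<otimes>\<^bsub>T\<^esub> pu (i', a') (j', b')
    = sg R (j * i') \<odot>\<^bsub>T\<^esub> pu (i + i', a \<otimes>\<^bsub>A\<^esub> a') (j + j', b \<otimes>\<^bsub>B\<^esub> b')"
  using P.gen_mult[of "((i, a), (j, b))" "((i', a'), (j', b'))"] assms
  by (simp add: gens_iff wmult_PT cls_fscale A.R.sg_closed A.mult_gr B.mult_gr gen_eq T_eq)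

lemma tensor_mult:
  assumes U: "graded_alg R U" and h: "lin_map R T U h"
    and mult: "\<And>i a j b i' a' j' b'. a \<in> gr A i \<Longrightarrow> b \<in> gr B j \<Longrightarrow> a' \<in> gr A i' \<Longrightarrow> b' \<in> gr B j' \<Longrightarrow>
      h (pu (i, a) (j, b) \<otimes>\<^bsub>T\<^esub> pu (i', a') (j', b')) = h (pu (i, a) (j, b)) \<otimes>\<^bsub>U\<^esub> h (pu (i', a') (j', b'))"
    and "x \<in> carrier T" "y \<in> carrier T"
  shows "h (x \<otimes>\<^bsub>T\<^esub> y) = h x \<otimes>\<^bsub>U\<^esub> h y"
proof (rule P.lin_map_mult[unfolded T_eq, OF T.graded_alg_axioms U h _ assms(4,5)])
  fix v w assume vw: "v \<in> gens PT" "w \<in> gens PT"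
  obtain i a j b i' a' j' b' where "v = ((i, a), (j, b))" "w = ((i', a'), (j', b'))"
    by (metis surj_pair)
  with vw show "h (P.gen v \<otimes>\<^bsub>T\<^esub> P.gen w) = h (P.gen v) \<otimes>\<^bsub>U\<^esub> h (P.gen w)"
    using mult by (simp only: gens_iff gen_eq)
qed

lemma dga_mor_tensor:
  assumes U: "graded_alg R U" and h: "lin_map R T U h"
    and mult: "\<And>i a j b i' a' j' b'. a \<in> gr A i \<Longrightarrow> b \<in> gr B j \<Longrightarrow> a' \<in> gr A i' \<Longrightarrow> b' \<in> gr B j' \<Longrightarrow>
      h (pu (i, a) (j, b) \<otimes>\<^bsub>T\<^esub> pu (i', a') (j', b')) = h (pu (i, a) (j, b)) \<otimes>\<^bsub>U\<^esub> h (pu (i', a') (j', b'))"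
    and one: "h (pu (0, \<one>\<^bsub>A\<^esub>) (0, \<one>\<^bsub>B\<^esub>)) = \<one>\<^bsub>U\<^esub>"
    and deg: "\<And>i a j b. a \<in> gr A i \<Longrightarrow> b \<in> gr B j \<Longrightarrow> h (pu (i, a) (j, b)) \<in> gr U (i + j)"
    and d: "lin_map R T T d" "lin_map R U U (dif U)"
    and dif: "\<And>i a j b. a \<in> gr A i \<Longrightarrow> b \<in> gr B j \<Longrightarrow> h (d (pu (i, a) (j, b))) = dif U (h (pu (i, a) (j, b)))"
  shows "dga_mor R (T\<lparr>dif := d\<rparr>) U h"
  unfolding T_eq[symmetric]
  by (rule P.dga_mor_presented[OF P.graded_alg_Q U])
    (use h mult one deg d dif in \<open>auto simp: T_eq gens_iff gen_eq wunit_PT wdeg_PT split_paired_all\<close>)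

end

section \<open>Homogeneous components and the inclusion of the first factor\<close>

lemma (in graded_module) hcomp_homogeneous:
  assumes "x \<in> gr M i"
  shows "hcomp M x = (\<lambda>j. if j = i then x else \<zero>\<^bsub>M\<^esub>)"
proof -
  have x: "x \<in> carrier M" using assms submoduleE(1)[OF gr_submodule] by auto
  have "{j. (if j = i then x else \<zero>\<^bsub>M\<^esub>) \<noteq> \<zero>\<^bsub>M\<^esub>} = (if x = \<zero>\<^bsub>M\<^esub> then {} else {i})" by auto
  then have "decomposition M x (\<lambda>j. if j = i then x else \<zero>\<^bsub>M\<^esub>)"
    using assms x submodule_zero[OF gr_submodule] by (auto simp: decomposition_def)
  then show ?thesis
    unfolding hcomp_def using direct_sum[OF x] by (rule the1_equality[rotated])
qed

lemma (in graded_module) hcomp_decomposition: "x \<in> carrier M \<Longrightarrow> decomposition M x (hcomp M x)"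
  unfolding hcomp_def by (rule theI'[OF direct_sum])

lemma (in tensor_algs) incl_homogeneous:
  assumes "graded_module R A" and a: "a \<in> gr A i"
  shows "incl R A B a = pu (i, a) (0, \<one>\<^bsub>B\<^esub>)"
proof (cases "a = \<zero>\<^bsub>A\<^esub>")
  \<comment> \<open>The zero element has no nonzero component, so \<open>incl\<close> is an empty
    sum. The pure tensor with first factor zero vanishes because the scalar zero can be pulled out
    of it.\<close>
  case True
  have "pu (i, \<zero>\<^bsub>R\<^esub> \<odot>\<^bsub>A\<^esub> a) (0, \<one>\<^bsub>B\<^esub>) = \<zero>\<^bsub>R\<^esub> \<odot>\<^bsub>T\<^esub> pu (i, a) (0, \<one>\<^bsub>B\<^esub>)"
    by (rule pure_smult_left) (use a B.one_gr in auto)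
  then have "pu (i, a) (0, \<one>\<^bsub>B\<^esub>) = \<zero>\<^bsub>T\<^esub>"
    using True pure_closed[OF a B.one_gr] by simp
  moreover have "hcomp A a = (\<lambda>j. \<zero>\<^bsub>A\<^esub>)"
    using graded_module.hcomp_homogeneous[OF assms] True by auto
  ultimately show ?thesis
    by (simp add: incl_def T.finsum_empty)
next
  case False
  then have "{j. hcomp A a j \<noteq> \<zero>\<^bsub>A\<^esub>} = {i}"
    by (simp add: graded_module.hcomp_homogeneous[OF assms])
  then show ?thesis
    using pure_closed[OF a B.one_gr]
    by (simp add: incl_def graded_module.hcomp_homogeneous[OF assms])
qed

text \<open>Reduces statements about \<open>incl\<close> to pure tensors of a homogeneous element
  with one, where all the maps of the proof have explicit values.\<close>

lemma (in tensor_algs) lin_map_incl: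
  assumes "graded_module R A" "module R U" "lin_map R T U h" "a \<in> carrier A"
  shows "h (incl R A B a) = (\<Oplus>\<^bsub>U\<^esub>i\<in>{i. hcomp A a i \<noteq> \<zero>\<^bsub>A\<^esub>}. h (pu (i, hcomp A a i) (0, \<one>\<^bsub>B\<^esub>)))"
proof -
  have "hcomp A a i \<in> gr A i" for i
    using graded_module.hcomp_decomposition[OF assms(1,4)] by (simp add: decomposition_def)
  then show ?thesis
    unfolding incl_def
    by (intro lin_map_finsum[OF assms(3) module_T assms(2)]) (auto intro: pure_closed B.one_gr)
qed


section \<open>Free graded commutative algebras and tensor powers\<close>

lemma hwords_simps [simp]:
  "[] \<in> hwords M"
  "(i, x) # w \<in> hwords M \<longleftrightarrow> x \<in> gr M i \<and> w \<in> hwords M"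
  "v @ w \<in> hwords M \<longleftrightarrow> v \<in> hwords M \<and> w \<in> hwords M"
  by (auto simp: hwords_def)

lemma word_deg_simps [simp]:
  "word_deg [] = 0" "word_deg (p # w) = fst p + word_deg w" "word_deg (v @ w) = word_deg v + word_deg w"
  by (simp_all add: word_deg_def)

lemma multilinear_rels_cases:
  assumes "f \<in> multilinear_rels R M S"
  obtains (add) xs ys i x y where "x \<in> gr M i" "y \<in> gr M i" "xs @ (i, x) # ys \<in> S"
      "f = fsub R (single R (xs @ (i, x \<oplus>\<^bsub>M\<^esub> y) # ys))
             (fadd R (single R (xs @ (i, x) # ys)) (single R (xs @ (i, y) # ys)))"
    | (smult) xs ys i a x where "a \<in> carrier R" "x \<in> gr M i" "xs @ (i, x) # ys \<in> S"
      "f = fsub R (single R (xs @ (i, a \<odot>\<^bsub>M\<^esub> x) # ys)) (fscale R a (single R (xs @ (i, x) # ys)))"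
  using assms unfolding multilinear_rels_def Un_iff mem_Collect_eq
  by (elim disjE exE conjE) (rule that(1) that(2); assumption)+

text \<open>\<open>S\<close> is any set of words in which a letter may be exchanged for another of
  the same degree. This serves both free algebras, with all words, and tensor powers, with words of
  fixed length.\<close>

lemma multilinear_rels_closed:
  assumes "cring R" and P: "gens P = S"
    and S: "\<And>xs i x y ys. xs @ (i, x) # ys \<in> S \<Longrightarrow> y \<in> gr M i \<Longrightarrow> xs @ (i, y) # ys \<in> S"
    and gr: "\<And>i. submodule (gr M i) R M" and M: "module R M"
  shows "multilinear_rels R M S \<subseteq> carrier (free_dg R P)"
proof
  interpret cring R by fact
  fix f assume "f \<in> multilinear_rels R M S"
  then show "f \<in> carrier (free_dg R P)"
  proof (cases rule: multilinear_rels_cases)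
    case (add xs ys i x y)
    then show ?thesis
      using S[of xs i x ys] module.submoduleE(5)[OF M gr, of x i y]
      by (auto intro!: fsub_closed fadd_closed single_closed simp: P)
  next
    case (smult xs ys i a x)
    then show ?thesis
      using S[of xs i x ys] module.submoduleE(4)[OF M gr, of a x i]
      by (auto intro!: fsub_closed fscale_closed single_closed simp: P)
  qed
qed

lemma multilinear_rels_vanish:
  fixes R :: "('r, 'q) ring_scheme" and M :: "('r, 'a, 'm) gmodule_scheme"
    and P :: "('r, (int \<times> 'a) list) presentation"
  assumes T: "module R T" and P: "gens P = S" and D: "D \<in> S \<rightarrow> carrier T"
    and S: "\<And>xs i x y ys. xs @ (i, x) # ys \<in> S \<Longrightarrow> y \<in> gr M i \<Longrightarrow> xs @ (i, y) # ys \<in> S"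
    and gr: "\<And>i. submodule (gr M i) R M" and M: "module R M"
    and add: "\<And>xs ys i x y. x \<in> gr M i \<Longrightarrow> y \<in> gr M i \<Longrightarrow> xs @ (i, x) # ys \<in> S \<Longrightarrow>
      D (xs @ (i, x \<oplus>\<^bsub>M\<^esub> y) # ys) = D (xs @ (i, x) # ys) \<oplus>\<^bsub>T\<^esub> D (xs @ (i, y) # ys)"
    and smult: "\<And>xs ys i x a. x \<in> gr M i \<Longrightarrow> a \<in> carrier R \<Longrightarrow> xs @ (i, x) # ys \<in> S \<Longrightarrow>
      D (xs @ (i, a \<odot>\<^bsub>M\<^esub> x) # ys) = a \<odot>\<^bsub>T\<^esub> D (xs @ (i, x) # ys)"
    and f: "f \<in> multilinear_rels R M S"
  shows "lin_comb R T D f = \<zero>\<^bsub>T\<^esub>"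
proof -
  interpret T: module R T by fact
  have D': "D \<in> gens P \<rightarrow> carrier T" using D P by simp
  from f show ?thesis
  proof (cases rule: multilinear_rels_cases)
    case (add xs ys i x y)
    then show ?thesis
      using assms(7)[of x i y xs ys] S module.submoduleE(5)[OF M gr, of x i y]
      by (auto simp: P intro!: T.lin_comb_rel_add[OF D'])
  next
    case (smult xs ys i a x)
    then show ?thesis
      using assms(8)[of x i a xs ys] S module.submoduleE(4)[OF M gr, of a x i]
      by (auto simp: P intro!: T.lin_comb_rel_smult[OF D'])
  qed
qed

locale free_cga_words = W: graded_module R W
  for R :: "('r, 'q) ring_scheme" and W :: "('r, 'v, 'm) gmodule_scheme"
begin

abbreviation "PL \<equiv> free_cga_pres R W"

lemma gens_PL: "gens PL = hwords W"
  and wmult_PL: "wmult PL v w = single R (v @ w)"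
  and wdeg_PL: "wdeg PL = word_deg"
  and wunit_PL: "wunit PL = []"
  by (simp_all add: free_cga_pres_def)

lemma rels_PL_cases:
  assumes "f \<in> rels PL"
  obtains (multilinear) "f \<in> multilinear_rels R W (hwords W)"
    | (swap) xs ys i x j y where "xs @ [(i, x), (j, y)] @ ys \<in> hwords W"
      "f = fsub R (single R (xs @ [(i, x), (j, y)] @ ys))
               (fscale R (sg R (i * j)) (single R (xs @ [(j, y), (i, x)] @ ys)))"
  using assms unfolding free_cga_pres_def presentation.simps Un_iff mem_Collect_eq
  by (elim disjE exE conjE) (rule that(1) that(2); assumption)+

sublocale P: graded_presentation R PL
proof (intro graded_presentation.intro presented_module.intro graded_presentation_axioms.intro
    presented_module_axioms.intro W.R.is_cring)
  show "rels PL \<subseteq> carrier (free_dg R PL)"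
  proof
    fix f assume "f \<in> rels PL"
    then show "f \<in> carrier (free_dg R PL)"
    proof (cases rule: rels_PL_cases)
      case multilinear
      then show ?thesis
        using multilinear_rels_closed[OF W.R.is_cring gens_PL, of W] W.gr_submodule W.module_axioms by auto
    next
      case (swap xs ys i x j y)
      then show ?thesis
        by (auto intro!: W.R.fsub_closed W.R.fscale_closed W.R.single_closed simp: gens_PL W.R.sg_closed)
    qed
  qed
  show "wmult PL v w \<in> gr (free_dg R PL) (wdeg PL v + wdeg PL w)" if "v \<in> gens PL" "w \<in> gens PL" for v w
    using that W.R.single_gr[of "v @ w" PL] by (simp add: wmult_PL gens_PL wdeg_PL)
qed (simp_all add: gens_PL wunit_PL wdeg_PL)

lemma gen_multilinear:
  assumes "xs @ (i, x) # ys \<in> hwords W"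
  shows "y \<in> gr W i \<Longrightarrow> P.gen (xs @ (i, x \<oplus>\<^bsub>W\<^esub> y) # ys) = P.gen (xs @ (i, x) # ys) \<oplus>\<^bsub>P.Q\<^esub> P.gen (xs @ (i, y) # ys)"
    and "a \<in> carrier R \<Longrightarrow> P.gen (xs @ (i, a \<odot>\<^bsub>W\<^esub> x) # ys) = a \<odot>\<^bsub>P.Q\<^esub> P.gen (xs @ (i, x) # ys)"
proof -
  note gr = W.submoduleE(4,5)[OF W.gr_submodule] and s = W.R.single_closed[of _ PL, unfolded gens_PL]
  have rel: "multilinear_rels R W (hwords W) \<subseteq> rels PL" by (simp add: free_cga_pres_def)
  show "P.gen (xs @ (i, x \<oplus>\<^bsub>W\<^esub> y) # ys) = P.gen (xs @ (i, x) # ys) \<oplus>\<^bsub>P.Q\<^esub> P.gen (xs @ (i, y) # ys)"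
    if y: "y \<in> gr W i"
  proof -
    let ?f = "single R (xs @ (i, x \<oplus>\<^bsub>W\<^esub> y) # ys)"
    let ?g = "fadd R (single R (xs @ (i, x) # ys)) (single R (xs @ (i, y) # ys))"
    have "fsub R ?f ?g \<in> multilinear_rels R W (hwords W)"
      unfolding multilinear_rels_def using assms y by (intro UnI1) (simp, blast)
    then have "P.cls ?f = P.cls ?g"
      using rel assms y by (intro P.cls_eq_of_rel) (auto intro!: s W.R.fadd_closed gr)
    then show ?thesis
      using P.cls_add[OF s s, of "xs @ (i, x) # ys" "xs @ (i, y) # ys"] assms y by simp
  qed
  show "P.gen (xs @ (i, a \<odot>\<^bsub>W\<^esub> x) # ys) = a \<odot>\<^bsub>P.Q\<^esub> P.gen (xs @ (i, x) # ys)"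
    if a: "a \<in> carrier R"
  proof -
    let ?f = "single R (xs @ (i, a \<odot>\<^bsub>W\<^esub> x) # ys)"
    let ?g = "fscale R a (single R (xs @ (i, x) # ys))"
    have "fsub R ?f ?g \<in> multilinear_rels R W (hwords W)"
      unfolding multilinear_rels_def using assms a by (intro UnI2) (simp, blast)
    then have "P.cls ?f = P.cls ?g"
      using rel assms a by (intro P.cls_eq_of_rel) (auto intro!: s W.R.fscale_closed gr)
    then show ?thesis
      using P.cls_smult[OF a s, of "xs @ (i, x) # ys"] assms by simp
  qed
qed

lemma gen_swap:
  assumes "xs @ [(i, x), (j, y)] @ ys \<in> hwords W"
  shows "P.gen (xs @ [(i, x), (j, y)] @ ys) = sg R (i * j) \<odot>\<^bsub>P.Q\<^esub> P.gen (xs @ [(j, y), (i, x)] @ ys)"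
proof -
  note s = W.R.single_closed[of _ PL, unfolded gens_PL]
  let ?f = "single R (xs @ [(i, x), (j, y)] @ ys)"
  let ?g = "fscale R (sg R (i * j)) (single R (xs @ [(j, y), (i, x)] @ ys))"
  have "fsub R ?f ?g \<in> rels PL"
    unfolding free_cga_pres_def presentation.simps using assms by (intro UnI2) blast
  then have "P.cls ?f = P.cls ?g"
    using assms by (intro P.cls_eq_of_rel) (auto intro!: s W.R.fscale_closed W.R.sg_closed)
  then show ?thesis
    using P.cls_smult[OF W.R.sg_closed s, of "xs @ [(j, y), (i, x)] @ ys"] assms by simp
qed

text \<open>The relations are written with arbitrary prefixes and suffixes, so placing one between
  two words gives a relation of the same kind. With one of the two words empty, this yields the left
  and right ideal conditions.\<close>

lemma context_vanish:
  assumes v: "v \<in> hwords W" "w \<in> hwords W" and f: "f \<in> rels PL"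
  shows "lin_comb R P.Q (\<lambda>u. P.gen (v @ u @ w)) f = \<zero>\<^bsub>P.Q\<^esub>"
proof -
  let ?D = "\<lambda>u. P.gen (v @ u @ w)"
  have D: "?D \<in> gens PL \<rightarrow> carrier P.Q" using v by (auto simp: gens_PL intro!: P.gen_closed)
  from f show ?thesis
  proof (cases rule: rels_PL_cases)
    case multilinear
    show ?thesis
    proof (rule multilinear_rels_vanish[OF P.Q.module_axioms gens_PL _ _ W.gr_submodule W.module_axioms _ _ multilinear])
      show "?D (xs @ (i, x \<oplus>\<^bsub>W\<^esub> y) # ys) = ?D (xs @ (i, x) # ys) \<oplus>\<^bsub>P.Q\<^esub> ?D (xs @ (i, y) # ys)"
        if "x \<in> gr W i" "y \<in> gr W i" "xs @ (i, x) # ys \<in> hwords W" for xs ys i x y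
        using gen_multilinear(1)[of "v @ xs" i x "ys @ w" y] that v by simp
      show "?D (xs @ (i, a \<odot>\<^bsub>W\<^esub> x) # ys) = a \<odot>\<^bsub>P.Q\<^esub> ?D (xs @ (i, x) # ys)"
        if "x \<in> gr W i" "a \<in> carrier R" "xs @ (i, x) # ys \<in> hwords W" for xs ys i x a
        using gen_multilinear(2)[of "v @ xs" i x "ys @ w" a] that v by simp
    qed (use D gens_PL in auto)
  next
    case (swap xs ys i x j y)
    let ?u = "xs @ [(i, x), (j, y)] @ ys" and ?u' = "xs @ [(j, y), (i, x)] @ ys"
    have "?D ?u = sg R (i * j) \<odot>\<^bsub>P.Q\<^esub> ?D ?u'"
      using gen_swap[of "v @ xs" i x j y "ys @ w"] v swap(1) by simp
    moreover have "?u \<in> gens PL" "?u' \<in> gens PL" using swap(1) by (auto simp: gens_PL)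
    ultimately show ?thesis
      unfolding swap(2) by (intro P.Q.lin_comb_rel_smult[OF D] W.R.sg_closed)
  qed
qed

sublocale P: presented_algebra R PL
  by (intro presented_algebra.intro presented_algebra_axioms.intro P.graded_presentation_axioms)
    (use context_vanish[of _ "[]"] context_vanish[of "[]"] in \<open>simp_all add: wmult_PL gens_PL\<close>)

lemma graded_alg: "graded_alg R (\<Lambda> R W)"
  using P.graded_alg_Q by (simp add: free_cga_def)

lemma one_mult:
  assumes "x \<in> carrier (\<Lambda> R W)"
  shows "\<one>\<^bsub>\<Lambda> R W\<^esub> \<otimes>\<^bsub>\<Lambda> R W\<^esub> x = x"
proof -
  have "P.gen [] \<otimes>\<^bsub>P.Q\<^esub> x = x"
    by (rule P.lin_map_eqI[OF P.lin_map_mult_right_Q lin_map_id P.Q.module_axioms])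
      (use assms P.gen_mult[of "[]"] P.gen_closed[of "[]"] in \<open>auto simp: gens_PL wmult_PL free_cga_def\<close>)
  then show ?thesis
    by (simp add: free_cga_def P.one_Q wunit_PL)
qed

end

section \<open>The differential on classes of words\<close>

context presented_module
begin

lemma dif_F_single:
  assumes "w \<in> gens P" "wdif P w \<in> carrier F"
  shows "dif F (single R w) = wdif P w"
proof
  fix u
  \<comment> \<open>The zero ring is allowed: there \<open>single\<close> has empty support, and all
    values are zero anyway.\<close>
  have "fsupp R (single R w) = (if \<one> = \<zero> then {} else {w})" by (auto simp: fsupp_def single_def)
  moreover have "wdif P w u \<in> carrier R" using assms(2) by (simp add: free_dg_carrier_iff)
  moreover have "wdif P w u = \<zero>" if "\<one> = \<zero>"
    using that \<open>wdif P w u \<in> carrier R\<close> by (metis l_one l_null)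
  ultimately show "dif F (single R w) u = wdif P w u"
    by (auto simp: free_dg_def single_def)
qed

text \<open>The companion of \<open>mult_Q_if_closed\<close> for the differential: a union of cosets
  that is known to be a coset is the class of any of its elements.\<close>

lemma dif_Q_if_closed:
  assumes w: "w \<in> gens P" "wdif P w \<in> carrier F" and "dif Q (gen w) \<in> carrier Q"
  shows "dif Q (gen w) = cls (wdif P w)"
proof -
  obtain h where h: "h \<in> carrier F" "dif Q (gen w) = cls h"
    using assms(3) by (auto simp: carrier_Q)
  have "dif Q (gen w) = (\<Union>x\<in>gen w. cls (dif F x))"
    by (simp add: presented_def factor_dg_def pclass_def)
  then have "wdif P w \<in> dif Q (gen w)"
    using cls_self[OF single_closed[OF w(1)]] cls_self[OF w(2)] dif_F_single[OF w] by force
  then show ?thesis using h cls_eqI[OF h(1)] by auto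
qed

end

text \<open>\<open>cdga_tpow\<close> will come from the mildness of tensor powers in
  \<open>model_family\<close>. It guarantees that products and differentials of classes are classes,
  after which \<open>mult_Q_if_closed\<close> and \<open>dif_Q_if_closed\<close> identify
  them.\<close>

locale tensor_power = A: cdga R A
  for R :: "('r, 'q) ring_scheme" and A :: "('r, 'a, 'm) dg_scheme" +
  fixes n :: nat
  assumes cdga_tpow: "cdga R (tpow R A n)"
begin

sublocale G: graded_alg R A by (rule A.graded_alg)

abbreviation "PP \<equiv> tpow_pres R A n"

definition wprod :: "(int \<times> 'a) list \<Rightarrow> 'a" where
  "wprod w = foldr (\<lambda>p y. snd p \<otimes>\<^bsub>A\<^esub> y) w \<one>\<^bsub>A\<^esub>"

lemma wprod_simps [simp]: "wprod [] = \<one>\<^bsub>A\<^esub>" "wprod (p # w) = snd p \<otimes>\<^bsub>A\<^esub> wprod w"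
  by (simp_all add: wprod_def)

lemma wprod_gr: "w \<in> hwords A \<Longrightarrow> wprod w \<in> gr A (word_deg w)"
  by (induction w) (auto simp: G.one_gr G.mult_gr)

lemma wprod_closed: "w \<in> hwords A \<Longrightarrow> wprod w \<in> carrier A"
  using wprod_gr G.gr_closed by blast

lemma wprod_append: "v \<in> hwords A \<Longrightarrow> w \<in> hwords A \<Longrightarrow> wprod (v @ w) = wprod v \<otimes>\<^bsub>A\<^esub> wprod w"
  by (induction v) (auto simp: A.one_mult wprod_closed A.mult_assoc G.gr_closed)

lemma gens_PP: "gens PP = {w \<in> hwords A. length w = n}"
  and wdeg_PP: "wdeg PP = word_deg"
  and wunit_PP: "wunit PP = replicate n (0, \<one>\<^bsub>A\<^esub>)"
  and wdif_PP: "wdif PP = word_dif R (dif A)"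
  and rels_PP: "rels PP = multilinear_rels R A {w \<in> hwords A. length w = n}"
  and wmult_PP: "wmult PP v w = fscale R (sg R (\<Sum>i<n. \<Sum>j<i. fst (v ! i) * fst (w ! j)))
        (single R (map2 (\<lambda>(i, x) (j, y). (i + j, x \<otimes>\<^bsub>A\<^esub> y)) v w))"
  by (simp_all add: tpow_pres_def)

lemma map2_hwords:
  "length v = length w \<Longrightarrow> v \<in> hwords A \<Longrightarrow> w \<in> hwords A \<Longrightarrow>
    map2 (\<lambda>(i, x) (j, y). (i + j, x \<otimes>\<^bsub>A\<^esub> y)) v w \<in> hwords A \<and>
    word_deg (map2 (\<lambda>(i, x) (j, y). (i + j, x \<otimes>\<^bsub>A\<^esub> y)) v w) = word_deg v + word_deg w"
  by (induction v w rule: list_induct2) (auto simp: G.mult_gr)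

sublocale P: graded_presentation R PP
proof (intro graded_presentation.intro presented_module.intro graded_presentation_axioms.intro
    presented_module_axioms.intro A.R.is_cring)
  show "rels PP \<subseteq> carrier (free_dg R PP)"
    unfolding rels_PP
    by (rule multilinear_rels_closed[OF A.R.is_cring gens_PP _ A.gr_submodule A.module_axioms]) auto
  show "wunit PP \<in> gens PP" "wdeg PP (wunit PP) = 0"
    by (auto simp: gens_PP wunit_PP wdeg_PP hwords_def word_deg_def G.one_gr sum_list_replicate)
  fix v w assume vw: "v \<in> gens PP" "w \<in> gens PP"
  let ?u = "map2 (\<lambda>(i, x) (j, y). (i + j, x \<otimes>\<^bsub>A\<^esub> y)) v w"
  have "?u \<in> gens PP" "wdeg PP ?u = wdeg PP v + wdeg PP w"
    using vw map2_hwords[of v w] by (auto simp: gens_PP wdeg_PP)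
  then have "single R ?u \<in> gr (free_dg R PP) (wdeg PP v + wdeg PP w)"
    using A.R.single_gr[of ?u PP] by simp
  then show "wmult PP v w \<in> gr (free_dg R PP) (wdeg PP v + wdeg PP w)"
    using module.submoduleE(4)[OF A.R.module_free_dg A.R.submodule_gr_free_dg A.R.sg_closed]
    by (simp add: wmult_PP)
qed

lemma Q_eq: "P.Q = tpow R A n"
  by (simp add: tpow_def)

lemma wprod_PP: "wprod \<in> gens PP \<rightarrow> carrier A"
  by (auto simp: gens_PP wprod_closed)

lemma wprod_rels: "\<forall>f\<in>rels PP. lin_comb R A wprod f = \<zero>\<^bsub>A\<^esub>"
proof
  fix f assume f: "f \<in> rels PP"
  show "lin_comb R A wprod f = \<zero>\<^bsub>A\<^esub>"
  proof (rule multilinear_rels_vanish[OF A.module_axioms gens_PP _ _ A.gr_submodule A.module_axioms _ _ f[unfolded rels_PP]])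
    show "wprod (xs @ (i, x \<oplus>\<^bsub>A\<^esub> y) # ys) = wprod (xs @ (i, x) # ys) \<oplus>\<^bsub>A\<^esub> wprod (xs @ (i, y) # ys)"
      if "x \<in> gr A i" "y \<in> gr A i" "xs @ (i, x) # ys \<in> {w \<in> hwords A. length w = n}" for xs ys i x y
      using that by (simp add: wprod_append G.gr_add G.mult_add_left G.mult_add_right G.gr_closed wprod_closed G.mult_closed)
    show "wprod (xs @ (i, a \<odot>\<^bsub>A\<^esub> x) # ys) = a \<odot>\<^bsub>A\<^esub> wprod (xs @ (i, x) # ys)"
      if "x \<in> gr A i" "a \<in> carrier R" "xs @ (i, x) # ys \<in> {w \<in> hwords A. length w = n}" for xs ys i x a
      using that by (simp add: wprod_append G.gr_smult G.mult_smult_left G.mult_smult_right G.gr_closed wprod_closed G.mult_closed)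
  qed (auto simp: wprod_closed)
qed

lemma mu_eq: "mu R A = lin_ext R A wprod"
  by (simp add: mu_def wprod_def[abs_def])

lemma mu_linear: "lin_map R P.Q A (mu R A)"
  unfolding mu_eq by (rule P.lin_ext_linear[OF A.module_axioms wprod_PP wprod_rels])

lemma mu_cls: "f \<in> carrier P.F \<Longrightarrow> mu R A (P.cls f) = lin_comb R A wprod f"
  unfolding mu_eq by (rule P.lin_ext_cls[OF A.module_axioms wprod_PP wprod_rels])

lemma mu_gen: "w \<in> gens PP \<Longrightarrow> mu R A (P.gen w) = wprod w"
  unfolding mu_eq by (rule P.lin_ext_gen[OF A.module_axioms wprod_PP wprod_rels])

text \<open>To turn the product of all letters of \<open>v\<close> followed by all letters of
  \<open>w\<close> into the letterwise product, each \<open>w ! j\<close> moves left past the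
  letters \<open>v ! i\<close> with \<open>i > j\<close>. The exponent adds up the products of their
  degrees. This is where multiplicativity of \<open>mu\<close> uses that \<open>A\<close> is graded
  commutative.\<close>

lemma wprod_map2:
  assumes "length v = length w" "v \<in> hwords A" "w \<in> hwords A"
  shows "sg R (\<Sum>i<length v. \<Sum>j<i. fst (v ! i) * fst (w ! j)) \<odot>\<^bsub>A\<^esub>
      wprod (map2 (\<lambda>(i, x) (j, y). (i + j, x \<otimes>\<^bsub>A\<^esub> y)) v w) = wprod v \<otimes>\<^bsub>A\<^esub> wprod w"
  using assms
proof (induction v w rule: list_induct2)
  case Nil
  then show ?case by (simp add: A.R.sg_zero G.one_mem A.one_mult)
next
  case (Cons p v q w)
  obtain i x j y where pq: "p = (i, x)" "q = (j, y)" by (metis surj_pair)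
  with Cons.prems have x: "x \<in> gr A i" "v \<in> hwords A" and y: "y \<in> gr A j" "w \<in> hwords A" by auto
  let ?m = "map2 (\<lambda>(i, x) (j, y). (i + j, x \<otimes>\<^bsub>A\<^esub> y)) v w"
  let ?s = "\<Sum>i<length v. \<Sum>j<i. fst (v ! i) * fst (w ! j)"
  have m: "wprod ?m \<in> carrier A" using map2_hwords[OF Cons.hyps x(2) y(2)] wprod_closed by blast
  note [simp] = G.gr_closed[OF x(1)] G.gr_closed[OF y(1)] wprod_closed[OF x(2)] wprod_closed[OF y(2)]
    G.mult_closed A.R.sg_closed m
  \<comment> \<open>Split off the terms with \<open>l = 0\<close>: the first letter of the second
    word passes all of \<open>v\<close>, which gives \<open>word_deg v * j\<close>. What remains is
    the exponent for the two tails.\<close>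
  have "(\<Sum>k<length (p # v). \<Sum>l<k. fst ((p # v) ! k) * fst ((q # w) ! l)) = word_deg v * j + ?s"
    by (simp add: sum.lessThan_Suc_shift sum.distrib pq word_deg_def sum_list_sum_nth
        atLeast0LessThan sum_distrib_right
        del: sum.lessThan_Suc)
  moreover have "wprod (p # v) \<otimes>\<^bsub>A\<^esub> wprod (q # w) = x \<otimes>\<^bsub>A\<^esub> ((wprod v \<otimes>\<^bsub>A\<^esub> y) \<otimes>\<^bsub>A\<^esub> wprod w)"
    by (simp add: pq A.mult_assoc)
  moreover have "wprod v \<otimes>\<^bsub>A\<^esub> y = sg R (word_deg v * j) \<odot>\<^bsub>A\<^esub> (y \<otimes>\<^bsub>A\<^esub> wprod v)"
    by (rule A.graded_comm[OF wprod_gr[OF x(2)] y(1)])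
  moreover have "wprod v \<otimes>\<^bsub>A\<^esub> wprod w = sg R ?s \<odot>\<^bsub>A\<^esub> wprod ?m"
    using Cons.IH x(2) y(2) by simp
  ultimately show ?case
    by (simp add: pq A.R.sg_add A.smult_assoc1 G.mult_smult_left G.mult_smult_right A.mult_assoc)
qed

lemma hwords_update:
  assumes "w \<in> hwords A" "k < length w"
  shows "w[k := (fst (w ! k) + 1, dif A (snd (w ! k)))] \<in> hwords A"
proof -
  have "\<forall>(i, x)\<in>set w. x \<in> gr A i" using assms(1) by (simp add: hwords_def)
  moreover have "w ! k \<in> set w" using assms(2) by simp
  ultimately have "dif A (snd (w ! k)) \<in> gr A (fst (w ! k) + 1)"
    using A.dif_degree by (auto simp: case_prod_beta)
  then show ?thesis
    using assms set_update_subset_insert[of w k] by (fastforce simp: hwords_def)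
qed

text \<open>Apply the Leibniz rule to one times one and cancel.\<close>

lemma dif_one: "dif A \<one>\<^bsub>A\<^esub> = \<zero>\<^bsub>A\<^esub>"
proof -
  have d: "dif A \<one>\<^bsub>A\<^esub> \<in> carrier A" using A.dif_degree[OF A.one_degree] G.gr_closed by blast
  have "dif A (\<one>\<^bsub>A\<^esub> \<otimes>\<^bsub>A\<^esub> \<one>\<^bsub>A\<^esub>) = dif A \<one>\<^bsub>A\<^esub> \<oplus>\<^bsub>A\<^esub> dif A \<one>\<^bsub>A\<^esub>"
    using A.leibniz[OF A.one_degree G.one_mem] d by (simp add: A.R.sg_zero A.one_mult A.mult_one G.mult_closed)
  then have "dif A \<one>\<^bsub>A\<^esub> = dif A \<one>\<^bsub>A\<^esub> \<oplus>\<^bsub>A\<^esub> dif A \<one>\<^bsub>A\<^esub>"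
    using G.one_mem by (simp add: A.one_mult)
  then show ?thesis using d by (metis A.M.add.r_cancel_one')
qed

text \<open>The iterated Leibniz rule: the differential passes the prefix \<open>take k w\<close>
  before it reaches the letter at position \<open>k\<close>, which accounts for the sign.\<close>

lemma dif_wprod:
  assumes "w \<in> hwords A"
  shows "dif A (wprod w) = (\<Oplus>\<^bsub>A\<^esub>k\<in>{..<length w}. sg R (word_deg (take k w)) \<odot>\<^bsub>A\<^esub>
      wprod (w[k := (fst (w ! k) + 1, dif A (snd (w ! k)))]))"
  using assms
proof (induction w)
  case Nil
  then show ?case by (simp add: dif_one A.M.finsum_empty)
next
  case (Cons p w)
  obtain i x where p: "p = (i, x)" by (metis surj_pair)
  with Cons.prems have x: "x \<in> gr A i" and w: "w \<in> hwords A" by auto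
  have dx: "dif A x \<in> gr A (i + 1)" by (rule A.dif_degree[OF x])
  let ?t = "\<lambda>w k. sg R (word_deg (take k w)) \<odot>\<^bsub>A\<^esub> wprod (w[k := (fst (w ! k) + 1, dif A (snd (w ! k)))])"
  have tc: "?t w k \<in> carrier A" if "k < length w" for k
    using wprod_closed[OF hwords_update[OF w that]] by (simp add: A.R.sg_closed)
  \<comment> \<open>Differentiating a letter of the tail picks up the factor \<open>x\<close> and
    the sign of its degree. These terms form the second half of the Leibniz rule, and
    \<open>t0\<close> is the first half.\<close>
  have tS: "?t (p # w) (Suc k) = sg R i \<odot>\<^bsub>A\<^esub> (x \<otimes>\<^bsub>A\<^esub> ?t w k)" if "k < length w" for k
    using wprod_closed[OF hwords_update[OF w that]] G.gr_closed[OF x]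
    by (simp add: p A.R.sg_add A.R.sg_closed A.smult_assoc1 G.mult_smult_right G.mult_closed)
  have t0: "?t (p # w) 0 = dif A x \<otimes>\<^bsub>A\<^esub> wprod w"
    using G.gr_closed[OF dx] wprod_closed[OF w] by (simp add: p A.R.sg_zero G.mult_closed)
  have L: "lin_map R A A (\<lambda>y. sg R i \<odot>\<^bsub>A\<^esub> (x \<otimes>\<^bsub>A\<^esub> y))"
    using G.gr_closed[OF x] A.R.sg_closed
    by (intro lin_mapI) (simp_all add: G.mult_closed G.mult_add_right A.smult_r_distr G.mult_smult_right A.smult_left_commute)
  have inj: "inj_on Suc {..<length w}" by simp
  have "(\<Oplus>\<^bsub>A\<^esub>k\<in>{..<length (p # w)}. ?t (p # w) k)
      = ?t (p # w) 0 \<oplus>\<^bsub>A\<^esub> (\<Oplus>\<^bsub>A\<^esub>k\<in>Suc ` {..<length w}. ?t (p # w) k)"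
    unfolding length_Cons lessThan_Suc_eq_insert_0
  proof (rule A.M.finsum_insert)
    show "?t (p # w) \<in> Suc ` {..<length w} \<rightarrow> carrier A"
      using tS tc lin_map_closed[OF L] by (auto simp del: take_Suc_Cons list_update.simps nth_Cons_Suc)
    show "?t (p # w) 0 \<in> carrier A"
      unfolding t0 using G.gr_closed[OF dx] wprod_closed[OF w] by (simp add: G.mult_closed)
  qed auto
  also have "(\<Oplus>\<^bsub>A\<^esub>k\<in>Suc ` {..<length w}. ?t (p # w) k) = (\<Oplus>\<^bsub>A\<^esub>k\<in>{..<length w}. ?t (p # w) (Suc k))"
    by (rule A.M.finsum_reindex[OF _ inj])
      (use tS tc lin_map_closed[OF L] in \<open>auto simp del: take_Suc_Cons list_update.simps nth_Cons_Suc\<close>)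
  also have "\<dots> = (\<Oplus>\<^bsub>A\<^esub>k\<in>{..<length w}. sg R i \<odot>\<^bsub>A\<^esub> (x \<otimes>\<^bsub>A\<^esub> ?t w k))"
    by (rule A.M.finsum_cong')
      (use tS tc lin_map_closed[OF L] in \<open>auto simp del: take_Suc_Cons list_update.simps nth_Cons_Suc\<close>)
  also have "\<dots> = sg R i \<odot>\<^bsub>A\<^esub> (x \<otimes>\<^bsub>A\<^esub> (\<Oplus>\<^bsub>A\<^esub>k\<in>{..<length w}. ?t w k))"
    by (rule lin_map_finsum[OF L A.module_axioms A.module_axioms, symmetric]) (use tc in auto)
  also have "\<dots> = sg R i \<odot>\<^bsub>A\<^esub> (x \<otimes>\<^bsub>A\<^esub> dif A (wprod w))"
    using Cons.IH[OF w] by simp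
  finally show ?case
    using A.leibniz[OF x wprod_closed[OF w]] t0 by (simp add: p)
qed

lemma word_dif_PP:
  assumes "w \<in> gens PP"
  shows "word_dif R (dif A) w \<in> carrier P.F"
    and "lin_comb R A wprod (word_dif R (dif A) w) = dif A (wprod w)"
proof -
  let ?u = "\<lambda>k. w[k := (fst (w ! k) + 1, dif A (snd (w ! k)))]"
  let ?s = "\<lambda>k. sg R (word_deg (take k w))"
  have u: "?u k \<in> gens PP" if "k \<in> {..<length w}" for k
    using assms that hwords_update by (auto simp: gens_PP)
  have f: "(\<lambda>k. fscale R (?s k) (single R (?u k))) \<in> {..<length w} \<rightarrow> carrier P.F"
    using u by (auto intro!: A.R.fscale_closed A.R.single_closed A.R.sg_closed)
  \<comment> \<open>\<open>word_dif\<close> is a sum in \<open>R\<close> at each word. Rewritten as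
    a sum in the free module, it can be pushed through \<open>lin_comb\<close>.\<close>
  have eq: "word_dif R (dif A) w = (\<Oplus>\<^bsub>P.F\<^esub>k\<in>{..<length w}. fscale R (?s k) (single R (?u k)))"
    by (rule ext) (simp add: word_dif_def A.R.finsum_free_dg_apply[OF f])
  show "word_dif R (dif A) w \<in> carrier P.F"
    unfolding eq by (rule P.F.finsum_closed[OF f])
  have "lin_comb R A wprod (word_dif R (dif A) w)
      = (\<Oplus>\<^bsub>A\<^esub>k\<in>{..<length w}. lin_comb R A wprod (fscale R (?s k) (single R (?u k))))"
    unfolding eq
    by (rule lin_map_finsum[OF A.lin_comb_linear[OF wprod_PP] P.F.module_axioms A.module_axioms f])
  also have "\<dots> = (\<Oplus>\<^bsub>A\<^esub>k\<in>{..<length w}. ?s k \<odot>\<^bsub>A\<^esub> wprod (?u k))"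
    using u wprod_PP
    by (intro A.M.finsum_cong') (auto simp: A.lin_comb_fscale_single[OF wprod_PP] A.R.sg_closed Pi_iff)
  also have "\<dots> = dif A (wprod w)"
    using assms by (intro dif_wprod[symmetric]) (simp add: gens_PP)
  finally show "lin_comb R A wprod (word_dif R (dif A) w) = dif A (wprod w)" .
qed

text \<open>On words, multiplicativity is \<open>wprod_map2\<close> and compatibility with the
  differentials is \<open>dif_wprod\<close>.\<close>

lemma mu_dga_mor: "dga_mor R (tpow R A n) A (mu R A)"
proof -
  interpret C: cdga R P.Q unfolding Q_eq by (rule cdga_tpow)
  interpret GC: graded_alg R P.Q by (rule C.graded_alg)
  \<comment> \<open>Updating \<open>dif\<close> by itself brings the algebra into the form that
    \<open>dga_mor_presented\<close> expects.\<close>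
  have "dga_mor R (P.Q\<lparr>dif := dif P.Q\<rparr>) A (mu R A)"
  proof (rule P.dga_mor_presented[OF GC.graded_alg_axioms G.graded_alg_axioms mu_linear])
    fix v w assume vw: "v \<in> gens PP" "w \<in> gens PP"
    let ?m = "map2 (\<lambda>(i, x) (j, y). (i + j, x \<otimes>\<^bsub>A\<^esub> y)) v w"
    have m: "?m \<in> gens PP" using vw map2_hwords[of v w] by (auto simp: gens_PP)
    have "P.gen v \<otimes>\<^bsub>P.Q\<^esub> P.gen w = P.cls (wmult PP v w)"
      using P.mult_Q_if_closed[OF A.R.single_closed[OF vw(1)] A.R.single_closed[OF vw(2)]]
        GC.mult_closed[OF P.gen_closed[OF vw(1)] P.gen_closed[OF vw(2)]] P.mult_F_single[OF vw] by simp
    also have "mu R A \<dots> = sg R (\<Sum>i<n. \<Sum>j<i. fst (v ! i) * fst (w ! j)) \<odot>\<^bsub>A\<^esub> wprod ?m"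
      using m by (simp add: mu_cls P.wmult_closed[OF vw])
        (simp add: wmult_PP A.lin_comb_fscale_single[OF wprod_PP] A.R.sg_closed)
    also have "\<dots> = wprod v \<otimes>\<^bsub>A\<^esub> wprod w"
      using wprod_map2[of v w] vw by (simp add: gens_PP)
    finally show "mu R A (P.gen v \<otimes>\<^bsub>P.Q\<^esub> P.gen w) = mu R A (P.gen v) \<otimes>\<^bsub>A\<^esub> mu R A (P.gen w)"
      using vw by (simp add: mu_gen)
  next
    have "wprod (replicate k (0, \<one>\<^bsub>A\<^esub>)) = \<one>\<^bsub>A\<^esub>" for k
      by (induction k) (simp_all add: A.one_mult G.one_mem)
    then show "mu R A (P.gen (wunit PP)) = \<one>\<^bsub>A\<^esub>"
      using mu_gen[OF P.wunit_gens] by (simp add: wunit_PP)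
  next
    fix w assume w: "w \<in> gens PP"
    show "mu R A (P.gen w) \<in> gr A (wdeg PP w)"
      using w by (simp add: mu_gen gens_PP wdeg_PP wprod_gr)
    have "dif P.Q (P.gen w) \<in> carrier P.Q"
      using lin_map_closed[OF C.lin_map_dif P.gen_closed[OF w]] .
    then have "dif P.Q (P.gen w) = P.cls (word_dif R (dif A) w)"
      using P.dif_Q_if_closed[OF w] word_dif_PP(1)[OF w] by (simp add: wdif_PP)
    then show "mu R A (dif P.Q (P.gen w)) = dif A (mu R A (P.gen w))"
      using word_dif_PP[OF w] w by (simp add: mu_cls mu_gen)
  qed (rule C.lin_map_dif A.lin_map_dif)+
  then show ?thesis by (simp add: Q_eq)
qed

end


section \<open>The pushout of a relative free extension\<close>

lemma dga_mor_linear: "dga_mor R A B f \<Longrightarrow> lin_map R A B f"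
  by (auto simp: dga_mor_def ring_hom_def lin_map_def)

lemma dga_mor_mult: "dga_mor R A B f \<Longrightarrow> x \<in> carrier A \<Longrightarrow> y \<in> carrier A \<Longrightarrow> f (x \<otimes>\<^bsub>A\<^esub> y) = f x \<otimes>\<^bsub>B\<^esub> f y"
  and dga_mor_one: "dga_mor R A B f \<Longrightarrow> f \<one>\<^bsub>A\<^esub> = \<one>\<^bsub>B\<^esub>"
  and dga_mor_gr: "dga_mor R A B f \<Longrightarrow> x \<in> gr A i \<Longrightarrow> f x \<in> gr B i"
  and dga_mor_dif: "dga_mor R A B f \<Longrightarrow> x \<in> carrier A \<Longrightarrow> f (dif A x) = dif B (f x)"
  by (auto simp: dga_mor_def ring_hom_def image_subset_iff)

lemma dga_mor_comp: "dga_mor R A B f \<Longrightarrow> dga_mor R B C g \<Longrightarrow> dga_mor R A C (\<lambda>x. g (f x))"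
  by (auto simp: dga_mor_def ring_hom_def Pi_iff image_subset_iff)

text \<open>The base change argument for an arbitrary morphism \<open>f\<close> from
  \<open>C\<close> to \<open>A\<close>; it will be applied to the multiplication of a tensor
  power.\<close>

locale relative_free_extension =
  W: free_cga_words R W + C: cdga R C + A: cdga R A + E: cdga R "rel_free R C W d"
  for R :: "('r, 'q) ring_scheme" and W :: "('r, 'v) gmodule" and C :: "('r, 'c, 'm) dg_scheme"
    and A :: "('r, 'a, 'n) dg_scheme" and d +
  fixes f
  assumes incl: "dga_mor R C (rel_free R C W d) (incl R C (\<Lambda> R W))"
    and f: "dga_mor R C A f"
begin

abbreviation "L \<equiv> \<Lambda> R W"

sublocale GC: graded_alg R C by (rule C.graded_alg)
sublocale GA: graded_alg R A by (rule A.graded_alg)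
sublocale GL: graded_alg R L by (rule W.graded_alg)
sublocale TC: tensor_algs R C L ..
sublocale TA: tensor_algs R A L ..

abbreviation "E \<equiv> rel_free R C W d"

lemmas f_linear = dga_mor_linear[OF f]

lemma d_linear: "lin_map R TC.T TC.T d"
  using E.lin_map_dif by (simp add: rel_free_def)

text \<open>No sign appears because the two inner factors, both equal to one, have degree
  zero.\<close>

lemma pure_split_C: "c \<in> gr C i \<Longrightarrow> b \<in> gr L j \<Longrightarrow>
    TC.pu (i, c) (j, b) = TC.pu (i, c) (0, \<one>\<^bsub>L\<^esub>) \<otimes>\<^bsub>TC.T\<^esub> TC.pu (0, \<one>\<^bsub>C\<^esub>) (j, b)"
  using TC.pure_mult[of c i "\<one>\<^bsub>L\<^esub>" 0 "\<one>\<^bsub>C\<^esub>" 0 b j] GC.one_gr GL.one_gr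
  by (simp add: W.W.R.sg_zero C.mult_one W.one_mult GC.gr_closed GL.gr_closed TC.pure_closed module.smult_one[OF TC.module_T])

text \<open>The Leibniz rule for the split pure tensor; the first term is known because the
  inclusion of \<open>C\<close> commutes with the differentials. The result has the shape by which
  \<open>pushout_dif\<close> is prescribed.\<close>

lemma d_pure:
  assumes c: "c \<in> gr C i" and b: "b \<in> gr L j"
  shows "d (TC.pu (i, c) (j, b)) = TC.pu (i + 1, dif C c) (j, b)
    \<oplus>\<^bsub>TC.T\<^esub> sg R i \<odot>\<^bsub>TC.T\<^esub> (TC.pu (i, c) (0, \<one>\<^bsub>L\<^esub>) \<otimes>\<^bsub>TC.T\<^esub> d (TC.pu (0, \<one>\<^bsub>C\<^esub>) (j, b)))"
proof -
  have dc: "dif C c \<in> gr C (i + 1)" by (rule C.dif_degree[OF c])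
  have "TC.pu (i + 1, dif C c) (0, \<one>\<^bsub>L\<^esub>) = d (TC.pu (i, c) (0, \<one>\<^bsub>L\<^esub>))"
    using dga_mor_dif[OF incl GC.gr_closed[OF c]]
    by (simp add: TC.incl_homogeneous[OF C.graded_module_axioms c]
        TC.incl_homogeneous[OF C.graded_module_axioms dc] rel_free_def)
  moreover have "d (TC.pu (i, c) (0, \<one>\<^bsub>L\<^esub>) \<otimes>\<^bsub>TC.T\<^esub> TC.pu (0, \<one>\<^bsub>C\<^esub>) (j, b))
      = d (TC.pu (i, c) (0, \<one>\<^bsub>L\<^esub>)) \<otimes>\<^bsub>TC.T\<^esub> TC.pu (0, \<one>\<^bsub>C\<^esub>) (j, b)
        \<oplus>\<^bsub>TC.T\<^esub> sg R i \<odot>\<^bsub>TC.T\<^esub> (TC.pu (i, c) (0, \<one>\<^bsub>L\<^esub>) \<otimes>\<^bsub>TC.T\<^esub> d (TC.pu (0, \<one>\<^bsub>C\<^esub>) (j, b)))"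
    using E.leibniz[of "TC.pu (i, c) (0, \<one>\<^bsub>L\<^esub>)" i "TC.pu (0, \<one>\<^bsub>C\<^esub>) (j, b)"]
      TC.pure_gr[OF c GL.one_gr] TC.pure_closed[OF GC.one_gr b] by (simp add: rel_free_def)
  ultimately show ?thesis
    using pure_split_C[OF c b] pure_split_C[OF dc b] by simp
qed

section \<open>Base change along \<open>f\<close> and the differential of the pushout\<close>

abbreviation "ext \<equiv> tensor_map R A L f (\<lambda>x. x)"

lemma ext_bilinear: "TC.bilinear_on_pure TA.T (\<lambda>((i, a), (j, b)). TA.pu (i, f a) (j, b))"
  unfolding TC.bilinear_on_pure_def
  by (auto simp: dga_mor_gr[OF f] GC.gr_closed GA.gr_closed GL.gr_closed lin_map_add[OF f_linear] lin_map_smult[OF f_linear]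
      TA.pure_add_left TA.pure_add_right TA.pure_smult_left TA.pure_smult_right TA.pure_closed)

lemma ext_linear: "lin_map R TC.T TA.T ext"
  unfolding tensor_map_def by (rule TC.tensor_lift_linear[OF TA.module_T ext_bilinear])

lemma ext_pure: "c \<in> gr C i \<Longrightarrow> b \<in> gr L j \<Longrightarrow> ext (TC.pu (i, c) (j, b)) = TA.pu (i, f c) (j, b)"
  unfolding tensor_map_def by (subst TC.tensor_lift_pure[OF TA.module_T ext_bilinear]) auto

text \<open>Since \<open>f\<close> preserves degrees, the Koszul signs on the two sides
  agree.\<close>

lemma ext_mult_pure:
  assumes "c \<in> gr C i" "b \<in> gr L j" "c' \<in> gr C i'" "b' \<in> gr L j'"
  shows "ext (TC.pu (i, c) (j, b) \<otimes>\<^bsub>TC.T\<^esub> TC.pu (i', c') (j', b'))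
    = ext (TC.pu (i, c) (j, b)) \<otimes>\<^bsub>TA.T\<^esub> ext (TC.pu (i', c') (j', b'))"
  using assms
  by (simp add: TC.pure_mult TA.pure_mult ext_pure lin_map_smult[OF ext_linear] W.W.R.sg_closed TC.pure_closed
      GC.mult_gr GL.mult_gr dga_mor_gr[OF f] dga_mor_mult[OF f] GC.gr_closed)

lemma ext_mult: "x \<in> carrier TC.T \<Longrightarrow> y \<in> carrier TC.T \<Longrightarrow> ext (x \<otimes>\<^bsub>TC.T\<^esub> y) = ext x \<otimes>\<^bsub>TA.T\<^esub> ext y"
  by (rule TC.tensor_mult[OF TA.T.graded_alg_axioms ext_linear ext_mult_pure])

abbreviation "pd \<equiv> pushout_dif R C A f W d"

text \<open>\<open>pushout_dif\<close> is a \<open>lin_ext\<close>, and this check gives it the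
  prescribed values on pure tensors. The sign depends on the degree \<open>i\<close> alone, so it is
  constant where additivity is tested.\<close>

lemma pd_bilinear: "TA.bilinear_on_pure TA.T (\<lambda>((i, a), (j, w)).
    TA.pu (i + 1, dif A a) (j, w) \<oplus>\<^bsub>TA.T\<^esub>
    sg R i \<odot>\<^bsub>TA.T\<^esub> (TA.pu (i, a) (0, \<one>\<^bsub>L\<^esub>) \<otimes>\<^bsub>TA.T\<^esub> ext (d (TC.pu (0, \<one>\<^bsub>C\<^esub>) (j, w)))))"
proof -
  have e: "ext (d (TC.pu (0, \<one>\<^bsub>C\<^esub>) (j, w))) \<in> carrier TA.T" if "w \<in> gr L j" for j w
    using that by (intro lin_map_closed[OF ext_linear] lin_map_closed[OF d_linear] TC.pure_closed GC.one_gr)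
  have e_add: "ext (d (TC.pu (0, \<one>\<^bsub>C\<^esub>) (j, w \<oplus>\<^bsub>L\<^esub> w')))
      = ext (d (TC.pu (0, \<one>\<^bsub>C\<^esub>) (j, w))) \<oplus>\<^bsub>TA.T\<^esub> ext (d (TC.pu (0, \<one>\<^bsub>C\<^esub>) (j, w')))"
    if "w \<in> gr L j" "w' \<in> gr L j" for j w w'
    using that by (simp add: TC.pure_add_right GC.one_gr TC.pure_closed lin_map_add[OF lin_map_comp[OF d_linear ext_linear]])
  have e_smult: "ext (d (TC.pu (0, \<one>\<^bsub>C\<^esub>) (j, s \<odot>\<^bsub>L\<^esub> w)))
      = s \<odot>\<^bsub>TA.T\<^esub> ext (d (TC.pu (0, \<one>\<^bsub>C\<^esub>) (j, w)))"
    if "w \<in> gr L j" "s \<in> carrier R" for j w s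
    using that by (simp add: TC.pure_smult_right GC.one_gr TC.pure_closed lin_map_smult[OF lin_map_comp[OF d_linear ext_linear]])
  note [simp] = e TA.pure_closed GL.one_gr A.dif_degree W.W.R.sg_closed TA.T.mult_closed GA.gr_closed GL.gr_closed
  show ?thesis
    unfolding TA.bilinear_on_pure_def
    by (auto simp: e_add e_smult A.dif_add A.dif_smult TA.pure_add_left TA.pure_add_right
        TA.pure_smult_left TA.pure_smult_right TA.T.mult_add_left TA.T.mult_add_right
        TA.T.mult_smult_left TA.T.mult_smult_right TA.T.smult_r_distr TA.T.smult_left_commute
        TA.T.M.a_ac)
qed

lemma pd_linear: "lin_map R TA.T TA.T pd"
  unfolding pushout_dif_def by (rule TA.tensor_lift_linear[OF TA.module_T pd_bilinear])

lemma pd_pure: "a \<in> gr A i \<Longrightarrow> w \<in> gr L j \<Longrightarrow> pd (TA.pu (i, a) (j, w)) =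
    TA.pu (i + 1, dif A a) (j, w) \<oplus>\<^bsub>TA.T\<^esub>
    sg R i \<odot>\<^bsub>TA.T\<^esub> (TA.pu (i, a) (0, \<one>\<^bsub>L\<^esub>) \<otimes>\<^bsub>TA.T\<^esub> ext (d (TC.pu (0, \<one>\<^bsub>C\<^esub>) (j, w))))"
  unfolding pushout_dif_def by (subst TA.tensor_lift_pure[OF TA.module_T pd_bilinear]) auto

text \<open>Applying \<open>ext\<close> to \<open>d_pure\<close> term by term gives
  \<open>pd_pure\<close>; the differential of the pushout is made for this.\<close>

lemma ext_dga_mor: "dga_mor R E (pushout R C A f W d) ext"
proof -
  have "graded_alg R (TA.T\<lparr>dif := pd\<rparr>)"
    using TA.T.graded_alg_axioms by (simp add: graded_alg_dif_update)
  then have "dga_mor R (TC.T\<lparr>dif := d\<rparr>) (TA.T\<lparr>dif := pd\<rparr>) ext"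
  proof (rule TC.dga_mor_tensor)
    fix i a j b assume a: "a \<in> gr C i" and b: "b \<in> gr L j"
    show "ext (TC.pu (i, a) (j, b)) \<in> gr (TA.T\<lparr>dif := pd\<rparr>) (i + j)"
      using a b by (simp add: ext_pure TA.pure_gr dga_mor_gr[OF f])
    have [simp]: "d (TC.pu (0, \<one>\<^bsub>C\<^esub>) (j, b)) \<in> carrier TC.T"
      by (intro lin_map_closed[OF d_linear] TC.pure_closed GC.one_gr b)
    show "ext (d (TC.pu (i, a) (j, b))) = dif (TA.T\<lparr>dif := pd\<rparr>) (ext (TC.pu (i, a) (j, b)))"
      using a b
      by (simp add: d_pure ext_pure pd_pure lin_map_add[OF ext_linear] lin_map_smult[OF ext_linear]
          ext_mult TC.pure_closed C.dif_degree GL.one_gr TC.T.mult_closed W.W.R.sg_closed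
          dga_mor_gr[OF f] dga_mor_dif[OF f] GC.gr_closed)
  qed (simp_all add: ext_linear ext_mult_pure d_linear pd_linear ext_pure GC.one_gr GL.one_gr
      dga_mor_one[OF f] TA.one_T)
  then show ?thesis by (simp add: rel_free_def pushout_def)
qed

lemma extension_if_retraction:
  assumes \<sigma>: "dga_mor R (pushout R C A f W d) A \<sigma>" and retr: "\<forall>a\<in>carrier A. \<sigma> (incl R A L a) = a"
  shows "\<exists>\<rho>. dga_mor R E A \<rho> \<and> (\<forall>c\<in>carrier C. \<rho> (incl R C L c) = f c)"
proof (intro exI conjI ballI)
  show \<rho>: "dga_mor R E A (\<lambda>x. \<sigma> (ext x))"
    by (rule dga_mor_comp[OF ext_dga_mor \<sigma>])
  then have lin: "lin_map R TC.T A (\<lambda>x. \<sigma> (ext x))"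
    using dga_mor_linear[OF \<rho>] by (simp add: rel_free_def)
  fix c assume c: "c \<in> carrier C"
  \<comment> \<open>The identity is checked on homogeneous components. There \<open>ext\<close>
    carries the included component of \<open>c\<close> to the included element
    \<open>f (?c i)\<close> of \<open>A\<close>, and \<open>\<sigma>\<close> undoes the inclusion of
    \<open>A\<close>.\<close>
  let ?c = "hcomp C c" and ?I = "{i. hcomp C c i \<noteq> \<zero>\<^bsub>C\<^esub>}"
  have dec: "decomposition C c ?c" by (rule C.hcomp_decomposition[OF c])
  then have ci: "?c i \<in> gr C i" for i by (simp add: decomposition_def)
  have "\<sigma> (ext (incl R C L c)) = (\<Oplus>\<^bsub>A\<^esub>i\<in>?I. \<sigma> (ext (TC.pu (i, ?c i) (0, \<one>\<^bsub>L\<^esub>))))"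
    by (rule TC.lin_map_incl[OF C.graded_module_axioms A.module_axioms lin c])
  also have "\<dots> = (\<Oplus>\<^bsub>A\<^esub>i\<in>?I. f (?c i))"
  proof (rule A.M.finsum_cong')
    fix i
    have fi: "f (?c i) \<in> gr A i" by (rule dga_mor_gr[OF f ci])
    show "\<sigma> (ext (TC.pu (i, ?c i) (0, \<one>\<^bsub>L\<^esub>))) = f (?c i)"
      using retr[rule_format, OF GA.gr_closed[OF fi]]
      by (simp add: ext_pure[OF ci GL.one_gr] TA.incl_homogeneous[OF A.graded_module_axioms fi])
  qed (auto intro: GA.gr_closed dga_mor_gr[OF f ci])
  also have "\<dots> = f (\<Oplus>\<^bsub>C\<^esub>i\<in>?I. ?c i)"
    by (rule lin_map_finsum[OF f_linear C.module_axioms A.module_axioms, symmetric]) (auto intro: GC.gr_closed ci)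
  also have "\<dots> = f c" using dec by (simp add: decomposition_def)
  finally show "\<sigma> (ext (incl R C L c)) = f c" .
qed

lemma retraction_if_extension:
  assumes \<rho>: "dga_mor R E A \<rho>" and ext_f: "\<forall>c\<in>carrier C. \<rho> (incl R C L c) = f c"
  shows "\<exists>\<sigma>. dga_mor R (pushout R C A f W d) A \<sigma> \<and> (\<forall>a\<in>carrier A. \<sigma> (incl R A L a) = a)"
proof -
  \<comment> \<open>\<open>q\<close> is the restriction of \<open>\<rho>\<close> to the factor
    \<open>\<Lambda> R W\<close>. The degree is carried along because pure tensors are built from
    elements tagged with degrees.\<close>
  define q where "q j w = \<rho> (TC.pu (0, \<one>\<^bsub>C\<^esub>) (j, w))" for j w
  have \<rho>_linear: "lin_map R TC.T A \<rho>"
    using dga_mor_linear[OF \<rho>] by (simp add: rel_free_def)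
  have \<rho>_mult: "\<rho> (x \<otimes>\<^bsub>TC.T\<^esub> y) = \<rho> x \<otimes>\<^bsub>A\<^esub> \<rho> y" if "x \<in> carrier TC.T" "y \<in> carrier TC.T" for x y
    using dga_mor_mult[OF \<rho>] that by (simp add: rel_free_def)
  have \<rho>_dif: "\<rho> (d x) = dif A (\<rho> x)" if "x \<in> carrier TC.T" for x
    using dga_mor_dif[OF \<rho>] that by (simp add: rel_free_def)
  have q_gr: "q j w \<in> gr A j" if "w \<in> gr L j" for j w
    using dga_mor_gr[OF \<rho>, of "TC.pu (0, \<one>\<^bsub>C\<^esub>) (j, w)" j] TC.pure_gr[OF GC.one_gr that]
    by (simp add: q_def rel_free_def)
  have q_one: "q 0 \<one>\<^bsub>L\<^esub> = \<one>\<^bsub>A\<^esub>"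
    using dga_mor_one[OF \<rho>] by (simp add: q_def rel_free_def TC.one_T)
  \<comment> \<open>The one of \<open>C\<close> has degree zero, so the Koszul sign of this product
    is trivial.\<close>
  have q_mult: "q (j + j') (w \<otimes>\<^bsub>L\<^esub> w') = q j w \<otimes>\<^bsub>A\<^esub> q j' w'" if "w \<in> gr L j" "w' \<in> gr L j'" for j w j' w'
    using TC.pure_mult[OF GC.one_gr that(1) GC.one_gr that(2)]
      \<rho>_mult[OF TC.pure_closed[OF GC.one_gr that(1)] TC.pure_closed[OF GC.one_gr that(2)]] that
    by (simp add: q_def W.W.R.sg_zero C.mult_one GC.one_mem GC.one_gr TC.pure_closed GL.mult_gr module.smult_one[OF TC.module_T])
  define D where "D = (\<lambda>((i :: int, a), (j, w)). a \<otimes>\<^bsub>A\<^esub> q j w)"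
  have bil: "TA.bilinear_on_pure A D"
  proof -
    have "q j (w \<oplus>\<^bsub>L\<^esub> w') = q j w \<oplus>\<^bsub>A\<^esub> q j w'" if "w \<in> gr L j" "w' \<in> gr L j" for j w w'
      using that by (simp add: q_def TC.pure_add_right GC.one_gr lin_map_add[OF \<rho>_linear] TC.pure_closed)
    moreover have "q j (s \<odot>\<^bsub>L\<^esub> w) = s \<odot>\<^bsub>A\<^esub> q j w" if "w \<in> gr L j" "s \<in> carrier R" for j w s
      using that by (simp add: q_def TC.pure_smult_right GC.one_gr lin_map_smult[OF \<rho>_linear] TC.pure_closed)
    ultimately show ?thesis
      unfolding TA.bilinear_on_pure_def D_def
      by (auto simp: GA.gr_closed[OF q_gr] GA.gr_closed GA.mult_closed GA.mult_add_left GA.mult_add_right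
          GA.mult_smult_left GA.mult_smult_right)
  qed
  define \<sigma> where "\<sigma> = lin_ext R A D"
  have \<sigma>_linear: "lin_map R TA.T A \<sigma>"
    unfolding \<sigma>_def by (rule TA.tensor_lift_linear[OF A.module_axioms bil])
  have \<sigma>_pure: "\<sigma> (TA.pu (i, a) (j, w)) = a \<otimes>\<^bsub>A\<^esub> q j w" if "a \<in> gr A i" "w \<in> gr L j" for a i w j
    unfolding \<sigma>_def TA.tensor_lift_pure[OF A.module_axioms bil that] by (simp add: D_def)
  have \<sigma>_mult_pure: "\<sigma> (TA.pu (i, a) (j, w) \<otimes>\<^bsub>TA.T\<^esub> TA.pu (i', a') (j', w'))
      = \<sigma> (TA.pu (i, a) (j, w)) \<otimes>\<^bsub>A\<^esub> \<sigma> (TA.pu (i', a') (j', w'))"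
    if *: "a \<in> gr A i" "w \<in> gr L j" "a' \<in> gr A i'" "w' \<in> gr L j'" for i a j w i' a' j' w'
  proof -
    note [simp] = GA.gr_closed[OF *(1)] GA.gr_closed[OF *(3)] GA.gr_closed[OF q_gr[OF *(2)]]
      GA.gr_closed[OF q_gr[OF *(4)]] GA.mult_closed W.W.R.sg_closed
    \<comment> \<open>Moving \<open>q j w\<close> past \<open>a'\<close> inside \<open>A\<close>
      costs the same sign as the product of the two pure tensors.\<close>
    have "q j w \<otimes>\<^bsub>A\<^esub> a' = sg R (j * i') \<odot>\<^bsub>A\<^esub> (a' \<otimes>\<^bsub>A\<^esub> q j w)"
      by (rule A.graded_comm[OF q_gr[OF *(2)] *(3)])
    then have "(a \<otimes>\<^bsub>A\<^esub> q j w) \<otimes>\<^bsub>A\<^esub> (a' \<otimes>\<^bsub>A\<^esub> q j' w')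
        = a \<otimes>\<^bsub>A\<^esub> ((sg R (j * i') \<odot>\<^bsub>A\<^esub> (a' \<otimes>\<^bsub>A\<^esub> q j w)) \<otimes>\<^bsub>A\<^esub> q j' w')"
      by (metis A.mult_assoc GA.gr_closed GA.mult_closed q_gr *)
    also have "\<dots> = sg R (j * i') \<odot>\<^bsub>A\<^esub> ((a \<otimes>\<^bsub>A\<^esub> a') \<otimes>\<^bsub>A\<^esub> (q j w \<otimes>\<^bsub>A\<^esub> q j' w'))"
      by (simp add: GA.mult_smult_left GA.mult_smult_right A.mult_assoc)
    finally show ?thesis
      using * by (simp add: TA.pure_mult \<sigma>_pure lin_map_smult[OF \<sigma>_linear] TA.pure_closed GA.mult_gr GL.mult_gr q_mult)
  qed
  have \<sigma>_mult: "\<sigma> (x \<otimes>\<^bsub>TA.T\<^esub> y) = \<sigma> x \<otimes>\<^bsub>A\<^esub> \<sigma> y" if "x \<in> carrier TA.T" "y \<in> carrier TA.T" for x y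
    by (rule TA.tensor_mult[OF GA.graded_alg_axioms \<sigma>_linear \<sigma>_mult_pure that])
  \<comment> \<open>The hypothesis \<open>ext_f\<close> is used for this identity. It evaluates
    \<open>\<sigma>\<close> on the term \<open>ext (d ?y)\<close> of the pushout differential,
    giving \<open>\<rho> (d ?y)\<close> and thus the differential of \<open>q j b\<close>.\<close>
  have \<sigma>_ext: "\<sigma> (ext x) = \<rho> x" if "x \<in> carrier TC.T" for x
  proof (rule TC.tensor_eqI[OF lin_map_comp[OF ext_linear \<sigma>_linear] \<rho>_linear A.module_axioms _ that])
    fix i c j b assume c: "c \<in> gr C i" and b: "b \<in> gr L j"
    have "\<rho> (TC.pu (i, c) (0, \<one>\<^bsub>L\<^esub>)) = f c"
      using ext_f GC.gr_closed[OF c] TC.incl_homogeneous[OF C.graded_module_axioms c] by metis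
    then have "\<rho> (TC.pu (i, c) (j, b)) = f c \<otimes>\<^bsub>A\<^esub> q j b"
      using pure_split_C[OF c b] \<rho>_mult TC.pure_closed[OF c GL.one_gr] TC.pure_closed[OF GC.one_gr b]
      by (simp add: q_def)
    then show "\<sigma> (ext (TC.pu (i, c) (j, b))) = \<rho> (TC.pu (i, c) (j, b))"
      using c b by (simp add: ext_pure \<sigma>_pure dga_mor_gr[OF f])
  qed
  have "dga_mor R (TA.T\<lparr>dif := pd\<rparr>) A \<sigma>"
  proof (rule TA.dga_mor_tensor[OF GA.graded_alg_axioms \<sigma>_linear \<sigma>_mult_pure])
    show "\<sigma> (TA.pu (0, \<one>\<^bsub>A\<^esub>) (0, \<one>\<^bsub>L\<^esub>)) = \<one>\<^bsub>A\<^esub>"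
      by (simp add: \<sigma>_pure GA.one_gr GL.one_gr q_one A.mult_one GA.one_mem)
    fix i a j b assume a: "a \<in> gr A i" and b: "b \<in> gr L j"
    show "\<sigma> (TA.pu (i, a) (j, b)) \<in> gr A (i + j)"
      using a b by (simp add: \<sigma>_pure GA.mult_gr q_gr)
    let ?y = "TC.pu (0, \<one>\<^bsub>C\<^esub>) (j, b)"
    have y: "?y \<in> carrier TC.T" "d ?y \<in> carrier TC.T"
      using TC.pure_closed[OF GC.one_gr b] lin_map_closed[OF d_linear] by auto
    note [simp] = lin_map_closed[OF ext_linear y(2)] W.W.R.sg_closed
    have "\<sigma> (pd (TA.pu (i, a) (j, b))) = dif A a \<otimes>\<^bsub>A\<^esub> q j b \<oplus>\<^bsub>A\<^esub> sg R i \<odot>\<^bsub>A\<^esub> (a \<otimes>\<^bsub>A\<^esub> dif A (q j b))"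
      using a b y
      by (simp add: pd_pure lin_map_add[OF \<sigma>_linear] lin_map_smult[OF \<sigma>_linear] TA.pure_closed A.dif_degree
          GL.one_gr TA.T.mult_closed \<sigma>_mult \<sigma>_pure q_one A.mult_one GA.gr_closed \<sigma>_ext \<rho>_dif q_def[symmetric])
    also have "\<dots> = dif A (a \<otimes>\<^bsub>A\<^esub> q j b)"
      using A.leibniz[OF a GA.gr_closed[OF q_gr[OF b]]] by simp
    finally show "\<sigma> (pd (TA.pu (i, a) (j, b))) = dif A (\<sigma> (TA.pu (i, a) (j, b)))"
      using a b by (simp add: \<sigma>_pure)
  qed (assumption | rule pd_linear A.lin_map_dif)+
  moreover have "\<sigma> (incl R A L a) = a" if a: "a \<in> carrier A" for a
  proof -
    have dec: "decomposition A a (hcomp A a)" by (rule A.hcomp_decomposition[OF a])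
    then have ai: "hcomp A a i \<in> gr A i" for i by (simp add: decomposition_def)
    have "\<sigma> (incl R A L a) = (\<Oplus>\<^bsub>A\<^esub>i\<in>{i. hcomp A a i \<noteq> \<zero>\<^bsub>A\<^esub>}. \<sigma> (TA.pu (i, hcomp A a i) (0, \<one>\<^bsub>L\<^esub>)))"
      by (rule TA.lin_map_incl[OF A.graded_module_axioms A.module_axioms \<sigma>_linear a])
    also have "\<dots> = (\<Oplus>\<^bsub>A\<^esub>i\<in>{i. hcomp A a i \<noteq> \<zero>\<^bsub>A\<^esub>}. hcomp A a i)"
      by (rule A.M.finsum_cong')
        (auto simp: \<sigma>_pure[OF ai GL.one_gr] q_one A.mult_one GA.gr_closed[OF ai])
    also have "\<dots> = a" using dec by (simp add: decomposition_def)
    finally show ?thesis .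
  qed
  ultimately show ?thesis by (auto simp: rel_free_def pushout_def)
qed

end

theorem proposition4p1:
  fixes R :: "('r, 'q) ring_scheme" and r :: nat
  assumes pid: "principal_domain R"
    and half: "\<one>\<^bsub>R\<^esub> \<oplus>\<^bsub>R\<^esub> \<one>\<^bsub>R\<^esub> \<in> Units R"
    and r: "1 \<le> r"
  shows
    "(\<forall>(A :: ('r, 'a) dg) (B :: ('r, 'b) dg) \<phi> (Ms :: ('r, 'a, 'w) models).
        mild_cdga R r A \<longrightarrow> mild_cdga R r B \<longrightarrow>
        dga_mor R A B \<phi> \<longrightarrow> \<phi> ` carrier A = carrier B \<longrightarrow>
        cond_F R r (cohom A) \<longrightarrow> cond_F R r (cohom B) \<longrightarrow>
        model_family R r A B \<phi> Ms \<longrightarrow>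
        secat R A B \<phi> Ms =
          Inf {enat m | m W d. Ms m = Some (W, d) \<and>
            (\<exists>\<rho>. dga_mor R (pushout R (tpow R A (Suc m)) A (mu R A) W d) A \<rho> \<and>
                 (\<forall>a\<in>carrier A. \<rho> (incl R A (\<Lambda> R W) a) = a))})
     \<and>
     (\<forall>n (X :: 'x topology) x0 (L :: ('r, 'l) dgl) (V :: ('r, 'v) gmodule) d \<kappa>
        (Ms :: ('r, ('r, ('r, 'v) words) words, 'u) models).
        2 \<le> n \<longrightarrow>
        mild_cw R r X \<longrightarrow> x0 \<in> topspace X \<longrightarrow> torsion_free_loop_homology R X x0 \<longrightarrow>
        ah_lie R X x0 L \<longrightarrow> decomposable_model R L V d \<kappa> \<longrightarrow>
        model_family R r (tpow R ((\<Lambda> R V)\<lparr>dif := d\<rparr>) n) ((\<Lambda> R V)\<lparr>dif := d\<rparr>)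
          (mu R ((\<Lambda> R V)\<lparr>dif := d\<rparr>)) Ms \<longrightarrow>
        TC R r n X x0 L V d \<kappa> Ms =
          secat R (tpow R ((\<Lambda> R V)\<lparr>dif := d\<rparr>) n) ((\<Lambda> R V)\<lparr>dif := d\<rparr>)
            (mu R ((\<Lambda> R V)\<lparr>dif := d\<rparr>)) Ms)"
proof (intro conjI allI impI)
  fix A :: "('r, 'a) dg" and B :: "('r, 'b) dg" and \<phi> and Ms :: "('r, 'a, 'w) models"
  assume A: "mild_cdga R r A" and Ms: "model_family R r A B \<phi> Ms"
  \<comment> \<open>Both infima run over the same partial family \<open>Ms\<close>, so the two
    existence conditions are compared for one model at a time. The set in \<open>secat\<close> also
    asks for the model property, which \<open>model_family\<close> supplies.\<close>
  have iff: "(\<exists>\<rho>. dga_mor R (rel_free R (tpow R A (Suc m)) W d) A \<rho> \<and>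
          (\<forall>x\<in>carrier (tpow R A (Suc m)). \<rho> (incl R (tpow R A (Suc m)) (\<Lambda> R W) x) = mu R A x)) \<longleftrightarrow>
      (\<exists>\<rho>. dga_mor R (pushout R (tpow R A (Suc m)) A (mu R A) W d) A \<rho> \<and>
          (\<forall>a\<in>carrier A. \<rho> (incl R A (\<Lambda> R W) a) = a))"
    and model: "comm_model R (tpow R A (Suc m)) (quot_tpow R A B \<phi> (Suc m)) (proj_tpow R A B \<phi> (Suc m)) W d"
    if "Ms m = Some (W, d)" for m W d
  proof -
    have C: "cdga R (tpow R A (Suc m))"
      and model: "comm_model R (tpow R A (Suc m)) (quot_tpow R A B \<phi> (Suc m)) (proj_tpow R A B \<phi> (Suc m)) W d"
      using Ms that by (auto simp: model_family_def mild_cdga_def)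
    have cA: "cdga R A" using A by (simp add: mild_cdga_def)
    interpret mu: tensor_power R A "Suc m"
      by (intro tensor_power.intro tensor_power_axioms.intro cA C)
    interpret relative_free_extension R W "tpow R A (Suc m)" A d "mu R A"
      using model mu.mu_dga_mor
      by (intro relative_free_extension.intro free_cga_words.intro relative_free_extension_axioms.intro cA C)
        (auto simp: comm_model_def free_graded_def)
    show "comm_model R (tpow R A (Suc m)) (quot_tpow R A B \<phi> (Suc m)) (proj_tpow R A B \<phi> (Suc m)) W d"
      by (rule model)
    show "(\<exists>\<rho>. dga_mor R (rel_free R (tpow R A (Suc m)) W d) A \<rho> \<and>
          (\<forall>x\<in>carrier (tpow R A (Suc m)). \<rho> (incl R (tpow R A (Suc m)) (\<Lambda> R W) x) = mu R A x)) \<longleftrightarrow>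
      (\<exists>\<rho>. dga_mor R (pushout R (tpow R A (Suc m)) A (mu R A) W d) A \<rho> \<and>
          (\<forall>a\<in>carrier A. \<rho> (incl R A (\<Lambda> R W) a) = a))"
      using extension_if_retraction retraction_if_extension by blast
  qed
  show "secat R A B \<phi> Ms = Inf {enat m | m W d. Ms m = Some (W, d) \<and>
            (\<exists>\<rho>. dga_mor R (pushout R (tpow R A (Suc m)) A (mu R A) W d) A \<rho> \<and>
                 (\<forall>a\<in>carrier A. \<rho> (incl R A (\<Lambda> R W) a) = a))}"
    unfolding secat_def using iff model by (intro arg_cong[where f = Inf] Collect_cong) blast
next
  fix n and X :: "'x topology" and x0 and L :: "('r, 'l) dgl" and V :: "('r, 'v) gmodule" and d \<kappa>
    and Ms :: "('r, ('r, ('r, 'v) words) words, 'u) models"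
  assume "mild_cw R r X" "x0 \<in> topspace X" "torsion_free_loop_homology R X x0" "ah_lie R X x0 L"
    "decomposable_model R L V d \<kappa>"
  \<comment> \<open>In this setting \<open>TC\<close> takes its meaningful branch, which is
    \<open>secat\<close> of the \<open>n\<close>-fold product written out.\<close>
  then have "tc_setting R r X x0 L V d \<kappa>" by (simp add: tc_setting_def)
  then show "TC R r n X x0 L V d \<kappa> Ms = secat R (tpow R ((\<Lambda> R V)\<lparr>dif := d\<rparr>) n) ((\<Lambda> R V)\<lparr>dif := d\<rparr>)
      (mu R ((\<Lambda> R V)\<lparr>dif := d\<rparr>)) Ms"
    by (simp add: TC_def secat_def Let_def)
qed

end
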